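(* Let $T>0$, $\theta\in[0,1]$, and let $\nu\in L^1(0,T)$ with $\nu>0$. Put $(J_\nu g)(x)=\int_0^x\nu(x-s)g(s)\,ds$ and $N(x)=\int_0^x\nu(s)\,ds$. If $\theta<1/2$, then there exists a constant $c_\theta>0$ such that $$\|J_\nu g\|_{H^\theta(0,T)}\le c_\theta\,N(T)\,\|g\|_{H^\theta(0,T)}\qquad\forall g\in H^\theta(0,T).$$ Moreover, if $\theta>1/2$, then there exists a constant $c_\theta>0$ such that the same inequality holds for all $g\in H^\theta(0,T)$ satisfying $g(0)=0$.
   Context: Functions are real-valued. For $\theta\in(0,1)$, $H^\theta(a,b)=\{g\in L^2(a,b):[g]_{\dot H^\theta(a,b)}^2<\infty\}$ with $[g]_{\dot H^\theta(a,b)}^2=\int_{[a,b]^2}\frac{|g(x)-g(y)|^2}{|x-y|^{1+2\theta}}\,dy\,dx$ and norm $\|g\|_{H^\theta(a,b)}^2=\|g\|_{L^2(a,b)}^2+[g]_{\dot H^\theta(a,b)}^2$. $\theta=1$ means the usual Sobolev space $H^1$, and $\theta=0$ means $L^2$. For $\theta>1/2$, elements of $H^\theta(0,T)$ are identified with their continuous representatives on $[0,T]$, so $g(0)$ is meaningful. *)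

theory Defs
  imports "HOL-Analysis.Analysis"
begin

text \<open>
  Elements of the spaces below are represented by arbitrary Lebesgue measurable representatives
  \<open>g :: real \<Rightarrow> real\<close>; the values of \<open>g\<close> outside the interval, or on a null set, are irrelevant.
\<close>

definition L2_space :: "real \<Rightarrow> real \<Rightarrow> (real \<Rightarrow> real) set" where
  "L2_space a b = {g. g \<in> borel_measurable (lebesgue_on {a<..<b}) \<and>
                      integrable (lebesgue_on {a<..<b}) (\<lambda>x. (g x)\<^sup>2)}"

definition L2_norm_sq :: "real \<Rightarrow> real \<Rightarrow> (real \<Rightarrow> real) \<Rightarrow> real" where
  "L2_norm_sq a b g = (LINT x|lebesgue_on {a<..<b}. (g x)\<^sup>2)"

text \<open>
  The square of the Gagliardo seminorm, with value \<open>\<infinity>\<close> allowed. On the diagonal the integrand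
  is \<open>0 / 0 = 0\<close>.
\<close>

definition gagliardo_sq :: "real \<Rightarrow> real \<Rightarrow> real \<Rightarrow> (real \<Rightarrow> real) \<Rightarrow> ennreal" where
  "gagliardo_sq \<theta> a b g =
     (\<integral>\<^sup>+x. (\<integral>\<^sup>+y. ennreal (\<bar>g x - g y\<bar>\<^sup>2 / \<bar>x - y\<bar> powr (1 + 2 * \<theta>)) \<partial>lebesgue_on {a..b})
        \<partial>lebesgue_on {a..b})"

definition test_function :: "real \<Rightarrow> real \<Rightarrow> (real \<Rightarrow> real) \<Rightarrow> bool" where
  "test_function a b \<phi> \<longleftrightarrow>
     (\<forall>n x. ((deriv ^^ n) \<phi>) field_differentiable (at x)) \<and>
     (\<exists>K. compact K \<and> K \<subseteq> {a<..<b} \<and> (\<forall>x. x \<notin> K \<longrightarrow> \<phi> x = 0))"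

definition locally_integrable :: "real \<Rightarrow> real \<Rightarrow> (real \<Rightarrow> real) \<Rightarrow> bool" where
  "locally_integrable a b g \<longleftrightarrow>
     (\<forall>K. compact K \<and> K \<subseteq> {a<..<b} \<longrightarrow> integrable (lebesgue_on K) g)"

definition has_weak_deriv :: "real \<Rightarrow> real \<Rightarrow> (real \<Rightarrow> real) \<Rightarrow> (real \<Rightarrow> real) \<Rightarrow> bool" where
  "has_weak_deriv a b g h \<longleftrightarrow>
     locally_integrable a b g \<and> locally_integrable a b h \<and>
     (\<forall>\<phi>. test_function a b \<phi> \<longrightarrow>
        (LINT x|lebesgue_on {a<..<b}. g x * deriv \<phi> x) =
        - (LINT x|lebesgue_on {a<..<b}. h x * \<phi> x))"

text \<open>Weak derivatives are unique up to null sets of \<open>(a, b)\<close>, so the choice does not affect integrals.\<close>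

definition weak_deriv :: "real \<Rightarrow> real \<Rightarrow> (real \<Rightarrow> real) \<Rightarrow> (real \<Rightarrow> real)" where
  "weak_deriv a b g = (SOME h. has_weak_deriv a b g h)"

definition H_space :: "real \<Rightarrow> real \<Rightarrow> real \<Rightarrow> (real \<Rightarrow> real) set" where
  "H_space \<theta> a b =
     (if \<theta> = 0 then L2_space a b
      else if \<theta> = 1 then {g \<in> L2_space a b. \<exists>h \<in> L2_space a b. has_weak_deriv a b g h}
      else {g \<in> L2_space a b. gagliardo_sq \<theta> a b g < \<infinity>})"

text \<open>The norm is meaningful only for elements of \<open>H_space \<theta> a b\<close>.\<close>

definition H_norm :: "real \<Rightarrow> real \<Rightarrow> real \<Rightarrow> (real \<Rightarrow> real) \<Rightarrow> real" where
  "H_norm \<theta> a b g =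
     (if \<theta> = 0 then sqrt (L2_norm_sq a b g)
      else if \<theta> = 1 then sqrt (L2_norm_sq a b g + L2_norm_sq a b (weak_deriv a b g))
      else sqrt (L2_norm_sq a b g + enn2real (gagliardo_sq \<theta> a b g)))"

definition continuous_rep :: "real \<Rightarrow> real \<Rightarrow> (real \<Rightarrow> real) \<Rightarrow> (real \<Rightarrow> real) \<Rightarrow> bool" where
  "continuous_rep a b g u \<longleftrightarrow>
     continuous_on {a..b} u \<and> (AE x in lebesgue_on {a<..<b}. u x = g x)"

definition positive_kernel :: "real \<Rightarrow> (real \<Rightarrow> real) \<Rightarrow> bool" where
  "positive_kernel T \<nu> \<longleftrightarrow>
     integrable (lebesgue_on {0<..<T}) \<nu> \<and> (AE x in lebesgue_on {0<..<T}. \<nu> x > 0)"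

text \<open>
  For \<open>\<nu>\<close> integrable and \<open>g\<close> square integrable on \<open>(0, T)\<close>, the integrand is integrable for
  almost every \<open>x\<close> in \<open>(0, T)\<close>; where it is not integrable, the value is \<open>0\<close>
  by the library's convention.
\<close>

definition J :: "(real \<Rightarrow> real) \<Rightarrow> (real \<Rightarrow> real) \<Rightarrow> real \<Rightarrow> real" where
  "J \<nu> g x = (LINT s|lebesgue_on {0..x}. \<nu> (x - s) * g s)"

definition N :: "(real \<Rightarrow> real) \<Rightarrow> real \<Rightarrow> real" where
  "N \<nu> x = (LINT s|lebesgue_on {0..x}. \<nu> s)"

end

theory Submission
  imports Defs
begin

text \<open>
Extend \<open>g\<close> by zero to the negative axis. For \<open>x \<in> [0,T]\<close> the Volterra integral is then the
average \<open>\<integral>\<nu> s * g (x - s) ds\<close> of translates of \<open>g\<close>, so a translation invariant norm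
of \<open>J \<nu> g\<close> is at most \<open>N \<nu> T\<close> times that norm of the extended function. This settles
\<open>\<theta> = 0\<close> (\<open>J_L2\<close>). For \<open>0 < \<theta> < 1\<close> it bounds the Gagliardo seminorm of
\<open>J \<nu> g\<close> on \<open>[0,T]\<close> by that of the extension on \<open>[-T,T]\<close> (\<open>conv_gagliardo\<close>).
Instead of Minkowski's integral inequality, Cauchy--Schwarz for the measure \<open>\<nu> s ds\<close> is used,
followed by Tonelli's theorem.

It remains to bound the extension by \<open>g\<close> itself. The jump that the extension may have at
\<open>0\<close> costs the Hardy integral \<open>\<integral>(g x)\<^sup>2 * x powr (-2 * \<theta>) dx\<close>
(\<open>gagliardo_zero_extension\<close>), and this is where the two cases separate. For \<open>\<theta> < 1/2\<close> it
is bounded by the norm of \<open>g\<close> without any condition: comparing \<open>g\<close> at the scale \<open>x\<close>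
with a much larger scale contracts the integral (\<open>hardy_below_half\<close>). For \<open>\<theta> > 1/2\<close> the
comparison has to go down towards \<open>0\<close>, where the value is known because \<open>g 0 = 0\<close>
(\<open>hardy_above_half\<close>).

For \<open>\<theta> = 1\<close> the condition \<open>g 0 = 0\<close> says that \<open>g\<close> is the primitive of its weak
derivative \<open>h\<close>. Convolution commutes with taking primitives, so \<open>J \<nu> h\<close> is a weak derivative
of \<open>J \<nu> g\<close> (\<open>J_weak_derivative\<close>), and the \<open>L\<^sup>2\<close> bound applies to both. As the norm of
\<open>H\<^sup>1\<close> is stated with an arbitrary choice of weak derivative, uniqueness up to null sets is needed
(\<open>weak_derivative_unique\<close>); it follows from the fundamental lemma of the calculus of variations, for
which smooth bumps \<open>exp (- c / ((x - a) * (b - x)))\<close> are constructed.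
\<close>

section \<open>Borel representatives\<close>

text \<open>
Tonelli's theorem is applied to iterated Lebesgue integrals below, and it needs joint measurability.
Lebesgue measurable functions need not compose with \<open>x - s\<close> to jointly measurable
functions for the product measure, whereas Borel functions do; hence the passage to a Borel
representative, set to \<open>0\<close> outside the interval so that no indicator has to be carried along.
\<close>
lemma borel_representative:
  fixes g :: "real \<Rightarrow> real"
  assumes g: "g \<in> borel_measurable (lebesgue_on S)" and S: "S \<in> sets borel"
  obtains f where "f \<in> borel_measurable borel" "\<And>x. x \<notin> S \<Longrightarrow> f x = 0"
    "AE x in lborel. x \<in> S \<longrightarrow> g x = f x"
proof -
  have "(\<lambda>x. if x \<in> S then g x else 0) \<in> borel_measurable lebesgue"
    using g S by (simp add: borel_measurable_if)
  then obtain f where f: "f \<in> borel_measurable lborel"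
      "AE x in lborel. (if x \<in> S then g x else 0) = f x"
    using completion_ex_borel_measurable_real by blast
  show ?thesis
  proof
    show "(\<lambda>x. if x \<in> S then f x else 0) \<in> borel_measurable borel"
      using f(1) S by (intro measurable_If_set) auto
    show "AE x in lborel. x \<in> S \<longrightarrow> g x = (if x \<in> S then f x else 0)"
      using f(2) by (rule AE_mp) auto
  qed auto
qed

lemma AE_lebesgue_on_iff:
  assumes "S \<in> sets borel"
  shows "(AE x in lebesgue_on S. P x) \<longleftrightarrow> (AE x in lborel. x \<in> S \<longrightarrow> P x)"
  using assms by (simp add: AE_restrict_space_iff AE_completion_iff)

lemma measurable_lebesgue_on_of_borel:
  fixes g f :: "real \<Rightarrow> real"
  assumes f: "f \<in> borel_measurable borel" and S: "S \<in> sets borel"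
    and ae: "AE x in lborel. x \<in> S \<longrightarrow> g x = f x"
  shows "g \<in> borel_measurable (lebesgue_on S)"
proof -
  have "(\<lambda>x. if x \<in> S then f x else 0) \<in> borel_measurable lebesgue"
    using f S by (intro measurable_completion measurable_If_set) auto
  then have "(\<lambda>x. if x \<in> S then g x else 0) \<in> borel_measurable lebesgue"
    by (rule borel_measurable_AE) (use ae in \<open>auto simp: AE_completion_iff elim: AE_mp\<close>)
  then show ?thesis using S by (simp add: borel_measurable_if)
qed

lemma integral_lebesgue_on_of_borel:
  fixes g f :: "real \<Rightarrow> real"
  assumes f: "f \<in> borel_measurable borel" and S: "S \<in> sets borel"
    and ae: "AE x in lborel. x \<in> S \<longrightarrow> g x = f x"
    and out: "\<And>x. x \<notin> S \<Longrightarrow> f x = 0"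
  shows "integrable (lebesgue_on S) g \<longleftrightarrow> integrable lborel f"
    and "(LINT x|lebesgue_on S. g x) = (LINT x|lborel. f x)"
proof -
  have Sl: "S \<in> sets lebesgue" using S by simp
  have fS: "f \<in> borel_measurable (lebesgue_on S)"
    using f S by (intro measurable_lebesgue_on_of_borel[of f]) auto
  have gS: "g \<in> borel_measurable (lebesgue_on S)"
    using f S ae by (rule measurable_lebesgue_on_of_borel)
  have eq: "AE x in lebesgue_on S. g x = f x"
    using ae S by (simp add: AE_lebesgue_on_iff)
  have ind: "indicat_real S x * f x = f x" for x
    using out[of x] by (auto simp: indicator_def)
  have "integrable (lebesgue_on S) g \<longleftrightarrow> integrable (lebesgue_on S) f"
    using gS fS eq by (rule integrable_cong_AE)
  also have "\<dots> \<longleftrightarrow> integrable lebesgue f"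
    using Sl by (simp add: integrable_restrict_space set_integrable_def ind)
  also have "\<dots> \<longleftrightarrow> integrable lborel f"
    using f by (intro integrable_completion) simp
  finally show "integrable (lebesgue_on S) g \<longleftrightarrow> integrable lborel f" .
  have "(LINT x|lebesgue_on S. g x) = (LINT x|lebesgue_on S. f x)"
    using gS fS eq by (rule integral_cong_AE)
  also have "\<dots> = (LINT x|lebesgue. f x)"
    using Sl by (simp add: integral_restrict_space set_lebesgue_integral_def ind)
  also have "\<dots> = (LINT x|lborel. f x)"
    using f by (intro integral_completion) simp
  finally show "(LINT x|lebesgue_on S. g x) = (LINT x|lborel. f x)" .
qed

lemma nn_integral_lebesgue_on:
  assumes "S \<in> sets borel"
  shows "(\<integral>\<^sup>+x. F x \<partial>lebesgue_on S) = (\<integral>\<^sup>+x. F x * indicator S x \<partial>lborel)"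
  using assms by (simp add: nn_integral_restrict_space nn_integral_completion)

text \<open>
The predicate need not be measurable, so its exceptional set is first enclosed in a Borel null set.
\<close>
lemma AE_lborel_affine:
  fixes t c :: real
  assumes "AE x in lborel. P x" and c: "c \<noteq> 0"
  shows "AE s in lborel. P (t + c * s)"
proof -
  obtain A where A: "{x. \<not> P x} \<subseteq> A" "A \<in> null_sets lborel"
    using assms(1) by (auto elim!: AE_E simp: null_sets_def)
  then have "AE x in lborel. x \<notin> A"
    by (simp add: AE_not_in)
  then have "AE s in lborel. t + c * s \<notin> A"
    using A c by (intro AE_borel_affine) auto
  then show ?thesis
    using A by (auto elim: AE_mp)
qed

section \<open>Convolution estimates\<close>

definition conv :: "(real \<Rightarrow> real) \<Rightarrow> (real \<Rightarrow> real) \<Rightarrow> real \<Rightarrow> real" where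
  "conv n f x = (LINT s|lborel. n s * f (x - s))"

lemma conv_measurable [measurable]:
  assumes [measurable]: "n \<in> borel_measurable borel" "f \<in> borel_measurable borel"
  shows "conv n f \<in> borel_measurable borel"
  unfolding conv_def by measurable

text \<open>
Since both representatives vanish outside \<open>(0,T)\<close>, the product \<open>n (x - s) * f s\<close> is
supported in \<open>[0,x]\<close>, so the Volterra integral becomes a convolution on the whole line. The identity
holds at every point of \<open>[0,T]\<close>, also where the integrand is not integrable: both sides then take
the same conventional value.
\<close>
lemma J_eq_conv:
  assumes n: "n \<in> borel_measurable borel" "\<And>x. x \<notin> {0<..<T} \<Longrightarrow> n x = 0"
    "AE x in lborel. x \<in> {0<..<T} \<longrightarrow> \<nu> x = n x"
    and f: "f \<in> borel_measurable borel" "\<And>x. x \<notin> {0<..<T} \<Longrightarrow> f x = 0"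
    "AE x in lborel. x \<in> {0<..<T} \<longrightarrow> g x = f x"
    and x: "x \<in> {0..T}"
  shows "J \<nu> g x = conv n f x"
proof -
  note [measurable] = n(1) f(1)
  have "AE s in lborel. x + (-1) * s \<in> {0<..<T} \<longrightarrow> \<nu> (x + (-1) * s) = n (x + (-1) * s)"
    using n(3) by (rule AE_lborel_affine) simp
  moreover have "AE s in lborel. s \<noteq> 0" "AE s in lborel. s \<noteq> x"
    by (auto intro: AE_lborel_singleton)
  ultimately have ae: "AE s in lborel. s \<in> {0..x} \<longrightarrow> \<nu> (x - s) * g s = n (x - s) * f s"
    using f(3) by eventually_elim (use x in auto)
  have "J \<nu> g x = (LINT s|lborel. n (x - s) * f s)"
    unfolding J_def
    by (rule integral_lebesgue_on_of_borel(2)[OF _ _ ae]) (use n(2) f(2) in auto)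
  also have "\<dots> = conv n f x"
    unfolding conv_def by (subst lborel_integral_real_affine[where c="-1" and t=x]) auto
  finally show ?thesis .
qed

lemma integrable_convolution_product:
  fixes n h :: "real \<Rightarrow> real"
  assumes n: "integrable lborel n" and h: "integrable lborel h"
  shows "integrable (lborel \<Otimes>\<^sub>M lborel) (\<lambda>(s, r). n s * h (r - s))"
proof (rule lborel_pair.Fubini_integrable)
  note [measurable] = borel_measurable_integrable[OF n, simplified] borel_measurable_integrable[OF h, simplified]
  show "(\<lambda>(s, r). n s * h (r - s)) \<in> borel_measurable (lborel \<Otimes>\<^sub>M lborel)" by measurable
  have tr: "integrable lborel (\<lambda>r. h (r - s))" for s
    using lborel_integrable_real_affine[OF h, of 1 "-s"] by simp
  then show "AE s in lborel. integrable lborel (\<lambda>r. case (s, r) of (s, r) \<Rightarrow> n s * h (r - s))" by simp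
  have "(LINT r|lborel. norm (n s * h (r - s))) = \<bar>n s\<bar> * (LINT r|lborel. \<bar>h r\<bar>)" for s
    using lborel_integral_real_affine[of 1 "\<lambda>r. \<bar>h r\<bar>" "-s"] by (simp add: abs_mult)
  then show "integrable lborel (\<lambda>s. LINT r|lborel. norm (case (s, r) of (s, r) \<Rightarrow> n s * h (r - s)))"
    using n by simp
qed

lemma AE_convolution_integrable:
  fixes n f :: "real \<Rightarrow> real"
  assumes "integrable lborel n" and "integrable lborel f"
  shows "AE x in lborel. integrable lborel (\<lambda>s. n s * f (x - s))"
  using lborel_pair.AE_integrable_snd[OF integrable_convolution_product[OF assms]] by simp

text \<open>
Cauchy--Schwarz for the splitting \<open>n F = sqrt n (sqrt n F)\<close>. It plays the role of Minkowski's
integral inequality: applied to \<open>F s = f (x - s)\<close>, or to a difference of two such translates, it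
bounds the square of a convolution by an average of squares of translates.
\<close>
lemma weighted_square_integral:
  fixes n F :: "'a \<Rightarrow> real"
  assumes n [measurable]: "n \<in> borel_measurable M" and nn: "\<And>s. 0 \<le> n s"
    and F [measurable]: "F \<in> borel_measurable M"
  shows "ennreal ((LINT s|M. n s * F s)\<^sup>2) \<le> (\<integral>\<^sup>+s. n s \<partial>M) * (\<integral>\<^sup>+s. ennreal (n s * (F s)\<^sup>2) \<partial>M)"
proof (cases "integrable M (\<lambda>s. n s * F s)")
  case True
  have "ennreal ((LINT s|M. n s * F s)\<^sup>2) = (ennreal (norm (LINT s|M. n s * F s)))\<^sup>2"
    by (simp add: ennreal_power)
  also have "\<dots> \<le> (\<integral>\<^sup>+s. norm (n s * F s) \<partial>M)\<^sup>2"
    by (intro power_mono integral_norm_bound_ennreal True) simp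
  also have "(\<integral>\<^sup>+s. norm (n s * F s) \<partial>M) = (\<integral>\<^sup>+s. ennreal (sqrt (n s)) * ennreal (sqrt (n s) * \<bar>F s\<bar>) \<partial>M)"
    by (intro nn_integral_cong) (simp add: nn abs_mult ennreal_mult' [symmetric] mult.assoc[symmetric])
  also have "\<dots>\<^sup>2 \<le> (\<integral>\<^sup>+s. (ennreal (sqrt (n s)))\<^sup>2 \<partial>M) * (\<integral>\<^sup>+s. (ennreal (sqrt (n s) * \<bar>F s\<bar>))\<^sup>2 \<partial>M)"
    by (rule Cauchy_Schwarz_nn_integral) measurable
  also have "\<dots> = (\<integral>\<^sup>+s. n s \<partial>M) * (\<integral>\<^sup>+s. ennreal (n s * (F s)\<^sup>2) \<partial>M)"
    by (simp add: ennreal_power nn power_mult_distrib)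
  finally show ?thesis .
qed (simp add: not_integrable_integral_eq)

lemma conv_L2:
  assumes n [measurable]: "n \<in> borel_measurable borel" and nn: "\<And>s. 0 \<le> n s"
    and f [measurable]: "f \<in> borel_measurable borel"
  shows "(\<integral>\<^sup>+x. ennreal ((conv n f x)\<^sup>2) \<partial>lborel) \<le> (\<integral>\<^sup>+s. n s \<partial>lborel)\<^sup>2 * (\<integral>\<^sup>+x. ennreal ((f x)\<^sup>2) \<partial>lborel)"
proof -
  define A where "A = (\<integral>\<^sup>+s. ennreal (n s) \<partial>lborel)"
  have "(\<integral>\<^sup>+x. ennreal ((conv n f x)\<^sup>2) \<partial>lborel) \<le> (\<integral>\<^sup>+x. A * (\<integral>\<^sup>+s. ennreal (n s * (f (x - s))\<^sup>2) \<partial>lborel) \<partial>lborel)"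
    unfolding conv_def A_def by (intro nn_integral_mono weighted_square_integral) (auto simp: nn)
  also have "\<dots> = A * (\<integral>\<^sup>+x. \<integral>\<^sup>+s. ennreal (n s * (f (x - s))\<^sup>2) \<partial>lborel \<partial>lborel)"
    by (rule nn_integral_cmult) measurable
  also have "(\<integral>\<^sup>+x. \<integral>\<^sup>+s. ennreal (n s * (f (x - s))\<^sup>2) \<partial>lborel \<partial>lborel)
      = (\<integral>\<^sup>+s. \<integral>\<^sup>+x. ennreal (n s * (f (x - s))\<^sup>2) \<partial>lborel \<partial>lborel)"
    by (rule lborel_pair.Fubini') measurable
  also have "\<dots> = (\<integral>\<^sup>+s. n s * (\<integral>\<^sup>+x. ennreal ((f x)\<^sup>2) \<partial>lborel) \<partial>lborel)"
  proof (intro nn_integral_cong)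
    fix s :: real
    show "(\<integral>\<^sup>+x. ennreal (n s * (f (x - s))\<^sup>2) \<partial>lborel) = n s * (\<integral>\<^sup>+x. ennreal ((f x)\<^sup>2) \<partial>lborel)"
      using nn_integral_real_affine[of "\<lambda>x. ennreal ((f x)\<^sup>2)" 1 "-s"]
      by (simp add: ennreal_mult nn nn_integral_cmult)
  qed
  also have "\<dots> = A * (\<integral>\<^sup>+x. ennreal ((f x)\<^sup>2) \<partial>lborel)"
    unfolding A_def by (rule nn_integral_multc) measurable
  finally show ?thesis
    by (simp add: A_def power2_eq_square mult.assoc)
qed

lemma gagliardo_sq_lborel:
  "gagliardo_sq \<theta> a b g = (\<integral>\<^sup>+x. (\<integral>\<^sup>+y. ennreal ((g x - g y)\<^sup>2 / \<bar>x - y\<bar> powr (1 + 2 * \<theta>))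
      * indicator {a..b} y \<partial>lborel) * indicator {a..b} x \<partial>lborel)"
  unfolding gagliardo_sq_def by (simp add: nn_integral_lebesgue_on)

lemma gagliardo_sq_cong_AE:
  assumes "AE x in lborel. x \<in> {a<..<b} \<longrightarrow> g x = f x"
  shows "gagliardo_sq \<theta> a b g = gagliardo_sq \<theta> a b f"
proof -
  have *: "AE x in lebesgue_on {a..b}. g x = f x"
  proof (subst AE_lebesgue_on_iff)
    have "AE s in lborel. s \<noteq> a" "AE s in lborel. s \<noteq> b"
      by (auto intro: AE_lborel_singleton)
    with assms show "AE x in lborel. x \<in> {a..b} \<longrightarrow> g x = f x"
      by eventually_elim auto
  qed simp
  show ?thesis
    unfolding gagliardo_sq_def
  proof (rule nn_integral_cong_AE, use * in eventually_elim)
    fix x assume x: "g x = f x"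
    show "(\<integral>\<^sup>+y. ennreal (\<bar>g x - g y\<bar>\<^sup>2 / \<bar>x - y\<bar> powr (1 + 2 * \<theta>)) \<partial>lebesgue_on {a..b})
        = (\<integral>\<^sup>+y. ennreal (\<bar>f x - f y\<bar>\<^sup>2 / \<bar>x - y\<bar> powr (1 + 2 * \<theta>)) \<partial>lebesgue_on {a..b})"
      by (rule nn_integral_cong_AE, use * in eventually_elim) (simp add: x)
  qed
qed

text \<open>
For fixed \<open>s\<close> the seminorm over \<open>[0,T]\<close> of the translate \<open>f (x - s)\<close> is the
seminorm of \<open>f\<close> over \<open>[-s, T-s]\<close>, which is at most that over \<open>[-T,T]\<close>; here
\<open>0 < s < T\<close> because of the support of \<open>n\<close>. Averaging over \<open>s\<close> with weight
\<open>n\<close> costs one factor \<open>\<integral>n\<close>, and Cauchy--Schwarz the other one.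
\<close>
lemma conv_gagliardo:
  assumes n: "integrable lborel n" and nn: "\<And>s. 0 \<le> n s" and n0: "\<And>s. s \<notin> {0<..<T} \<Longrightarrow> n s = 0"
    and f: "integrable lborel f"
  shows "gagliardo_sq \<theta> 0 T (conv n f) \<le> (\<integral>\<^sup>+s. n s \<partial>lborel)\<^sup>2 * gagliardo_sq \<theta> (-T) T f"
proof -
  note [measurable] = borel_measurable_integrable[OF n, simplified] borel_measurable_integrable[OF f, simplified]
  define A where "A = (\<integral>\<^sup>+s. ennreal (n s) \<partial>lborel)"
  define w where "w x y = 1 / \<bar>x - y\<bar> powr (1 + 2 * \<theta>)" for x y :: real
  have w: "0 \<le> w x y" and wtr: "w (x - s) (y - s) = w x y" for x y s by (simp_all add: w_def)
  have [measurable]: "case_prod w \<in> borel_measurable (borel \<Otimes>\<^sub>M borel)"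
    unfolding w_def by measurable
  define D where "D x y = ennreal ((f x - f y)\<^sup>2 * w x y)" for x y
  have [measurable]: "case_prod D \<in> borel_measurable (borel \<Otimes>\<^sub>M borel)"
    unfolding D_def by measurable
  define I :: "real \<Rightarrow> ennreal" where "I = indicator {0..T}"
  have [measurable]: "I \<in> borel_measurable borel" unfolding I_def by measurable
  have Isq: "I x * I x = I x" for x by (auto simp: I_def indicator_def)
  note ae = AE_convolution_integrable[OF n f]
  have pt: "ennreal ((conv n f x - conv n f y)\<^sup>2 * w x y) \<le> A * (\<integral>\<^sup>+s. n s * D (x - s) (y - s) \<partial>lborel)"
    if "integrable lborel (\<lambda>s. n s * f (x - s))" "integrable lborel (\<lambda>s. n s * f (y - s))" for x y
  proof -
    have "conv n f x - conv n f y = (LINT s|lborel. n s * (f (x - s) - f (y - s)))"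
      unfolding conv_def by (subst Bochner_Integration.integral_diff[symmetric, OF that]) (simp add: algebra_simps)
    then have "ennreal ((conv n f x - conv n f y)\<^sup>2)
        \<le> A * (\<integral>\<^sup>+s. ennreal (n s * (f (x - s) - f (y - s))\<^sup>2) \<partial>lborel)"
      unfolding A_def using weighted_square_integral[of n lborel "\<lambda>s. f (x - s) - f (y - s)"] nn by simp
    then have "ennreal ((conv n f x - conv n f y)\<^sup>2) * w x y
        \<le> A * (\<integral>\<^sup>+s. ennreal (n s * (f (x - s) - f (y - s))\<^sup>2) \<partial>lborel) * w x y"
      by (rule mult_right_mono) simp
    also have "\<dots> = A * (\<integral>\<^sup>+s. ennreal (n s * (f (x - s) - f (y - s))\<^sup>2) * w x y \<partial>lborel)"
      by (simp add: mult.assoc nn_integral_multc)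
    also have "(\<integral>\<^sup>+s. ennreal (n s * (f (x - s) - f (y - s))\<^sup>2) * w x y \<partial>lborel)
        = (\<integral>\<^sup>+s. n s * D (x - s) (y - s) \<partial>lborel)"
      by (intro nn_integral_cong) (simp add: D_def wtr w nn ennreal_mult mult.assoc)
    finally show ?thesis by (simp add: ennreal_mult w)
  qed
  have "gagliardo_sq \<theta> 0 T (conv n f)
      = (\<integral>\<^sup>+x. (\<integral>\<^sup>+y. ennreal ((conv n f x - conv n f y)\<^sup>2 * w x y) * I y \<partial>lborel) * I x \<partial>lborel)"
    by (simp add: gagliardo_sq_lborel w_def I_def)
  also have "\<dots> \<le> (\<integral>\<^sup>+x. (\<integral>\<^sup>+y. A * (\<integral>\<^sup>+s. n s * D (x - s) (y - s) \<partial>lborel) * I y \<partial>lborel) * I x \<partial>lborel)"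
  proof (rule nn_integral_mono_AE, use ae in eventually_elim)
    fix x assume x: "integrable lborel (\<lambda>s. n s * f (x - s))"
    have "AE y in lborel. ennreal ((conv n f x - conv n f y)\<^sup>2 * w x y) * I y
        \<le> A * (\<integral>\<^sup>+s. n s * D (x - s) (y - s) \<partial>lborel) * I y"
      using ae by eventually_elim (intro mult_right_mono pt x; simp)
    then show "(\<integral>\<^sup>+y. ennreal ((conv n f x - conv n f y)\<^sup>2 * w x y) * I y \<partial>lborel) * I x
        \<le> (\<integral>\<^sup>+y. A * (\<integral>\<^sup>+s. n s * D (x - s) (y - s) \<partial>lborel) * I y \<partial>lborel) * I x"
      by (intro mult_right_mono nn_integral_mono_AE) auto
  qed
  also have "\<dots> = A * (\<integral>\<^sup>+x. \<integral>\<^sup>+y. \<integral>\<^sup>+s. n s * (D (x - s) (y - s) * I y * I x) \<partial>lborel \<partial>lborel \<partial>lborel)"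
  proof -
    have "(\<integral>\<^sup>+y. A * (\<integral>\<^sup>+s. n s * D (x - s) (y - s) \<partial>lborel) * I y \<partial>lborel) * I x
        = A * (\<integral>\<^sup>+y. \<integral>\<^sup>+s. n s * (D (x - s) (y - s) * I y * I x) \<partial>lborel \<partial>lborel)" for x
    proof -
      have "(\<integral>\<^sup>+y. A * (\<integral>\<^sup>+s. n s * D (x - s) (y - s) \<partial>lborel) * I y \<partial>lborel) * I x
          = (\<integral>\<^sup>+y. A * ((\<integral>\<^sup>+s. n s * D (x - s) (y - s) \<partial>lborel) * (I y * I x)) \<partial>lborel)"
        by (subst nn_integral_multc[symmetric]) (auto simp: mult.assoc)
      also have "\<dots> = A * (\<integral>\<^sup>+y. (\<integral>\<^sup>+s. n s * D (x - s) (y - s) \<partial>lborel) * (I y * I x) \<partial>lborel)"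
        by (rule nn_integral_cmult) measurable
      also have "(\<lambda>y. (\<integral>\<^sup>+s. n s * D (x - s) (y - s) \<partial>lborel) * (I y * I x))
          = (\<lambda>y. \<integral>\<^sup>+s. n s * D (x - s) (y - s) * (I y * I x) \<partial>lborel)"
        by (intro ext nn_integral_multc[symmetric]) measurable
      finally show ?thesis by (simp add: mult.assoc)
    qed
    then show ?thesis by (simp add: nn_integral_cmult)
  qed
  also have "(\<integral>\<^sup>+x. \<integral>\<^sup>+y. \<integral>\<^sup>+s. n s * (D (x - s) (y - s) * I y * I x) \<partial>lborel \<partial>lborel \<partial>lborel)
      = (\<integral>\<^sup>+x. \<integral>\<^sup>+s. \<integral>\<^sup>+y. n s * (D (x - s) (y - s) * I y * I x) \<partial>lborel \<partial>lborel \<partial>lborel)"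
    by (intro nn_integral_cong lborel_pair.Fubini') measurable
  also have "\<dots> = (\<integral>\<^sup>+s. \<integral>\<^sup>+x. \<integral>\<^sup>+y. n s * (D (x - s) (y - s) * I y * I x) \<partial>lborel \<partial>lborel \<partial>lborel)"
    by (rule lborel_pair.Fubini') measurable
  also have "\<dots> = (\<integral>\<^sup>+s. n s * (\<integral>\<^sup>+x. \<integral>\<^sup>+y. D (x - s) (y - s) * I y * I x \<partial>lborel \<partial>lborel) \<partial>lborel)"
    by (simp add: nn_integral_cmult)
  also have "\<dots> \<le> (\<integral>\<^sup>+s. n s * gagliardo_sq \<theta> (-T) T f \<partial>lborel)"
  proof (rule nn_integral_mono)
    fix s :: real
    show "n s * (\<integral>\<^sup>+x. \<integral>\<^sup>+y. D (x - s) (y - s) * I y * I x \<partial>lborel \<partial>lborel) \<le> n s * gagliardo_sq \<theta> (-T) T f"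
    proof (cases "s \<in> {0<..<T}")
      case True
      have tr: "(\<integral>\<^sup>+x. h (x - s) \<partial>lborel) = (\<integral>\<^sup>+x. h x \<partial>lborel)" if "h \<in> borel_measurable borel" for h
        using nn_integral_real_affine[of h 1 "-s"] that by simp
      have "(\<integral>\<^sup>+x. \<integral>\<^sup>+y. D (x - s) (y - s) * I y * I x \<partial>lborel \<partial>lborel)
          = (\<integral>\<^sup>+x. \<integral>\<^sup>+y. D (x - s) y * I (y + s) * I x \<partial>lborel \<partial>lborel)"
        by (rule nn_integral_cong, subst tr[symmetric]) auto
      also have "\<dots> = (\<integral>\<^sup>+x. \<integral>\<^sup>+y. D x y * I (y + s) * I (x + s) \<partial>lborel \<partial>lborel)"
        by (subst tr[symmetric]) auto
      also have "\<dots> \<le> (\<integral>\<^sup>+x. \<integral>\<^sup>+y. D x y * indicator {-T..T} y * indicator {-T..T} x \<partial>lborel \<partial>lborel)"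
        using True by (intro nn_integral_mono) (auto simp: I_def indicator_def)
      also have "\<dots> = gagliardo_sq \<theta> (-T) T f"
        by (simp add: gagliardo_sq_lborel D_def w_def nn_integral_multc)
      finally show ?thesis by (rule mult_left_mono) simp
    qed (simp add: n0)
  qed
  also have "\<dots> = A * gagliardo_sq \<theta> (-T) T f"
    unfolding A_def by (rule nn_integral_multc) measurable
  finally show ?thesis
    by (simp add: A_def power2_eq_square mult.assoc mult_left_mono)
qed

section \<open>Extension by zero\<close>

lemma nn_integral_weight_left:
  fixes x \<theta> T :: real
  assumes x: "0 < x" and th: "0 < \<theta>" and T: "0 \<le> T"
  shows "(\<integral>\<^sup>+y. ennreal (1 / \<bar>x - y\<bar> powr (1 + 2 * \<theta>)) * indicator {-T..0} y \<partial>lborel)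
    \<le> ennreal (x powr (-2 * \<theta>) / (2 * \<theta>))"
proof -
  have "(\<integral>\<^sup>+y. ennreal (1 / \<bar>x - y\<bar> powr (1 + 2 * \<theta>)) * indicator {-T..0} y \<partial>lborel)
      = ennreal ((x - 0) powr (-2 * \<theta>) / (2 * \<theta>) - (x - (-T)) powr (-2 * \<theta>) / (2 * \<theta>))"
  proof (rule nn_integral_FTC_Icc)
    fix y assume y: "y \<in> {-T..0}"
    then show "((\<lambda>y. (x - y) powr (-2 * \<theta>) / (2 * \<theta>)) has_real_derivative
        1 / \<bar>x - y\<bar> powr (1 + 2 * \<theta>)) (at y)"
      using x th by (auto intro!: derivative_eq_intros simp: powr_minus powr_diff powr_add field_simps)
  qed (use T in auto)
  also have "\<dots> \<le> ennreal (x powr (-2 * \<theta>) / (2 * \<theta>))"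
    using th by (intro ennreal_leI) simp
  finally show ?thesis .
qed

text \<open>
Extension by zero adds only the two off-diagonal rectangles, which are equal by symmetry. On the rectangle
\<open>x > 0 > y\<close> the integrand is \<open>(f x)\<^sup>2 / (x - y) powr (1 + 2 * \<theta>)\<close>, whose integral in
\<open>y\<close> is at most \<open>(f x)\<^sup>2 * x powr (-2 * \<theta>) / (2 * \<theta>)\<close>. So the only obstruction is
the Hardy integral on the right.
\<close>
lemma gagliardo_zero_extension:
  assumes [measurable]: "f \<in> borel_measurable borel" and f0: "\<And>x. x \<notin> {0<..<T} \<Longrightarrow> f x = 0"
    and th: "0 < \<theta>" and T: "0 < T"
  shows "gagliardo_sq \<theta> (-T) T f
    \<le> gagliardo_sq \<theta> 0 T f + ennreal (1 / \<theta>) * (\<integral>\<^sup>+x. ennreal ((f x)\<^sup>2 * x powr (-2 * \<theta>)) \<partial>lborel)"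
proof -
  define D where "D x y = ennreal ((f x - f y)\<^sup>2 / \<bar>x - y\<bar> powr (1 + 2 * \<theta>))" for x y
  have [measurable]: "case_prod D \<in> borel_measurable (borel \<Otimes>\<^sub>M borel)"
    unfolding D_def by measurable
  define P :: "real \<Rightarrow> ennreal" where "P = indicator {0..T}"
  define Q :: "real \<Rightarrow> ennreal" where "Q = indicator {-T..0}"
  have [measurable]: "P \<in> borel_measurable borel" "Q \<in> borel_measurable borel"
    unfolding P_def Q_def by measurable
  define C where "C = (\<integral>\<^sup>+x. \<integral>\<^sup>+y. D x y * Q y * P x \<partial>lborel \<partial>lborel)"
  have sym: "D x y = D y x" for x y
    by (simp add: D_def abs_minus_commute power2_commute)
  have "gagliardo_sq \<theta> (-T) T f
      = (\<integral>\<^sup>+x. \<integral>\<^sup>+y. D x y * indicator {-T..T} y * indicator {-T..T} x \<partial>lborel \<partial>lborel)"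
    by (simp add: gagliardo_sq_lborel D_def nn_integral_multc)
  also have "\<dots> \<le> (\<integral>\<^sup>+x. \<integral>\<^sup>+y. D x y * P y * P x + (D x y * Q y * P x + D y x * Q x * P y) \<partial>lborel \<partial>lborel)"
  proof (intro nn_integral_mono)
    fix x y
    show "D x y * indicator {-T..T} y * indicator {-T..T} x
        \<le> D x y * P y * P x + (D x y * Q y * P x + D y x * Q x * P y)"
    proof (cases "x \<le> 0 \<and> y \<le> 0")
      case True
      then have "D x y = 0" by (simp add: D_def f0)
      then show ?thesis by simp
    next
      case False
      then show ?thesis
        by (cases "0 \<le> x"; cases "0 \<le> y") (auto simp: P_def Q_def indicator_def sym[of y x])
    qed
  qed
  also have "\<dots> = (\<integral>\<^sup>+x. \<integral>\<^sup>+y. D x y * P y * P x \<partial>lborel \<partial>lborel)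
      + (C + (\<integral>\<^sup>+x. \<integral>\<^sup>+y. D y x * Q x * P y \<partial>lborel \<partial>lborel))"
    unfolding C_def by (simp add: nn_integral_add)
  also have "(\<integral>\<^sup>+x. \<integral>\<^sup>+y. D x y * P y * P x \<partial>lborel \<partial>lborel) = gagliardo_sq \<theta> 0 T f"
    by (simp add: gagliardo_sq_lborel D_def P_def nn_integral_multc)
  also have "(\<integral>\<^sup>+x. \<integral>\<^sup>+y. D y x * Q x * P y \<partial>lborel \<partial>lborel) = C"
    unfolding C_def by (rule lborel_pair.Fubini') measurable
  also have "C \<le> (\<integral>\<^sup>+x. ennreal (1 / (2 * \<theta>)) * ennreal ((f x)\<^sup>2 * x powr (-2 * \<theta>)) \<partial>lborel)"
    unfolding C_def
  proof (rule nn_integral_mono)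
    fix x
    show "(\<integral>\<^sup>+y. D x y * Q y * P x \<partial>lborel) \<le> ennreal (1 / (2 * \<theta>)) * ennreal ((f x)\<^sup>2 * x powr (-2 * \<theta>))"
    proof (cases "x \<in> {0<..<T}")
      case True
      have "(\<integral>\<^sup>+y. D x y * Q y * P x \<partial>lborel)
          = (\<integral>\<^sup>+y. ennreal ((f x)\<^sup>2) * (ennreal (1 / \<bar>x - y\<bar> powr (1 + 2 * \<theta>)) * indicator {-T..0} y) \<partial>lborel)"
        using True by (intro nn_integral_cong)
          (auto simp: D_def P_def Q_def indicator_def f0 simp flip: ennreal_mult)
      also have "\<dots> = ennreal ((f x)\<^sup>2) * (\<integral>\<^sup>+y. ennreal (1 / \<bar>x - y\<bar> powr (1 + 2 * \<theta>)) * indicator {-T..0} y \<partial>lborel)"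
        by (rule nn_integral_cmult) measurable
      also have "\<dots> \<le> ennreal ((f x)\<^sup>2) * ennreal (x powr (-2 * \<theta>) / (2 * \<theta>))"
        using True th T by (intro mult_left_mono nn_integral_weight_left) auto
      also have "\<dots> = ennreal (1 / (2 * \<theta>)) * ennreal ((f x)\<^sup>2 * x powr (-2 * \<theta>))"
        using th by (simp flip: ennreal_mult)
      finally show ?thesis .
    next
      case False
      then have "x = 0 \<or> x = T \<or> x \<notin> {0..T}" by auto
      then have "D x y * Q y * P x = 0" for y
        using f0[of x] f0[of y] by (auto simp: P_def Q_def D_def indicator_def)
      then have "(\<lambda>y. D x y * Q y * P x) = (\<lambda>y. 0)" by (rule ext)
      then show ?thesis by simp
    qed
  qed
  also have "\<dots> = ennreal (1 / (2 * \<theta>)) * (\<integral>\<^sup>+x. ennreal ((f x)\<^sup>2 * x powr (-2 * \<theta>)) \<partial>lborel)"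
    by (rule nn_integral_cmult) measurable
  finally have "gagliardo_sq \<theta> (-T) T f \<le> gagliardo_sq \<theta> 0 T f
      + (ennreal (1 / (2 * \<theta>)) * (\<integral>\<^sup>+x. ennreal ((f x)\<^sup>2 * x powr (-2 * \<theta>)) \<partial>lborel)
       + ennreal (1 / (2 * \<theta>)) * (\<integral>\<^sup>+x. ennreal ((f x)\<^sup>2 * x powr (-2 * \<theta>)) \<partial>lborel))"
    by (simp add: add_mono)
  also have "ennreal (1 / (2 * \<theta>)) * (\<integral>\<^sup>+x. ennreal ((f x)\<^sup>2 * x powr (-2 * \<theta>)) \<partial>lborel)
       + ennreal (1 / (2 * \<theta>)) * (\<integral>\<^sup>+x. ennreal ((f x)\<^sup>2 * x powr (-2 * \<theta>)) \<partial>lborel)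
       = ennreal (1 / \<theta>) * (\<integral>\<^sup>+x. ennreal ((f x)\<^sup>2 * x powr (-2 * \<theta>)) \<partial>lborel)"
    using th by (simp flip: distrib_right ennreal_plus)
  finally show ?thesis .
qed

section \<open>Fractional Hardy inequalities\<close>

text \<open>
The classical Hardy inequality for \<open>x \<mapsto> \<integral>\<^sub>0\<^sup>x |h t| / t dt\<close> in the weight
\<open>x powr (-2 * \<theta>)\<close>. With \<open>\<gamma> = \<theta> - 1/2\<close>, Cauchy--Schwarz for
\<open>1/t = t powr ((\<gamma> - 1)/2) * t powr ((-1 - \<gamma>)/2)\<close> leaves an integrable power at \<open>0\<close>
in the first factor; exchanging the integrals, the remaining integral over \<open>x > t\<close> of
\<open>x powr (\<gamma> - 2 * \<theta>) = x powr (-1 - \<gamma>)\<close> converges at infinity. Each of the two integrals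
contributes a factor \<open>1 / \<gamma>\<close>.
\<close>
lemma hardy_weighted:
  assumes [measurable]: "h \<in> borel_measurable borel" and th: "1/2 < \<theta>"
  shows "(\<integral>\<^sup>+x. (\<integral>\<^sup>+t. ennreal (\<bar>h t\<bar> / t) * indicator {0<..<x} t \<partial>lborel)\<^sup>2
        * (ennreal (x powr (-2 * \<theta>)) * indicator {0<..<T} x) \<partial>lborel)
    \<le> ennreal (1 / (\<theta> - 1/2)\<^sup>2)
        * (\<integral>\<^sup>+t. ennreal ((h t)\<^sup>2 * t powr (-2 * \<theta>)) * indicator {0<..<T} t \<partial>lborel)"
proof -
  define \<gamma> where "\<gamma> = \<theta> - 1/2"
  have g: "0 < \<gamma>" using th by (simp add: \<gamma>_def)
  have p2: "(t powr a)\<^sup>2 = t powr (2 * a)" for t a :: real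
    unfolding power2_eq_square powr_add[symmetric] mult_2 ..
  have e2: "(- 2 - 2 * \<gamma>) / 2 = - 1 - \<gamma>" and e3: "(2 * \<gamma> - 2) / 2 = \<gamma> - 1"
    by (simp_all add: field_simps)
  define H where "H t = ennreal ((h t)\<^sup>2 * t powr (-1 - \<gamma>))" for t
  have [measurable]: "H \<in> borel_measurable borel" unfolding H_def by measurable
  define K where "K t x = (if t < x \<and> x < T then ennreal (x powr (\<gamma> - 2 * \<theta>)) else 0)" for t x
  have [measurable]: "case_prod K \<in> borel_measurable (borel \<Otimes>\<^sub>M borel)"
    unfolding K_def by measurable
  have sq: "(\<integral>\<^sup>+t. ennreal (\<bar>h t\<bar> / t) * indicator {0<..<x} t \<partial>lborel)\<^sup>2
      \<le> ennreal (x powr \<gamma> / \<gamma>) * (\<integral>\<^sup>+t. H t * indicator {0<..<x} t \<partial>lborel)" if x: "0 < x" for x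
  proof -
    have m1: "(\<lambda>t. ennreal (t powr ((\<gamma> - 1) / 2)) * indicator {0<..<x} t) \<in> borel_measurable lborel"
      by measurable
    have m2: "(\<lambda>t. ennreal (\<bar>h t\<bar> * t powr ((-1 - \<gamma>) / 2)) * indicator {0<..<x} t) \<in> borel_measurable lborel"
      by measurable
    have eq: "(\<integral>\<^sup>+t. ennreal (\<bar>h t\<bar> / t) * indicator {0<..<x} t \<partial>lborel)
        = (\<integral>\<^sup>+t. (ennreal (t powr ((\<gamma> - 1) / 2)) * indicator {0<..<x} t)
            * (ennreal (\<bar>h t\<bar> * t powr ((-1 - \<gamma>) / 2)) * indicator {0<..<x} t) \<partial>lborel)"
    proof (intro nn_integral_cong)
      fix t :: real
      have "t powr ((\<gamma> - 1) / 2) * (\<bar>h t\<bar> * t powr ((-1 - \<gamma>) / 2)) = \<bar>h t\<bar> / t" if "0 < t"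
      proof -
        have e: "(\<gamma> - 1) / 2 + (-1 - \<gamma>) / 2 = -1"
          by (simp add: field_simps)
        have "t powr ((\<gamma> - 1) / 2) * t powr ((-1 - \<gamma>) / 2) = t powr (-1)"
          unfolding powr_add[symmetric] e ..
        also have "\<dots> = 1 / t"
          using that by (simp add: powr_minus divide_inverse)
        finally show ?thesis by (simp add: mult.left_commute)
      qed
      then show "ennreal (\<bar>h t\<bar> / t) * indicator {0<..<x} t
          = (ennreal (t powr ((\<gamma> - 1) / 2)) * indicator {0<..<x} t)
            * (ennreal (\<bar>h t\<bar> * t powr ((-1 - \<gamma>) / 2)) * indicator {0<..<x} t)"
        by (auto simp: indicator_def simp flip: ennreal_mult)
    qed
    have "(\<integral>\<^sup>+t. ennreal (\<bar>h t\<bar> / t) * indicator {0<..<x} t \<partial>lborel)\<^sup>2 \<le> (\<integral>\<^sup>+t. (ennreal (t powr ((\<gamma> - 1) / 2)) * indicator {0<..<x} t)\<^sup>2 \<partial>lborel)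
        * (\<integral>\<^sup>+t. (ennreal (\<bar>h t\<bar> * t powr ((-1 - \<gamma>) / 2)) * indicator {0<..<x} t)\<^sup>2 \<partial>lborel)"
      unfolding eq by (rule Cauchy_Schwarz_nn_integral[OF m1 m2])
    also have "(\<integral>\<^sup>+t. (ennreal (\<bar>h t\<bar> * t powr ((-1 - \<gamma>) / 2)) * indicator {0<..<x} t)\<^sup>2 \<partial>lborel)
        = (\<integral>\<^sup>+t. H t * indicator {0<..<x} t \<partial>lborel)"
      by (intro nn_integral_cong)
        (auto simp: H_def indicator_def ennreal_power power_mult_distrib p2 e2)
    also have "(\<integral>\<^sup>+t. (ennreal (t powr ((\<gamma> - 1) / 2)) * indicator {0<..<x} t)\<^sup>2 \<partial>lborel)
        = (\<integral>\<^sup>+t. ennreal (t powr (\<gamma> - 1) * indicator {0<..<x} t) \<partial>lborel)"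
      by (intro nn_integral_cong) (auto simp: indicator_def ennreal_power p2 e3)
    also have "\<dots> \<le> (\<integral>\<^sup>+t. ennreal (t powr (\<gamma> - 1) * indicator {0..x} t) \<partial>lborel)"
      by (intro nn_integral_mono) (auto simp: indicator_def)
    also have "\<dots> = ennreal (x powr \<gamma> / \<gamma>)"
    proof (rule nn_integral_has_integral_lborel)
      have "((\<lambda>t. t powr (\<gamma> - 1)) has_integral (x powr \<gamma> / \<gamma>)) {0..x}"
        using has_integral_powr_from_0[of "\<gamma> - 1" x] g x by simp
      then have "((\<lambda>t. if t \<in> {0..x} then t powr (\<gamma> - 1) else 0) has_integral (x powr \<gamma> / \<gamma>)) UNIV"
        by (simp only: has_integral_restrict_UNIV)
      then show "((\<lambda>t. t powr (\<gamma> - 1) * indicator {0..x} t) has_integral (x powr \<gamma> / \<gamma>)) UNIV"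
        by (rule has_integral_eq[rotated]) (auto simp: indicator_def)
    qed auto
    finally show ?thesis by (simp add: mult_right_mono)
  qed
  have inner: "(\<integral>\<^sup>+x. K t x \<partial>lborel)
      \<le> ennreal (t powr (-\<gamma>) / \<gamma>)" if t: "0 < t" for t
  proof (cases "t \<le> T")
    case True
    have "(\<integral>\<^sup>+x. K t x \<partial>lborel)
        \<le> (\<integral>\<^sup>+x. ennreal (x powr (\<gamma> - 2 * \<theta>)) * indicator {t..T} x \<partial>lborel)"
      by (intro nn_integral_mono) (auto simp: K_def indicator_def)
    also have "\<dots> = ennreal (- (T powr (-\<gamma>)) / \<gamma> - (- (t powr (-\<gamma>)) / \<gamma>))"
    proof (rule nn_integral_FTC_Icc)
      fix x assume "x \<in> {t..T}"
      have e: "\<gamma> - 2 * \<theta> = -\<gamma> - 1" by (simp add: \<gamma>_def)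
      show "((\<lambda>x. - (x powr (-\<gamma>)) / \<gamma>) has_real_derivative x powr (\<gamma> - 2 * \<theta>)) (at x)"
        unfolding e using t g \<open>x \<in> {t..T}\<close> by (auto intro!: derivative_eq_intros)
    qed (use True in auto)
    also have "\<dots> \<le> ennreal (t powr (-\<gamma>) / \<gamma>)"
      using g by (intro ennreal_leI) simp
    finally show ?thesis .
  next
    case False
    then have "K t = (\<lambda>x. 0)" by (auto simp: K_def)
    then show ?thesis by simp
  qed
  have "(\<integral>\<^sup>+x. (\<integral>\<^sup>+t. ennreal (\<bar>h t\<bar> / t) * indicator {0<..<x} t \<partial>lborel)\<^sup>2
        * (ennreal (x powr (-2 * \<theta>)) * indicator {0<..<T} x) \<partial>lborel)
      \<le> (\<integral>\<^sup>+x. \<integral>\<^sup>+t. ennreal (1 / \<gamma>) * H t * indicator {0<..<T} t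
          * K t x \<partial>lborel \<partial>lborel)"
  proof (rule nn_integral_mono)
    fix x
    show "(\<integral>\<^sup>+t. ennreal (\<bar>h t\<bar> / t) * indicator {0<..<x} t \<partial>lborel)\<^sup>2
        * (ennreal (x powr (-2 * \<theta>)) * indicator {0<..<T} x)
      \<le> (\<integral>\<^sup>+t. ennreal (1 / \<gamma>) * H t * indicator {0<..<T} t
          * K t x \<partial>lborel)"
    proof (cases "x \<in> {0<..<T}")
      case True
      have "(\<integral>\<^sup>+t. ennreal (\<bar>h t\<bar> / t) * indicator {0<..<x} t \<partial>lborel)\<^sup>2 * ennreal (x powr (-2 * \<theta>))
          \<le> ennreal (x powr \<gamma> / \<gamma>) * (\<integral>\<^sup>+t. H t * indicator {0<..<x} t \<partial>lborel) * ennreal (x powr (-2 * \<theta>))"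
        using True by (intro mult_right_mono sq) auto
      also have "\<dots> = (\<integral>\<^sup>+t. H t * indicator {0<..<x} t \<partial>lborel) * ennreal (x powr (\<gamma> - 2 * \<theta>) / \<gamma>)"
      proof -
        have "x powr \<gamma> / \<gamma> * x powr (-2 * \<theta>) = x powr (\<gamma> - 2 * \<theta>) / \<gamma>"
          by (simp add: powr_diff powr_minus divide_inverse mult_ac)
        then have "ennreal (x powr \<gamma> / \<gamma>) * ennreal (x powr (-2 * \<theta>)) = ennreal (x powr (\<gamma> - 2 * \<theta>) / \<gamma>)"
          using g by (subst ennreal_mult[symmetric]) auto
        from this[symmetric] show ?thesis by (simp only: mult_ac)
      qed
      also have "\<dots> = (\<integral>\<^sup>+t. H t * indicator {0<..<x} t * ennreal (x powr (\<gamma> - 2 * \<theta>) / \<gamma>) \<partial>lborel)"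
        by (rule nn_integral_multc[symmetric]) measurable
      also have "\<dots> = (\<integral>\<^sup>+t. ennreal (1 / \<gamma>) * H t * indicator {0<..<T} t
          * K t x \<partial>lborel)"
        using g True by (intro nn_integral_cong)
          (auto simp: indicator_def H_def K_def mult_ac simp flip: ennreal_mult)
      finally show ?thesis using True by (simp add: indicator_def)
    qed simp
  qed
  also have "\<dots> = (\<integral>\<^sup>+t. \<integral>\<^sup>+x. ennreal (1 / \<gamma>) * H t * indicator {0<..<T} t
          * K t x \<partial>lborel \<partial>lborel)"
    by (rule lborel_pair.Fubini') measurable
  also have "\<dots> = (\<integral>\<^sup>+t. ennreal (1 / \<gamma>) * H t * indicator {0<..<T} t
          * (\<integral>\<^sup>+x. K t x \<partial>lborel) \<partial>lborel)"
    by (intro nn_integral_cong nn_integral_cmult) measurable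
  also have "\<dots> \<le> (\<integral>\<^sup>+t. ennreal (1 / \<gamma>\<^sup>2)
      * (ennreal ((h t)\<^sup>2 * t powr (-2 * \<theta>)) * indicator {0<..<T} t) \<partial>lborel)"
  proof (rule nn_integral_mono)
    fix t
    show "ennreal (1 / \<gamma>) * H t * indicator {0<..<T} t
          * (\<integral>\<^sup>+x. K t x \<partial>lborel)
        \<le> ennreal (1 / \<gamma>\<^sup>2) * (ennreal ((h t)\<^sup>2 * t powr (-2 * \<theta>)) * indicator {0<..<T} t)"
    proof (cases "t \<in> {0<..<T}")
      case True
      have "ennreal (1 / \<gamma>) * H t * (\<integral>\<^sup>+x. K t x \<partial>lborel)
          \<le> ennreal (1 / \<gamma>) * H t * ennreal (t powr (-\<gamma>) / \<gamma>)"
        using True by (intro mult_left_mono inner) auto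
      also have "\<dots> = ennreal (1 / \<gamma>\<^sup>2 * ((h t)\<^sup>2 * (t powr (-1 - \<gamma>) * t powr (-\<gamma>))))"
        using g unfolding H_def by (simp add: power2_eq_square flip: ennreal_mult)
      also have "t powr (-1 - \<gamma>) * t powr (-\<gamma>) = t powr (-2 * \<theta>)"
        unfolding powr_add[symmetric] by (simp add: \<gamma>_def)
      finally show ?thesis using True g by (simp flip: ennreal_mult)
    qed simp
  qed
  also have "\<dots> = ennreal (1 / \<gamma>\<^sup>2)
      * (\<integral>\<^sup>+t. ennreal ((h t)\<^sup>2 * t powr (-2 * \<theta>)) * indicator {0<..<T} t \<partial>lborel)"
    by (rule nn_integral_cmult) measurable
  finally show ?thesis by (simp add: \<gamma>_def)
qed

text \<open>
The finiteness condition is the reason why the Hardy integral is cut off near \<open>0\<close> below.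
\<close>
lemma ennreal_absorb_half:
  fixes W K :: ennreal
  assumes "W \<le> ennreal (1/2) * W + K" and "W < \<infinity>"
  shows "W \<le> 2 * K"
proof (cases K)
  case (real k)
  obtain w where w: "W = ennreal w" "0 \<le> w" using assms(2) by (cases W) auto
  have "ennreal (1/2 * w + k) = ennreal (1/2) * ennreal w + ennreal k"
    using w real by (subst ennreal_plus; (subst ennreal_mult)?) simp_all
  then have "ennreal w \<le> ennreal (1/2 * w + k)"
    using assms(1) real w by simp
  then have "w \<le> 1/2 * w + k"
    using w real by (subst (asm) ennreal_le_iff) auto
  then have "w \<le> 2 * k" by simp
  then have "ennreal w \<le> ennreal 2 * ennreal k"
    using real by (simp add: ennreal_mult[symmetric] ennreal_leI del: ennreal_numeral)
  then show ?thesis using w real by simp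
qed (simp add: ennreal_mult_top)

text \<open>
Fractional Hardy inequality for \<open>\<theta> < 1/2\<close>, with no condition at \<open>0\<close>. A value
\<open>f x\<close> is compared with the values \<open>f y\<close> for \<open>y\<close> in the larger scale
\<open>[A x, 2 A x]\<close>. The differences are controlled by the Gagliardo seminorm, because
\<open>|x - y| \<le> 2 A x\<close>. The averages of \<open>(f y)\<^sup>2\<close> reproduce the Hardy integral with a factor
at most \<open>4 * A powr (2 * \<theta> - 1)\<close>, and since \<open>2 * \<theta> - 1 < 0\<close> this is \<open>1/2\<close> for the
chosen \<open>A\<close> and can be absorbed. The cut-off at \<open>d > 0\<close> makes the absorbed quantity
finite; moving to a larger scale preserves the region \<open>x \<ge> d\<close>. Finally \<open>d\<close> tends to \<open>0\<close>.
For \<open>x > T / (2 A)\<close> the larger scale leaves the interval, but there the weight is bounded.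
\<close>
lemma hardy_below_half:
  assumes [measurable]: "f \<in> borel_measurable borel" and f0: "\<And>x. x \<notin> {0<..<T} \<Longrightarrow> f x = 0"
    and T: "0 < T" and th: "0 < \<theta>" "\<theta> < 1/2"
    and fin: "(\<integral>\<^sup>+x. ennreal ((f x)\<^sup>2) \<partial>lborel) < \<infinity>"
    and A: "A = 8 powr (1 / (1 - 2 * \<theta>))"
  shows "(\<integral>\<^sup>+x. ennreal ((f x)\<^sup>2 * x powr (-2 * \<theta>)) \<partial>lborel)
    \<le> 2 * (ennreal (2 / A * (2 * A) powr (1 + 2 * \<theta>)) * gagliardo_sq \<theta> 0 T f
        + ennreal ((T / (2 * A)) powr (-2 * \<theta>)) * (\<integral>\<^sup>+x. ennreal ((f x)\<^sup>2) \<partial>lborel))"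
proof -
  have A1: "1 < A"
    unfolding A using th by (intro gr_one_powr) auto
  define B where "B = T / (2 * A)"
  have B: "0 < B" "2 * A * B = T" using T A1 by (simp_all add: B_def)
  define c where "c = 2 / A * (2 * A) powr (1 + 2 * \<theta>)"
  have c: "0 \<le> c" using A1 by (simp add: c_def)
  define D where "D x y = ennreal ((f x - f y)\<^sup>2 / \<bar>x - y\<bar> powr (1 + 2 * \<theta>))" for x y
  have [measurable]: "case_prod D \<in> borel_measurable (borel \<Otimes>\<^sub>M borel)"
    unfolding D_def by measurable
  define E :: "real \<Rightarrow> real \<Rightarrow> ennreal" where "E x y = (if A * x \<le> y \<and> y \<le> 2 * A * x then 1 else 0)" for x y
  have [measurable]: "case_prod E \<in> borel_measurable (borel \<Otimes>\<^sub>M borel)"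
    unfolding E_def by measurable
  define F where "F x = ennreal ((f x)\<^sup>2 * x powr (-2 * \<theta>))" for x
  have [measurable]: "F \<in> borel_measurable borel"
    unfolding F_def by measurable
  define S where "S = (\<integral>\<^sup>+x. ennreal ((f x)\<^sup>2) \<partial>lborel)"
  \<comment> \<open>This is where the exponent defining \<open>A\<close> is used.\<close>
  have contraction: "2 / A * (2 * A) powr (2 * \<theta>) \<le> 1/2"
  proof -
    have "1 / (1 - 2 * \<theta>) * (2 * \<theta> - 1) = -1"
      using th by (simp add: field_simps)
    then have "A powr (2 * \<theta> - 1) = 8 powr (-1)"
      unfolding A powr_powr by simp
    then have a: "A powr (2 * \<theta>) / A = 1/8"
      using A1 by (simp add: powr_diff powr_minus)
    have "(2::real) powr (2 * \<theta>) \<le> 2 powr 1"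
      using th by (intro powr_mono) auto
    then have "2 * 2 powr (2 * \<theta>) * (A powr (2 * \<theta>) / A) \<le> 2 * 2 * (1 / 8)"
      unfolding a by simp
    then show ?thesis using A1 by (simp add: powr_mult field_simps)
  qed
  have tail: "(\<integral>\<^sup>+x. F x * indicator {d..} x \<partial>lborel)
      \<le> 2 * (ennreal c * gagliardo_sq \<theta> 0 T f + ennreal (B powr (-2 * \<theta>)) * S)" if d: "0 < d" for d
  proof (rule ennreal_absorb_half)
    define W where "W = (\<integral>\<^sup>+x. F x * indicator {d..} x \<partial>lborel)"
    have "W \<le> (\<integral>\<^sup>+x. ennreal (d powr (-2 * \<theta>)) * ennreal ((f x)\<^sup>2) \<partial>lborel)"
      unfolding W_def
    proof (rule nn_integral_mono)
      fix x
      show "F x * indicator {d..} x \<le> ennreal (d powr (-2 * \<theta>)) * ennreal ((f x)\<^sup>2)"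
      proof (cases "d \<le> x")
        case True
        then have "x powr (-2 * \<theta>) \<le> d powr (-2 * \<theta>)"
          using d th by (intro powr_mono2') auto
        then have "(f x)\<^sup>2 * x powr (-2 * \<theta>) \<le> d powr (-2 * \<theta>) * (f x)\<^sup>2"
          by (subst mult.commute) (rule mult_right_mono, auto)
        then show ?thesis
          using True by (simp add: F_def ennreal_leI flip: ennreal_mult)
      qed simp
    qed
    also have "\<dots> = ennreal (d powr (-2 * \<theta>)) * S"
      unfolding S_def by (rule nn_integral_cmult) measurable
    also have "\<dots> < \<infinity>"
      using fin by (simp add: S_def ennreal_mult_less_top)
    finally show "(\<integral>\<^sup>+x. F x * indicator {d..} x \<partial>lborel) < \<infinity>"
      by (simp add: W_def)
    \<comment> \<open>Values at \<open>x \<le> B\<close> against the scale \<open>[A x, 2 A x]\<close>, which lies in \<open>[0,T]\<close>.\<close>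
    have near: "F x * indicator {d..B} x
        \<le> (\<integral>\<^sup>+y. ennreal (2 / A * (f y)\<^sup>2) * (ennreal (x powr (-1 - 2 * \<theta>)) * indicator {d..} x * E x y) \<partial>lborel)
          + (\<integral>\<^sup>+y. ennreal c * (D x y * indicator {0..T} y * indicator {0..T} x) \<partial>lborel)" for x
    proof (cases "x \<in> {d..B}")
      case True
      then have x: "0 < x" "x \<le> B" using d by auto
      have "F x = ennreal ((f x)\<^sup>2 * x powr (-1 - 2 * \<theta>) / A) * ennreal (2 * A * x - A * x)"
        using x A1 by (simp add: F_def powr_diff powr_minus flip: ennreal_mult) (simp add: field_simps)
      also have "\<dots> = (\<integral>\<^sup>+y. ennreal ((f x)\<^sup>2 * x powr (-1 - 2 * \<theta>) / A) * indicator {A * x..2 * A * x} y \<partial>lborel)"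
        using x A1 by (subst nn_integral_cmult_indicator) auto
      also have "\<dots> \<le> (\<integral>\<^sup>+y. ennreal (2 / A * (f y)\<^sup>2) * (ennreal (x powr (-1 - 2 * \<theta>)) * indicator {d..} x * E x y)
          + ennreal c * (D x y * indicator {0..T} y * indicator {0..T} x) \<partial>lborel)"
      proof (rule nn_integral_mono)
        fix y
        show "ennreal ((f x)\<^sup>2 * x powr (-1 - 2 * \<theta>) / A) * indicator {A * x..2 * A * x} y
          \<le> ennreal (2 / A * (f y)\<^sup>2) * (ennreal (x powr (-1 - 2 * \<theta>)) * indicator {d..} x * E x y)
          + ennreal c * (D x y * indicator {0..T} y * indicator {0..T} x)"
        proof (cases "y \<in> {A * x..2 * A * x}")
          case y: True
          have xA: "x < A * x" using x A1 by simp
          moreover have "2 * A * x \<le> 2 * A * B" using x A1 by simp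
          moreover have "A * x \<le> y" "y \<le> 2 * A * x" using y by auto
          ultimately have yT: "0 < y" "y \<le> T" "x \<le> T" "x < y" using x(1) B(2) by linarith+
          define m where "m = x powr (-1 - 2 * \<theta>) / A"
          have m: "0 \<le> m" using A1 by (simp add: m_def)
          have "(f x)\<^sup>2 \<le> 2 * (f y)\<^sup>2 + 2 * (f x - f y)\<^sup>2"
            using zero_le_power2[of "2 * f y - f x"] by (simp add: power2_eq_square algebra_simps)
          then have "(f x)\<^sup>2 * m \<le> (2 * (f y)\<^sup>2 + 2 * (f x - f y)\<^sup>2) * m"
            using m by (rule mult_right_mono)
          also have "\<dots> = 2 / A * (f y)\<^sup>2 * x powr (-1 - 2 * \<theta>) + 2 * m * (f x - f y)\<^sup>2"
            by (simp add: m_def algebra_simps)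
          also have "2 * m * (f x - f y)\<^sup>2 \<le> c * ((f x - f y)\<^sup>2 / \<bar>x - y\<bar> powr (1 + 2 * \<theta>))"
          proof -
            have "\<bar>x - y\<bar> powr (1 + 2 * \<theta>) \<le> (2 * A * x) powr (1 + 2 * \<theta>)"
              using yT y x th by (intro powr_mono2) auto
            then have "2 * m * \<bar>x - y\<bar> powr (1 + 2 * \<theta>) \<le> 2 * m * (2 * A * x) powr (1 + 2 * \<theta>)"
              using m by (intro mult_left_mono) auto
            also have "\<dots> = c * (x powr (-1 - 2 * \<theta>) * x powr (1 + 2 * \<theta>))"
              using A1 x by (simp add: m_def c_def powr_mult)
            also have "\<dots> = c"
              unfolding powr_add[symmetric] using x by simp
            finally have "2 * m \<le> c / \<bar>x - y\<bar> powr (1 + 2 * \<theta>)"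
              using yT by (simp add: field_simps)
            then have "2 * m * (f x - f y)\<^sup>2 \<le> c / \<bar>x - y\<bar> powr (1 + 2 * \<theta>) * (f x - f y)\<^sup>2"
              by (rule mult_right_mono) simp
            then show ?thesis by simp
          qed
          finally have "(f x)\<^sup>2 * m \<le> 2 / A * (f y)\<^sup>2 * x powr (-1 - 2 * \<theta>)
              + c * ((f x - f y)\<^sup>2 / \<bar>x - y\<bar> powr (1 + 2 * \<theta>))" by simp
          then have "ennreal ((f x)\<^sup>2 * m) \<le> ennreal (2 / A * (f y)\<^sup>2 * x powr (-1 - 2 * \<theta>)
              + c * ((f x - f y)\<^sup>2 / \<bar>x - y\<bar> powr (1 + 2 * \<theta>)))" by (rule ennreal_leI)
          also have "\<dots> = ennreal (2 / A * (f y)\<^sup>2) * ennreal (x powr (-1 - 2 * \<theta>)) + ennreal c * D x y"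
            using A1 c unfolding D_def by (subst ennreal_plus) (auto simp: ennreal_mult[symmetric])
          finally show ?thesis
            using y x yT True by (simp add: E_def m_def)
        qed simp
      qed
      also have "\<dots> = (\<integral>\<^sup>+y. ennreal (2 / A * (f y)\<^sup>2) * (ennreal (x powr (-1 - 2 * \<theta>)) * indicator {d..} x * E x y) \<partial>lborel)
          + (\<integral>\<^sup>+y. ennreal c * (D x y * indicator {0..T} y * indicator {0..T} x) \<partial>lborel)"
        by (rule nn_integral_add) measurable
      finally show ?thesis using True by simp
    qed simp
    have inner: "(\<integral>\<^sup>+x. ennreal (x powr (-1 - 2 * \<theta>)) * indicator {d..} x * E x y \<partial>lborel)
        \<le> ennreal ((y / (2 * A)) powr (-2 * \<theta>)) * indicator {d..} y" if y: "0 < y" for y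
    proof -
      have "(\<integral>\<^sup>+x. ennreal (x powr (-1 - 2 * \<theta>)) * indicator {d..} x * E x y \<partial>lborel)
          \<le> (\<integral>\<^sup>+x. ennreal ((y / (2 * A)) powr (-1 - 2 * \<theta>)) * indicator {d..} y * indicator {y / (2 * A)..y / A} x \<partial>lborel)"
      proof (rule nn_integral_mono)
        fix x
        show "ennreal (x powr (-1 - 2 * \<theta>)) * indicator {d..} x * E x y
          \<le> ennreal ((y / (2 * A)) powr (-1 - 2 * \<theta>)) * indicator {d..} y * indicator {y / (2 * A)..y / A} x"
        proof (cases "d \<le> x \<and> A * x \<le> y \<and> y \<le> 2 * A * x")
          case True
          then have x: "0 < x" "y / (2 * A) \<le> x" "x \<le> y / A" using d A1 by (auto simp: field_simps)
          have "x \<le> A * x" using x A1 by simp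
          then have dy: "d \<le> y" using True by linarith
          have "x powr (-1 - 2 * \<theta>) \<le> (y / (2 * A)) powr (-1 - 2 * \<theta>)"
            using x y A1 th by (intro powr_mono2') auto
          then show ?thesis using True x dy by (simp add: E_def ennreal_leI)
        qed (auto simp: E_def)
      qed
      also have "\<dots> = ennreal ((y / (2 * A)) powr (-1 - 2 * \<theta>)) * indicator {d..} y * ennreal (y / A - y / (2 * A))"
        using y A1 by (subst nn_integral_cmult_indicator) (auto simp: field_simps)
      also have "\<dots> = ennreal ((y / (2 * A)) powr (-1 - 2 * \<theta>)) * ennreal (y / (2 * A)) * indicator {d..} y"
        using A1 by (simp add: mult_ac)
      also have "ennreal ((y / (2 * A)) powr (-1 - 2 * \<theta>)) * ennreal (y / (2 * A)) = ennreal ((y / (2 * A)) powr (-2 * \<theta>))"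
      proof -
        have "z powr (-1 - 2 * \<theta>) * z = z powr (-2 * \<theta>)" if "0 < z" for z :: real
          using powr_add[of z "-1 - 2 * \<theta>" 1] that by simp
        from this[of "y / (2 * A)"] show ?thesis using y A1 by (subst ennreal_mult[symmetric]) auto
      qed
      finally show ?thesis .
    qed
    have "(\<integral>\<^sup>+x. F x * indicator {d..B} x \<partial>lborel)
        \<le> (\<integral>\<^sup>+x. \<integral>\<^sup>+y. ennreal (2 / A * (f y)\<^sup>2) * (ennreal (x powr (-1 - 2 * \<theta>)) * indicator {d..} x * E x y) \<partial>lborel \<partial>lborel)
          + (\<integral>\<^sup>+x. \<integral>\<^sup>+y. ennreal c * (D x y * indicator {0..T} y * indicator {0..T} x) \<partial>lborel \<partial>lborel)"
      by (subst nn_integral_add[symmetric]) (measurable, rule nn_integral_mono, rule near)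
    also have "(\<integral>\<^sup>+x. \<integral>\<^sup>+y. ennreal c * (D x y * indicator {0..T} y * indicator {0..T} x) \<partial>lborel \<partial>lborel)
        = ennreal c * gagliardo_sq \<theta> 0 T f"
      by (simp add: gagliardo_sq_lborel D_def nn_integral_multc nn_integral_cmult)
    also have "(\<integral>\<^sup>+x. \<integral>\<^sup>+y. ennreal (2 / A * (f y)\<^sup>2) * (ennreal (x powr (-1 - 2 * \<theta>)) * indicator {d..} x * E x y) \<partial>lborel \<partial>lborel)
        = (\<integral>\<^sup>+y. \<integral>\<^sup>+x. ennreal (2 / A * (f y)\<^sup>2) * (ennreal (x powr (-1 - 2 * \<theta>)) * indicator {d..} x * E x y) \<partial>lborel \<partial>lborel)"
      by (rule lborel_pair.Fubini') measurable
    also have "\<dots> = (\<integral>\<^sup>+y. ennreal (2 / A * (f y)\<^sup>2) * (\<integral>\<^sup>+x. ennreal (x powr (-1 - 2 * \<theta>)) * indicator {d..} x * E x y \<partial>lborel) \<partial>lborel)"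
      by (intro nn_integral_cong nn_integral_cmult) measurable
    also have "\<dots> \<le> (\<integral>\<^sup>+y. ennreal (1/2) * (F y * indicator {d..} y) \<partial>lborel)"
    proof (rule nn_integral_mono)
      fix y
      show "ennreal (2 / A * (f y)\<^sup>2) * (\<integral>\<^sup>+x. ennreal (x powr (-1 - 2 * \<theta>)) * indicator {d..} x * E x y \<partial>lborel)
          \<le> ennreal (1/2) * (F y * indicator {d..} y)"
      proof (cases "0 < y")
        case True
        have "ennreal (2 / A * (f y)\<^sup>2) * (\<integral>\<^sup>+x. ennreal (x powr (-1 - 2 * \<theta>)) * indicator {d..} x * E x y \<partial>lborel)
            \<le> ennreal (2 / A * (f y)\<^sup>2) * (ennreal ((y / (2 * A)) powr (-2 * \<theta>)) * indicator {d..} y)"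
          using True by (intro mult_left_mono inner) auto
        also have "\<dots> = ennreal (2 / A * (2 * A) powr (2 * \<theta>) * ((f y)\<^sup>2 * y powr (-2 * \<theta>))) * indicator {d..} y"
          using A1 True by (simp add: powr_divide powr_minus field_simps flip: ennreal_mult mult.assoc)
        also have "\<dots> \<le> ennreal (1/2 * ((f y)\<^sup>2 * y powr (-2 * \<theta>))) * indicator {d..} y"
          by (intro mult_right_mono ennreal_leI contraction) auto
        also have "\<dots> = ennreal (1/2) * (F y * indicator {d..} y)"
          unfolding F_def by (subst ennreal_mult) (auto simp: mult.assoc)
        finally show ?thesis .
      qed (simp add: f0)
    qed
    also have "\<dots> = ennreal (1/2) * W"
      unfolding W_def by (rule nn_integral_cmult) measurable
    finally have 1: "(\<integral>\<^sup>+x. F x * indicator {d..B} x \<partial>lborel) \<le> ennreal (1/2) * W + ennreal c * gagliardo_sq \<theta> 0 T f"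
      by (simp add: add_right_mono)
    have 2: "(\<integral>\<^sup>+x. F x * indicator {B..} x \<partial>lborel) \<le> ennreal (B powr (-2 * \<theta>)) * S"
    proof -
      have "(\<integral>\<^sup>+x. F x * indicator {B..} x \<partial>lborel) \<le> (\<integral>\<^sup>+x. ennreal (B powr (-2 * \<theta>)) * ennreal ((f x)\<^sup>2) \<partial>lborel)"
      proof (rule nn_integral_mono)
        fix x
        show "F x * indicator {B..} x \<le> ennreal (B powr (-2 * \<theta>)) * ennreal ((f x)\<^sup>2)"
        proof (cases "B \<le> x")
          case True
          then have "x powr (-2 * \<theta>) \<le> B powr (-2 * \<theta>)"
            using B th by (intro powr_mono2') auto
          then have "(f x)\<^sup>2 * x powr (-2 * \<theta>) \<le> B powr (-2 * \<theta>) * (f x)\<^sup>2"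
            by (subst mult.commute) (rule mult_right_mono, auto)
          then show ?thesis
            using True by (simp add: F_def ennreal_leI flip: ennreal_mult)
        qed simp
      qed
      also have "\<dots> = ennreal (B powr (-2 * \<theta>)) * S"
        unfolding S_def by (rule nn_integral_cmult) measurable
      finally show ?thesis .
    qed
    have "W \<le> (\<integral>\<^sup>+x. F x * indicator {d..B} x + F x * indicator {B..} x \<partial>lborel)"
      unfolding W_def by (intro nn_integral_mono) (auto simp: indicator_def)
    also have "\<dots> = (\<integral>\<^sup>+x. F x * indicator {d..B} x \<partial>lborel) + (\<integral>\<^sup>+x. F x * indicator {B..} x \<partial>lborel)"
      by (rule nn_integral_add) measurable
    also have "\<dots> \<le> (ennreal (1/2) * W + ennreal c * gagliardo_sq \<theta> 0 T f) + ennreal (B powr (-2 * \<theta>)) * S"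
      by (intro add_mono 1 2)
    finally show "(\<integral>\<^sup>+x. F x * indicator {d..} x \<partial>lborel)
        \<le> ennreal (1/2) * (\<integral>\<^sup>+x. F x * indicator {d..} x \<partial>lborel)
          + (ennreal c * gagliardo_sq \<theta> 0 T f + ennreal (B powr (-2 * \<theta>)) * S)"
      by (simp add: W_def add.assoc)
  qed
  have "(\<integral>\<^sup>+x. F x \<partial>lborel) \<le> (\<integral>\<^sup>+x. (SUP k. F x * indicator {1 / real (Suc k)..} x) \<partial>lborel)"
  proof (rule nn_integral_mono)
    fix x
    show "F x \<le> (SUP k. F x * indicator {1 / real (Suc k)..} x)"
    proof (cases "0 < x")
      case True
      then obtain k where "1 / real (Suc k) < x"
        using reals_Archimedean[of x] by (auto simp: inverse_eq_divide)
      then show ?thesis by (intro SUP_upper2[of k]) auto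
    qed (simp add: F_def f0)
  qed
  also have "\<dots> = (SUP k. \<integral>\<^sup>+x. F x * indicator {1 / real (Suc k)..} x \<partial>lborel)"
  proof (rule nn_integral_monotone_convergence_SUP)
    show "incseq (\<lambda>k x. F x * indicator {1 / real (Suc k)..} x)"
    proof (intro monoI le_funI mult_left_mono)
      fix k l :: nat and x :: real
      assume "k \<le> l"
      then have "1 / real (Suc l) \<le> 1 / real (Suc k)" by (intro divide_left_mono) auto
      then show "(indicator {1 / real (Suc k)..} x :: ennreal) \<le> indicator {1 / real (Suc l)..} x"
        by (auto simp: indicator_def)
    qed simp
  qed measurable
  also have "\<dots> \<le> 2 * (ennreal c * gagliardo_sq \<theta> 0 T f + ennreal (B powr (-2 * \<theta>)) * S)"
    by (intro SUP_least tail) simp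
  finally show ?thesis by (simp add: F_def S_def c_def B_def)
qed

text \<open>
Fractional Hardy inequality for \<open>\<theta> > 1/2\<close> and functions vanishing at \<open>0\<close>. Let
\<open>M x\<close> be the mean of \<open>u\<close> over \<open>[0,x]\<close> and \<open>h = u - M\<close>. By Cauchy--Schwarz
\<open>h\<close> satisfies the desired bound, because \<open>|x - y| \<le> x\<close> in the mean defining it. Moreover
\<open>M' x = h x / x\<close>, and \<open>M\<close> tends to \<open>u 0 = 0\<close> at \<open>0\<close>, so
\<open>|M x| \<le> \<integral>\<^sub>0\<^sup>x |h t| / t dt\<close> and \<open>M\<close> inherits the bound of \<open>h\<close> by
\<open>hardy_weighted\<close>.
\<close>
lemma hardy_above_half:
  assumes T: "0 < T" and th: "1/2 < \<theta>"
    and u: "continuous_on {0..T} u" "u 0 = 0"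
    and f: "f = (\<lambda>x. if x \<in> {0<..<T} then u x else 0)"
  shows "(\<integral>\<^sup>+x. ennreal ((f x)\<^sup>2 * x powr (-2 * \<theta>)) \<partial>lborel)
    \<le> ennreal (2 + 2 / (\<theta> - 1/2)\<^sup>2) * gagliardo_sq \<theta> 0 T f"
proof -
  define P where "P x = integral {0..x} u" for x
  define M where "M x = P x / x" for x
  define h where "h x = (if x \<in> {0<..<T} then u x - M x else 0)" for x
  have dP: "(P has_real_derivative u x) (at x within {0..T})" if "x \<in> {0..T}" for x
    unfolding P_def using u(1) that by (rule integral_has_real_derivative)
  have contP: "continuous_on {0..T} P"
    by (rule DERIV_continuous_on[OF dP])
  have contM: "continuous_on {0<..<T} M"
    unfolding M_def by (intro continuous_intros continuous_on_subset[OF contP]) auto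
  have contu: "continuous_on {0<..<T} u"
    by (rule continuous_on_subset[OF u(1)]) auto
  have [measurable]: "f \<in> borel_measurable borel"
    unfolding f using contu by (intro borel_measurable_continuous_on_if) auto
  have [measurable]: "h \<in> borel_measurable borel"
    unfolding h_def using contu contM by (intro borel_measurable_continuous_on_if continuous_intros) auto
  define D where "D x y = ennreal ((f x - f y)\<^sup>2 / \<bar>x - y\<bar> powr (1 + 2 * \<theta>))" for x y
  have [measurable]: "case_prod D \<in> borel_measurable (borel \<Otimes>\<^sub>M borel)"
    unfolding D_def by measurable

  \<comment> \<open>The deviation from the mean over \<open>[0,x]\<close>, bounded pointwise by the inner Gagliardo integral.\<close>
  have osc: "ennreal ((h x)\<^sup>2 * x powr (-2 * \<theta>)) * indicator {0<..<T} x
      \<le> (\<integral>\<^sup>+y. D x y * indicator {0..T} y \<partial>lborel) * indicator {0..T} x" for x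
  proof (cases "x \<in> {0<..<T}")
    case True
    then have x: "0 < x" "x < T" by auto
    have int: "integrable lborel (\<lambda>y. indicator {0<..<x} y * f y)"
      and val: "(LINT y|lborel. indicator {0<..<x} y * f y) = P x"
    proof -
      have "integrable lborel (\<lambda>y. indicator {0..x} y *\<^sub>R u y)"
        using x by (intro borel_integrable_compact continuous_on_subset[OF u(1)]) auto
      then have "set_integrable lborel {0..x} u"
        by (simp add: set_integrable_def)
      then have *: "set_integrable lborel {0<..<x} u"
        by (rule set_integrable_subset) auto
      have eq: "(\<lambda>y. indicator {0<..<x} y * f y) = (\<lambda>y. indicator {0<..<x} y *\<^sub>R u y)"
        using x by (auto simp: f indicator_def)
      show "integrable lborel (\<lambda>y. indicator {0<..<x} y * f y)"
        using * unfolding eq set_integrable_def .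
      have "(LINT y|lborel. indicator {0<..<x} y * f y) = integral {0<..<x} u"
        unfolding eq using set_borel_integral_eq_integral(2)[OF *] by (simp only: set_lebesgue_integral_def)
      then show "(LINT y|lborel. indicator {0<..<x} y * f y) = P x"
        by (simp add: P_def integral_open_interval_real)
    qed
    have "(LINT y|lborel. indicator {0<..<x} y * (f x - f y)) = x * u x - P x"
    proof -
      have "(\<lambda>y. indicator {0<..<x} y * (f x - f y))
          = (\<lambda>y. indicator {0<..<x} y * f x - indicator {0<..<x} y * f y)"
        by (simp add: algebra_simps)
      then have "(LINT y|lborel. indicator {0<..<x} y * (f x - f y))
          = (LINT y|lborel. indicator {0<..<x} y * f x) - P x"
        using int val x by (subst val[symmetric]) (simp add: Bochner_Integration.integral_diff)
      also have "(LINT y|lborel. indicator {0<..<x} y * f x) = x * u x"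
        using x by (simp add: f)
      finally show ?thesis .
    qed
    also have "x * u x - P x = x * h x"
      using x by (simp add: h_def M_def field_simps)
    finally have "ennreal ((x * h x)\<^sup>2)
        \<le> (\<integral>\<^sup>+y. ennreal (indicator {0<..<x} y) \<partial>lborel)
          * (\<integral>\<^sup>+y. ennreal (indicator {0<..<x} y * (f x - f y)\<^sup>2) \<partial>lborel)"
      using weighted_square_integral[of "indicator {0<..<x}" lborel "\<lambda>y. f x - f y"] by simp
    also have "(\<integral>\<^sup>+y. ennreal (indicator {0<..<x} y) \<partial>lborel) = ennreal x"
      using x by (simp add: ennreal_indicator)
    also have "(\<integral>\<^sup>+y. ennreal (indicator {0<..<x} y * (f x - f y)\<^sup>2) \<partial>lborel)
        \<le> (\<integral>\<^sup>+y. ennreal (x powr (1 + 2 * \<theta>)) * (D x y * indicator {0..T} y) \<partial>lborel)"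
    proof (rule nn_integral_mono)
      fix y
      show "ennreal (indicator {0<..<x} y * (f x - f y)\<^sup>2)
          \<le> ennreal (x powr (1 + 2 * \<theta>)) * (D x y * indicator {0..T} y)"
      proof (cases "y \<in> {0<..<x}")
        case y: True
        have "\<bar>x - y\<bar> powr (1 + 2 * \<theta>) \<le> x powr (1 + 2 * \<theta>)"
          using y th by (intro powr_mono2) auto
        then have "(f x - f y)\<^sup>2 * \<bar>x - y\<bar> powr (1 + 2 * \<theta>) \<le> (f x - f y)\<^sup>2 * x powr (1 + 2 * \<theta>)"
          by (rule mult_left_mono) simp
        then have "(f x - f y)\<^sup>2 \<le> x powr (1 + 2 * \<theta>) * ((f x - f y)\<^sup>2 / \<bar>x - y\<bar> powr (1 + 2 * \<theta>))"
          using y by (simp add: field_simps)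
        then show ?thesis
          using y x by (simp add: D_def ennreal_leI flip: ennreal_mult)
      qed simp
    qed
    also have "\<dots> = ennreal (x powr (1 + 2 * \<theta>)) * (\<integral>\<^sup>+y. D x y * indicator {0..T} y \<partial>lborel)"
      by (rule nn_integral_cmult) measurable
    finally have bound: "ennreal ((x * h x)\<^sup>2)
        \<le> ennreal x * (ennreal (x powr (1 + 2 * \<theta>)) * (\<integral>\<^sup>+y. D x y * indicator {0..T} y \<partial>lborel))"
      by (simp add: mult_left_mono)
    have s: "x powr (-2 - 2 * \<theta>) * x\<^sup>2 = x powr (-2 * \<theta>)"
      and s': "x powr (-2 - 2 * \<theta>) * (x * x powr (1 + 2 * \<theta>)) = 1"
    proof -
      have "x powr (-2 - 2 * \<theta>) * x powr 2 = x powr (-2 * \<theta>)"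
        unfolding powr_add[symmetric] by simp
      then show "x powr (-2 - 2 * \<theta>) * x\<^sup>2 = x powr (-2 * \<theta>)"
        using x by simp
      have "x powr (-2 - 2 * \<theta>) * (x powr 1 * x powr (1 + 2 * \<theta>)) = 1"
        unfolding powr_add[symmetric] using x by simp
      then show "x powr (-2 - 2 * \<theta>) * (x * x powr (1 + 2 * \<theta>)) = 1"
        using x by simp
    qed
    have "ennreal ((h x)\<^sup>2 * x powr (-2 * \<theta>)) = ennreal (x powr (-2 - 2 * \<theta>)) * ennreal ((x * h x)\<^sup>2)"
      by (subst s[symmetric]) (simp add: power_mult_distrib mult_ac flip: ennreal_mult)
    also have "\<dots> \<le> ennreal (x powr (-2 - 2 * \<theta>))
        * (ennreal x * (ennreal (x powr (1 + 2 * \<theta>)) * (\<integral>\<^sup>+y. D x y * indicator {0..T} y \<partial>lborel)))"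
      using bound by (rule mult_left_mono) simp
    also have "\<dots> = ennreal (x powr (-2 - 2 * \<theta>) * (x * x powr (1 + 2 * \<theta>)))
        * (\<integral>\<^sup>+y. D x y * indicator {0..T} y \<partial>lborel)"
      using x by (simp add: ennreal_mult mult.assoc)
    also have "\<dots> = (\<integral>\<^sup>+y. D x y * indicator {0..T} y \<partial>lborel)"
      unfolding s' by simp
    finally show ?thesis using x by simp
  qed simp
  have osc_int: "(\<integral>\<^sup>+x. ennreal ((h x)\<^sup>2 * x powr (-2 * \<theta>)) * indicator {0<..<T} x \<partial>lborel)
      \<le> gagliardo_sq \<theta> 0 T f"
    unfolding gagliardo_sq_lborel using osc by (intro nn_integral_mono) (simp add: D_def)

  \<comment> \<open>\<open>M\<close> is the difference quotient at \<open>0\<close> of the primitive of \<open>u\<close>.\<close>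
  have M0: "(M \<longlongrightarrow> 0) (at_right 0)"
  proof -
    have "((\<lambda>y. (P y - P 0) / (y - 0)) \<longlongrightarrow> u 0) (at 0 within {0..T})"
      using dP[of 0] T by (simp add: has_field_derivative_iff)
    then show ?thesis
      using T u(2) by (simp add: at_within_Icc_at_right M_def[abs_def] P_def)
  qed
  have avg: "ennreal \<bar>M x\<bar> \<le> (\<integral>\<^sup>+t. ennreal (\<bar>h t\<bar> / t) * indicator {0<..<x} t \<partial>lborel)"
    if x: "x \<in> {0<..<T}" for x
  proof -
    define R where "R = (\<integral>\<^sup>+t. ennreal (\<bar>h t\<bar> / t) * indicator {0<..<x} t \<partial>lborel)"
    \<comment> \<open>The fundamental theorem of calculus for \<open>M\<close> away from \<open>0\<close>, uniformly in \<open>d\<close>.\<close>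
    have step: "ennreal \<bar>M x - M d\<bar> \<le> R" if d: "d \<in> {0<..<x}" for d
    proof -
      have ivl: "{d..x} \<subseteq> {0<..<T}" using d x by auto
      have cont: "continuous_on {d..x} (\<lambda>t. (u t - M t) / t)"
        using ivl by (intro continuous_intros continuous_on_subset[OF contu] continuous_on_subset[OF contM]) auto
      have der: "(M has_vector_derivative (u t - M t) / t) (at t within {d..x})" if "d \<le> t" "t \<le> x" for t
      proof -
        have t: "0 < t" "t \<in> {0..T}" using that d x by auto
        have "(P has_real_derivative u t) (at t within {d..x})"
          using dP[OF t(2)] by (rule DERIV_subset) (use d x in auto)
        then have "((\<lambda>t. P t / t) has_real_derivative (u t * t - P t * 1) / (t * t)) (at t within {d..x})"
          using t by (intro DERIV_divide) auto
        also have "(u t * t - P t * 1) / (t * t) = (u t - M t) / t"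
          using t by (simp add: M_def field_simps)
        finally show ?thesis
          by (simp add: M_def[abs_def] has_real_derivative_iff_has_vector_derivative)
      qed
      have dx: "d \<le> x" using d by simp
      have hb: "has_bochner_integral lborel (\<lambda>t. indicator {d..x} t *\<^sub>R ((u t - M t) / t)) (M x - M d)"
        using dx der cont by (rule has_bochner_integral_FTC_Icc)
      then have "M x - M d = (LINT t|lborel. indicator {d..x} t *\<^sub>R ((u t - M t) / t))"
        by (simp add: has_bochner_integral_integral_eq)
      then have "ennreal \<bar>M x - M d\<bar> \<le> (\<integral>\<^sup>+t. ennreal (norm (indicator {d..x} t *\<^sub>R ((u t - M t) / t))) \<partial>lborel)"
        using integral_norm_bound_ennreal[of lborel] hb
        by (metis has_bochner_integral_iff real_norm_def)
      also have "\<dots> \<le> R"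
        unfolding R_def
      proof (rule nn_integral_mono_AE)
        have "AE t in lborel. t \<noteq> x" by (rule AE_lborel_singleton)
        then show "AE t in lborel. ennreal (norm (indicator {d..x} t *\<^sub>R ((u t - M t) / t)))
            \<le> ennreal (\<bar>h t\<bar> / t) * indicator {0<..<x} t"
          by eventually_elim (use d x in \<open>auto simp: indicator_def h_def\<close>)
      qed
      finally show ?thesis .
    qed
    show ?thesis
    proof (cases R)
      case (real r)
      have "((\<lambda>d. \<bar>M x - M d\<bar>) \<longlongrightarrow> \<bar>M x - 0\<bar>) (at_right 0)"
        by (intro tendsto_intros M0)
      moreover have "\<forall>\<^sub>F d in at_right 0. \<bar>M x - M d\<bar> \<le> r"
        unfolding eventually_at_right_field
        using x step real by (intro exI[of _ x]) (auto simp: ennreal_le_iff)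
      ultimately have "\<bar>M x - 0\<bar> \<le> r"
        by (rule tendsto_upperbound) simp
      then show ?thesis
        using real by (simp add: R_def[symmetric] ennreal_leI)
    qed (simp add: R_def[symmetric])
  qed

  have "(\<integral>\<^sup>+x. ennreal ((f x)\<^sup>2 * x powr (-2 * \<theta>)) \<partial>lborel)
      \<le> (\<integral>\<^sup>+x. 2 * (ennreal ((h x)\<^sup>2 * x powr (-2 * \<theta>)) * indicator {0<..<T} x)
        + 2 * ((\<integral>\<^sup>+t. ennreal (\<bar>h t\<bar> / t) * indicator {0<..<x} t \<partial>lborel)\<^sup>2
          * (ennreal (x powr (-2 * \<theta>)) * indicator {0<..<T} x)) \<partial>lborel)"
  proof (rule nn_integral_mono)
    fix x
    show "ennreal ((f x)\<^sup>2 * x powr (-2 * \<theta>))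
        \<le> 2 * (ennreal ((h x)\<^sup>2 * x powr (-2 * \<theta>)) * indicator {0<..<T} x)
        + 2 * ((\<integral>\<^sup>+t. ennreal (\<bar>h t\<bar> / t) * indicator {0<..<x} t \<partial>lborel)\<^sup>2
          * (ennreal (x powr (-2 * \<theta>)) * indicator {0<..<T} x))"
    proof (cases "x \<in> {0<..<T}")
      case True
      have e: "f x = h x + M x" using True by (simp add: f h_def)
      have "(f x)\<^sup>2 \<le> 2 * (h x)\<^sup>2 + 2 * \<bar>M x\<bar>\<^sup>2"
        using zero_le_power2[of "h x - M x"] by (simp add: e power2_eq_square algebra_simps)
      then have "(f x)\<^sup>2 * x powr (-2 * \<theta>) \<le> (2 * (h x)\<^sup>2 + 2 * \<bar>M x\<bar>\<^sup>2) * x powr (-2 * \<theta>)"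
        by (rule mult_right_mono) simp
      then have "ennreal ((f x)\<^sup>2 * x powr (-2 * \<theta>))
          \<le> ennreal (2 * ((h x)\<^sup>2 * x powr (-2 * \<theta>)) + 2 * (\<bar>M x\<bar>\<^sup>2 * x powr (-2 * \<theta>)))"
        by (intro ennreal_leI) (simp add: algebra_simps)
      also have "\<dots> = 2 * ennreal ((h x)\<^sup>2 * x powr (-2 * \<theta>)) + 2 * ((ennreal \<bar>M x\<bar>)\<^sup>2 * ennreal (x powr (-2 * \<theta>)))"
        by (subst ennreal_plus) (simp_all add: ennreal_mult ennreal_power)
      also have "\<dots> \<le> 2 * ennreal ((h x)\<^sup>2 * x powr (-2 * \<theta>))
          + 2 * ((\<integral>\<^sup>+t. ennreal (\<bar>h t\<bar> / t) * indicator {0<..<x} t \<partial>lborel)\<^sup>2 * ennreal (x powr (-2 * \<theta>)))"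
        by (intro add_left_mono mult_left_mono mult_right_mono power_mono avg True) simp_all
      finally show ?thesis using True by simp
    qed (auto simp: f)
  qed
  also have "\<dots> = 2 * (\<integral>\<^sup>+x. ennreal ((h x)\<^sup>2 * x powr (-2 * \<theta>)) * indicator {0<..<T} x \<partial>lborel)
      + 2 * (\<integral>\<^sup>+x. (\<integral>\<^sup>+t. ennreal (\<bar>h t\<bar> / t) * indicator {0<..<x} t \<partial>lborel)\<^sup>2
          * (ennreal (x powr (-2 * \<theta>)) * indicator {0<..<T} x) \<partial>lborel)"
  proof -
    have [measurable]: "(\<lambda>x. \<integral>\<^sup>+t. ennreal (\<bar>h t\<bar> / t) * indicator {0<..<x} t \<partial>lborel) \<in> borel_measurable borel"
    proof -
      have "(\<lambda>x. \<integral>\<^sup>+t. (if 0 < t \<and> t < x then ennreal (\<bar>h t\<bar> / t) else 0) \<partial>lborel) \<in> borel_measurable borel"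
        by measurable
      also have "(\<lambda>x. \<integral>\<^sup>+t. (if 0 < t \<and> t < x then ennreal (\<bar>h t\<bar> / t) else 0) \<partial>lborel)
          = (\<lambda>x. \<integral>\<^sup>+t. ennreal (\<bar>h t\<bar> / t) * indicator {0<..<x} t \<partial>lborel)"
        by (intro ext nn_integral_cong) (auto simp: indicator_def)
      finally show ?thesis .
    qed
    show ?thesis
      by (subst nn_integral_add) (simp_all add: nn_integral_cmult)
  qed
  also have "\<dots> \<le> 2 * gagliardo_sq \<theta> 0 T f + 2 * (ennreal (1 / (\<theta> - 1/2)\<^sup>2) * gagliardo_sq \<theta> 0 T f)"
    by (intro add_mono mult_left_mono osc_int order_trans[OF hardy_weighted[OF _ th]]) simp_all
  also have "\<dots> = ennreal (2 + 2 / (\<theta> - 1/2)\<^sup>2) * gagliardo_sq \<theta> 0 T f"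
  proof -
    have "ennreal (2 + 2 * (1 / (\<theta> - 1/2)\<^sup>2)) = 2 + 2 * ennreal (1 / (\<theta> - 1/2)\<^sup>2)"
      by (subst ennreal_plus; (subst ennreal_mult)?) simp_all
    then show ?thesis by (simp add: distrib_right mult.assoc)
  qed
  finally show ?thesis .
qed

section \<open>Test functions\<close>

lemma test_function_has_derivatives:
  assumes "test_function a b \<phi>"
  shows "(\<phi> has_real_derivative deriv \<phi> x) (at x)"
    and "(deriv \<phi> has_real_derivative deriv (deriv \<phi>) x) (at x)"
proof -
  have "((deriv ^^ 0) \<phi>) field_differentiable (at x)" "((deriv ^^ 1) \<phi>) field_differentiable (at x)"
    using assms unfolding test_function_def by blast+
  then show "(\<phi> has_real_derivative deriv \<phi> x) (at x)"
    and "(deriv \<phi> has_real_derivative deriv (deriv \<phi>) x) (at x)"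
    by (simp_all add: field_differentiable_derivI)
qed

lemma test_function_continuous:
  assumes "test_function a b \<phi>"
  shows "continuous_on S \<phi>" and "continuous_on S (deriv \<phi>)"
  using test_function_has_derivatives[OF assms]
  by (meson DERIV_isCont continuous_at_imp_continuous_on)+

lemma test_function_measurable:
  assumes "test_function a b \<phi>"
  shows "\<phi> \<in> borel_measurable borel" and "deriv \<phi> \<in> borel_measurable borel"
  using test_function_continuous[OF assms] by (auto intro: borel_measurable_continuous_onI)

lemma test_function_support:
  assumes ab: "a < b" and \<phi>: "test_function a b \<phi>"
  obtains l r where "a < l" "l \<le> r" "r < b"
    "\<And>x. x \<notin> {l..r} \<Longrightarrow> \<phi> x = 0" "\<And>x. x \<notin> {l..r} \<Longrightarrow> deriv \<phi> x = 0"
proof -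
  obtain K where K: "compact K" "K \<subseteq> {a<..<b}" "\<And>x. x \<notin> K \<Longrightarrow> \<phi> x = 0"
    using \<phi> unfolding test_function_def by blast
  obtain l r where lr: "a < l" "l \<le> r" "r < b" "K \<subseteq> {l..r}"
  proof (cases "K = {}")
    case True
    then show ?thesis using that[of "(a + b) / 2" "(a + b) / 2"] ab by auto
  next
    case False
    obtain l where l: "l \<in> K" "\<forall>t\<in>K. l \<le> t"
      using compact_attains_inf[OF K(1) False] by blast
    obtain r where r: "r \<in> K" "\<forall>t\<in>K. t \<le> r"
      using compact_attains_sup[OF K(1) False] by blast
    show ?thesis by (rule that[of l r]) (use l r K(2) in auto)
  qed
  have z: "\<phi> x = 0" if "x \<notin> {l..r}" for x
    using K(3) lr(4) that by blast
  have "deriv \<phi> x = 0" if x: "x \<notin> {l..r}" for x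
  proof (rule DERIV_imp_deriv)
    show "(\<phi> has_real_derivative 0) (at x)"
      by (rule has_field_derivative_transform_within_open[of "\<lambda>_. 0" _ _ "- {l..r}"])
        (use x z in auto)
  qed
  with lr z show ?thesis using that by blast
qed

lemma test_function_subinterval:
  assumes "test_function l r \<phi>" "a \<le> l" "r \<le> b"
  shows "test_function a b \<phi>"
proof -
  have "{l<..<r} \<subseteq> {a<..<b}" using assms by auto
  then show ?thesis using assms(1) unfolding test_function_def by blast
qed

lemma test_function_diff_cmult:
  assumes \<phi>: "test_function a b \<phi>" and \<psi>: "test_function a b \<psi>"
  shows "test_function a b (\<lambda>x. \<phi> x - c * \<psi> x)"
proof -
  have D: "((deriv ^^ n) \<phi>) field_differentiable (at x)" "((deriv ^^ n) \<psi>) field_differentiable (at x)" for n x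
    using \<phi> \<psi> unfolding test_function_def by blast+
  have eq: "(deriv ^^ n) (\<lambda>x. \<phi> x - c * \<psi> x) = (\<lambda>x. (deriv ^^ n) \<phi> x - c * (deriv ^^ n) \<psi> x)" for n
  proof (induction n)
    case (Suc n)
    have "deriv (\<lambda>x. (deriv ^^ n) \<phi> x - c * (deriv ^^ n) \<psi> x) x
        = deriv ((deriv ^^ n) \<phi>) x - c * deriv ((deriv ^^ n) \<psi>) x" for x
      by (rule DERIV_imp_deriv) (intro DERIV_diff DERIV_cmult field_differentiable_derivI D)
    then show ?case by (simp add: Suc.IH fun_eq_iff)
  qed simp
  obtain K1 K2 where K: "compact K1" "K1 \<subseteq> {a<..<b}" "\<forall>x. x \<notin> K1 \<longrightarrow> \<phi> x = 0"
    "compact K2" "K2 \<subseteq> {a<..<b}" "\<forall>x. x \<notin> K2 \<longrightarrow> \<psi> x = 0"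
    using \<phi> \<psi> unfolding test_function_def by blast
  have "\<exists>K. compact K \<and> K \<subseteq> {a<..<b} \<and> (\<forall>x. x \<notin> K \<longrightarrow> \<phi> x - c * \<psi> x = 0)"
    using K by (intro exI[of _ "K1 \<union> K2"]) auto
  moreover have "(deriv ^^ n) (\<lambda>x. \<phi> x - c * \<psi> x) field_differentiable (at x)" for n x
    unfolding eq by (intro derivative_intros D)
  ultimately show ?thesis unfolding test_function_def by blast
qed

definition bump_poly :: "real \<Rightarrow> real \<Rightarrow> real poly" where
  "bump_poly a b = [:-a, 1:] * [:b, -1:]"

text \<open>
The functions \<open>p / q ^ k * exp (- c / q)\<close> with \<open>q x = (x - a) * (b - x)\<close> on \<open>(a,b)\<close>,
extended by \<open>0\<close>. The polynomial \<open>p\<close> and the power \<open>k\<close> are there to make the family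
closed under differentiation; the bump itself is the case \<open>p = 1\<close>, \<open>k = 0\<close>.
\<close>
definition flat_bump :: "real \<Rightarrow> real \<Rightarrow> real \<Rightarrow> real poly \<Rightarrow> nat \<Rightarrow> real \<Rightarrow> real" where
  "flat_bump a b c p k x = (if a < x \<and> x < b
     then poly p x / poly (bump_poly a b) x ^ k * exp (- c / poly (bump_poly a b) x) else 0)"

lemma poly_bump_poly: "poly (bump_poly a b) x = (x - a) * (b - x)"
  by (simp add: bump_poly_def algebra_simps)

text \<open>
From \<open>(c / (q m)) ^ m \<le> exp (c / q)\<close> with \<open>m = k + 2\<close>: the exponential beats any power of
\<open>1/q\<close>, here with two powers to spare. These two powers give the quadratic flatness at the end
points, hence derivative \<open>0\<close> there.
\<close>
lemma inverse_power_exp_bounded: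
  fixes c q :: real
  assumes c: "0 < c" and q: "0 < q"
  shows "exp (- c / q) / q ^ k \<le> (real (k + 2) / c) ^ (k + 2) * q\<^sup>2"
proof -
  define m where "m = k + 2"
  have m: "0 < m" by (simp add: m_def)
  have "(c / q / real m) ^ m \<le> (1 + c / q / real m) ^ m"
    using c q by (intro power_mono) auto
  also have "\<dots> \<le> exp (c / q)"
    using c q m by (intro exp_ge_one_plus_x_over_n_power_n) (auto intro: order_trans[of _ 0])
  finally have "(c / q / real m) ^ m * exp (- c / q) \<le> exp (c / q) * exp (- c / q)"
    by (rule mult_right_mono) simp
  also have "\<dots> = 1" by (simp flip: exp_add)
  finally have "(c / q / real m) ^ m * exp (- c / q) \<le> 1" .
  then have "(real m / c) ^ m * q ^ m * ((c / q / real m) ^ m * exp (- c / q)) \<le> (real m / c) ^ m * q ^ m * 1"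
    using c q by (intro mult_left_mono) auto
  also have "(real m / c) ^ m * q ^ m * ((c / q / real m) ^ m * exp (- c / q))
      = ((real m / c) * q * (c / q / real m)) ^ m * exp (- c / q)"
    by (simp add: power_mult_distrib power_divide)
  also have "(real m / c) * q * (c / q / real m) = 1"
    using c q m by simp
  finally have "exp (- c / q) \<le> (real m / c) ^ m * q ^ m" by simp
  also have "q ^ m = q\<^sup>2 * q ^ k"
    unfolding m_def power_add by (rule mult.commute)
  finally have "exp (- c / q) / q ^ k \<le> (real m / c) ^ m * q\<^sup>2"
    using q by (simp only: divide_le_eq zero_less_power mult.assoc if_True)
  then show ?thesis unfolding m_def .
qed

text \<open>
The family is closed under differentiation. Inside the interval this is the quotient rule. At a point
\<open>x\<close> outside \<open>(a,b)\<close>, end points included, the function is bounded by a multiple of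
\<open>(y - x)\<^sup>2\<close>, because \<open>(y - a) * (b - y) \<le> (b - a) * |y - x|\<close>.
\<close>
lemma flat_bump_derivative:
  assumes c: "0 < c" and ab: "a < b"
  defines "Q \<equiv> bump_poly a b"
  shows "(flat_bump a b c p k has_real_derivative
    flat_bump a b c (pderiv p * Q\<^sup>2 - smult (real k) (p * pderiv Q * Q) + smult c (p * pderiv Q)) (k + 2) x) (at x)"
proof (cases "a < x \<and> x < b")
  case True
  then have Qx: "poly Q x \<noteq> 0" by (simp add: Q_def poly_bump_poly)
  have "((\<lambda>x. poly p x / poly Q x ^ k * exp (- c / poly Q x)) has_real_derivative
      (poly (pderiv p) x * poly Q x ^ k - poly p x * (real k * poly Q x ^ (k - 1) * poly (pderiv Q) x))
        / (poly Q x ^ k * poly Q x ^ k) * exp (- c / poly Q x)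
      + poly p x / poly Q x ^ k * (exp (- c / poly Q x) * (c * poly (pderiv Q) x / (poly Q x)\<^sup>2))) (at x)"
    using Qx by (auto intro!: derivative_eq_intros simp: power2_eq_square field_simps)
  also have "(poly (pderiv p) x * poly Q x ^ k - poly p x * (real k * poly Q x ^ (k - 1) * poly (pderiv Q) x))
        / (poly Q x ^ k * poly Q x ^ k) * exp (- c / poly Q x)
      + poly p x / poly Q x ^ k * (exp (- c / poly Q x) * (c * poly (pderiv Q) x / (poly Q x)\<^sup>2))
    = flat_bump a b c (pderiv p * Q\<^sup>2 - smult (real k) (p * pderiv Q * Q) + smult c (p * pderiv Q)) (k + 2) x"
    using True Qx
    by (cases k) (simp_all add: flat_bump_def Q_def[symmetric] field_simps power2_eq_square)
  finally show ?thesis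
    by (rule has_field_derivative_transform_within_open[of _ _ _ "{a<..<b}"])
      (use True in \<open>auto simp: flat_bump_def Q_def\<close>)
next
  case False
  have "compact (poly p ` {a..b})"
    by (intro compact_continuous_image continuous_intros) auto
  then obtain M where M: "\<And>y. y \<in> {a..b} \<Longrightarrow> \<bar>poly p y\<bar> \<le> M"
    using compact_imp_bounded bounded_iff by (metis imageI real_norm_def)
  define C where "C = M * (real (k + 2) / c) ^ (k + 2) * (b - a)\<^sup>2"
  have M0: "0 \<le> M" using M[of a] ab by auto
  have C0: "0 \<le> C" using M0 c by (simp add: C_def)
  have bound: "\<bar>flat_bump a b c p k y\<bar> \<le> C * (y - x)\<^sup>2" for y
  proof (cases "a < y \<and> y < b")
    case y: True
    define q where "q = (y - a) * (b - y)"
    have q: "0 < q" using y by (simp add: q_def)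
    have "q \<le> (b - a) * \<bar>y - x\<bar>"
    proof (cases "x \<le> a")
      case True
      then have "(y - a) * (b - y) \<le> \<bar>y - x\<bar> * (b - a)"
        using y by (intro mult_mono) auto
      then show ?thesis by (simp add: q_def mult.commute)
    next
      case x: False
      then have "(y - a) * (b - y) \<le> (b - a) * \<bar>y - x\<bar>"
        using y False by (intro mult_mono) auto
      then show ?thesis by (simp add: q_def)
    qed
    then have qq: "q\<^sup>2 \<le> (b - a)\<^sup>2 * (y - x)\<^sup>2"
      using q power_mono[of q "(b - a) * \<bar>y - x\<bar>" 2] by (simp add: power_mult_distrib)
    have "\<bar>flat_bump a b c p k y\<bar> = \<bar>poly p y\<bar> * (exp (- c / q) / q ^ k)"
      using y q by (simp add: flat_bump_def poly_bump_poly q_def[symmetric] abs_mult)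
    also have "\<dots> \<le> M * ((real (k + 2) / c) ^ (k + 2) * q\<^sup>2)"
      using y q c M0 by (intro mult_mono M inverse_power_exp_bounded) auto
    also have "\<dots> \<le> M * ((real (k + 2) / c) ^ (k + 2) * ((b - a)\<^sup>2 * (y - x)\<^sup>2))"
      using M0 c by (intro mult_left_mono qq) auto
    finally show ?thesis by (simp add: C_def mult_ac)
  qed (use C0 in \<open>auto simp: flat_bump_def\<close>)
  have zero: "flat_bump a b c p' k' x = 0" for p' k'
    using False by (auto simp: flat_bump_def)
  have "((\<lambda>y. (flat_bump a b c p k y - flat_bump a b c p k x) / (y - x)) \<longlongrightarrow> 0) (at x)"
  proof (rule Lim_null_comparison)
    show "\<forall>\<^sub>F y in at x. norm ((flat_bump a b c p k y - flat_bump a b c p k x) / (y - x)) \<le> C * \<bar>y - x\<bar>"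
      unfolding eventually_at_filter
    proof (intro always_eventually allI impI)
      fix y assume "y \<noteq> x"
      then show "norm ((flat_bump a b c p k y - flat_bump a b c p k x) / (y - x)) \<le> C * \<bar>y - x\<bar>"
        using bound[of y]
        by (simp add: zero abs_divide divide_le_eq power2_eq_square mult.assoc flip: abs_mult)
    qed
    have "((\<lambda>y. C * \<bar>y - x\<bar>) \<longlongrightarrow> C * \<bar>x - x\<bar>) (at x)"
      by (intro tendsto_intros)
    then show "((\<lambda>y. C * \<bar>y - x\<bar>) \<longlongrightarrow> 0) (at x)" by simp
  qed
  then show ?thesis
    by (simp add: has_field_derivative_iff zero)
qed

lemma flat_bump_test_function:
  assumes c: "0 < c" and ab: "l < a" "a < b" "b < r"
  shows "test_function l r (flat_bump a b c p k)"
proof -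
  have "\<exists>p' k'. (deriv ^^ n) (flat_bump a b c p k) = flat_bump a b c p' k'" for n
  proof (induction n)
    case (Suc n)
    then obtain p' k' where e: "(deriv ^^ n) (flat_bump a b c p k) = flat_bump a b c p' k'" by blast
    have "(deriv ^^ Suc n) (flat_bump a b c p k) = deriv (flat_bump a b c p' k')"
      by (simp add: e)
    also have "\<dots> = flat_bump a b c (pderiv p' * (bump_poly a b)\<^sup>2
        - smult (real k') (p' * pderiv (bump_poly a b) * bump_poly a b)
        + smult c (p' * pderiv (bump_poly a b))) (k' + 2)"
      by (rule ext, rule DERIV_imp_deriv, rule flat_bump_derivative[OF c ab(2)])
    finally show ?case by blast
  qed auto
  then have "(deriv ^^ n) (flat_bump a b c p k) field_differentiable (at x)" for n x
    using flat_bump_derivative[OF c ab(2)] unfolding field_differentiable_def by metis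
  moreover have "\<exists>K. compact K \<and> K \<subseteq> {l<..<r} \<and> (\<forall>x. x \<notin> K \<longrightarrow> flat_bump a b c p k x = 0)"
    using ab by (intro exI[of _ "{a..b}"]) (auto simp: flat_bump_def)
  ultimately show ?thesis unfolding test_function_def by blast
qed

section \<open>Uniqueness of weak derivatives\<close>

text \<open>
Open intervals form an intersection-stable generator of the Borel sets, and the Borel sets on which the
integral vanishes form a Dynkin system. So the integral vanishes over every Borel set.
\<close>
lemma integral_zero_on_intervals_imp_AE_zero:
  fixes w :: "real \<Rightarrow> real"
  assumes w: "integrable lborel w"
    and zero: "\<And>a b. a < b \<Longrightarrow> (LINT x|lborel. indicator {a<..<b} x * w x) = 0"
    and total: "(LINT x|lborel. w x) = 0"
  shows "AE x in lborel. w x = 0"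
proof (rule sigma_finite_measure.density_zero[OF lborel.sigma_finite_measure_axioms w])
  fix A :: "real set" assume "A \<in> sets lborel"
  then have A: "A \<in> sigma_sets UNIV (range (\<lambda>(a, b). box a b :: real set))"
    by (simp add: borel_eq_box)
  have meas: "B \<in> sets lborel" if "B \<in> sigma_sets UNIV (range (\<lambda>(a, b). box a b :: real set))" for B
    using that by (simp add: borel_eq_box)
  have sint: "set_integrable lborel B w" if "B \<in> sets lborel" for B
    unfolding set_integrable_def using w that by (rule integrable_mult_indicator[rotated])
  have "Int_stable (range (\<lambda>(a, b). box a b :: real set))"
  proof (rule Int_stableI)
    fix X Y :: "real set"
    assume "X \<in> range (\<lambda>(a, b). box a b)" "Y \<in> range (\<lambda>(a, b). box a b)"
    then obtain a b a' b' where "X = {a<..<b}" "Y = {a'<..<b'}"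
      by (auto simp: box_real)
    then have "X \<inter> Y = (\<lambda>(a, b). box a b) (max a a', min b b')"
      by (auto simp: box_real)
    then show "X \<inter> Y \<in> range (\<lambda>(a, b). box a b)"
      by (rule range_eqI)
  qed
  moreover have "range (\<lambda>(a, b). box a b :: real set) \<subseteq> Pow UNIV" by simp
  ultimately show "(LINT x:A|lborel. w x) = 0"
    using A
  proof (induction rule: sigma_sets_induct_disjoint)
    case (basic A)
    then obtain a b where "A = {a<..<b}" by (auto simp: box_real)
    then show ?case using zero[of a b]
      by (cases "a < b") (auto simp: set_lebesgue_integral_def)
  next
    case (compl A)
    have "(LINT x:UNIV - A|lborel. w x) = (LINT x|lborel. w x - indicator A x * w x)"
      unfolding set_lebesgue_integral_def by (intro Bochner_Integration.integral_cong) (auto simp: indicator_def)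
    also have "\<dots> = 0"
      using compl sint[OF meas[OF compl(1)]] w total
      by (subst Bochner_Integration.integral_diff) (auto simp: set_integrable_def set_lebesgue_integral_def)
    finally show ?case .
  next
    case (union A)
    have "(LINT x:(\<Union>i. A i)|lborel. w x) = (\<Sum>i. LINT x:A i|lborel. w x)"
    proof (rule lebesgue_integral_countable_add)
      show "A i \<in> sets lborel" for i using union(2) meas by blast
      then show "set_integrable lborel (\<Union>i. A i) w" by (intro sint) auto
      show "A i \<inter> A j = {}" if "i \<noteq> j" for i j
        using union(1) that by (auto simp: disjoint_family_on_def)
    qed
    then show ?case using union(3) by simp
  qed (auto simp: set_lebesgue_integral_def)
qed

text \<open>
Fundamental lemma of the calculus of variations. The indicator of \<open>(a,b)\<close> is a bounded
pointwise limit of the bumps \<open>exp (- e / ((x - a - e) * (b - e - x)))\<close> on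
\<open>(a + e, b - e)\<close> as \<open>e\<close> decreases to \<open>0\<close>. Shrinking the interval keeps the supports
compact in \<open>(l,r)\<close> even for \<open>a = l\<close> and \<open>b = r\<close>.
\<close>
lemma test_functions_determine_AE:
  fixes v :: "real \<Rightarrow> real"
  assumes v: "integrable lborel v" and lr: "l < r"
    and test: "\<And>\<phi>. test_function l r \<phi> \<Longrightarrow> (LINT x|lborel. v x * \<phi> x) = 0"
  shows "AE x in lborel. x \<in> {l<..<r} \<longrightarrow> v x = 0"
proof -
  note [measurable] = borel_measurable_integrable[OF v, simplified]
  have inside: "(LINT x|lborel. indicator {a<..<b} x * v x) = 0" if ab: "l \<le> a" "a < b" "b \<le> r" for a b
  proof -
    define e where "e n = (b - a) / real (n + 3)" for n
    define \<phi> where "\<phi> n = flat_bump (a + e n) (b - e n) (e n) 1 0" for n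
    have e: "0 < e n" "2 * e n < b - a" for n
    proof -
      have "(b - a) * 2 < (b - a) * real (n + 3)"
        using ab by (intro mult_strict_left_mono) auto
      then show "2 * e n < b - a"
        by (simp add: e_def divide_less_eq mult.commute)
    qed (use ab in \<open>auto simp: e_def\<close>)
    have e0: "e \<longlonglongrightarrow> 0"
      unfolding e_def by (rule LIMSEQ_ignore_initial_segment[OF lim_const_over_n])
    have test\<phi>: "test_function l r (\<phi> n)" for n
      unfolding \<phi>_def using e[of n] ab by (intro flat_bump_test_function) auto
    have "(\<lambda>n. LINT x|lborel. v x * \<phi> n x) \<longlonglongrightarrow> (LINT x|lborel. indicator {a<..<b} x * v x)"
    proof (rule integral_dominated_convergence[where w="\<lambda>x. \<bar>v x\<bar>"])
      show "(\<lambda>x. v x * \<phi> n x) \<in> borel_measurable lborel" for n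
        using test_function_measurable(1)[OF test\<phi>[of n]] by measurable
      show "AE x in lborel. norm (v x * \<phi> n x) \<le> \<bar>v x\<bar>" for n
      proof (rule AE_I2)
        fix x
        have "\<bar>\<phi> n x\<bar> \<le> 1"
          using e[of n] by (auto simp: \<phi>_def flat_bump_def poly_bump_poly)
        then show "norm (v x * \<phi> n x) \<le> \<bar>v x\<bar>"
          by (simp add: abs_mult mult_left_le)
      qed
      show "AE x in lborel. (\<lambda>n. v x * \<phi> n x) \<longlonglongrightarrow> indicator {a<..<b} x * v x"
      proof (rule AE_I2)
        fix x
        show "(\<lambda>n. v x * \<phi> n x) \<longlonglongrightarrow> indicator {a<..<b} x * v x"
        proof (cases "x \<in> {a<..<b}")
          case True
          have "(\<lambda>n. exp (- e n / ((x - (a + e n)) * ((b - e n) - x)))) \<longlonglongrightarrow> exp (- 0 / ((x - (a + 0)) * ((b - 0) - x)))"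
            using True by (intro tendsto_intros e0) auto
          moreover have "\<forall>\<^sub>F n in sequentially. e n < min (x - a) (b - x)"
            using e0 True by (intro order_tendstoD(2)[OF e0]) auto
          then have "\<forall>\<^sub>F n in sequentially. exp (- e n / ((x - (a + e n)) * ((b - e n) - x))) = \<phi> n x"
            by eventually_elim (auto simp: \<phi>_def flat_bump_def poly_bump_poly)
          ultimately have "(\<lambda>n. \<phi> n x) \<longlonglongrightarrow> 1"
            by (auto intro: Lim_transform_eventually)
          then have "(\<lambda>n. v x * \<phi> n x) \<longlonglongrightarrow> v x * 1" by (intro tendsto_intros)
          then show ?thesis using True by simp
        next
          case False
          then have "\<phi> n x = 0" for n
            using e(1)[of n] by (auto simp: \<phi>_def flat_bump_def)
          then show ?thesis using False by simp
        qed
      qed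
    qed (use v in auto)
    moreover have "(\<lambda>n. LINT x|lborel. v x * \<phi> n x) \<longlonglongrightarrow> 0"
      using test[OF test\<phi>] by simp
    ultimately show ?thesis by (rule LIMSEQ_unique)
  qed
  have "AE x in lborel. indicator {l<..<r} x * v x = 0"
  proof (rule integral_zero_on_intervals_imp_AE_zero)
    show "integrable lborel (\<lambda>x. indicator {l<..<r} x * v x)"
      using integrable_mult_indicator[OF _ v, of "{l<..<r}"] by simp
    show "(LINT x|lborel. indicator {l<..<r} x * v x) = 0"
      by (rule inside) (use lr in auto)
    fix a b :: real
    have "(LINT x|lborel. indicator {a<..<b} x * (indicator {l<..<r} x * v x))
        = (LINT x|lborel. indicator {max a l<..<min b r} x * v x)"
      by (intro Bochner_Integration.integral_cong) (auto simp: indicator_def)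
    also have "\<dots> = 0"
    proof (cases "max a l < min b r")
      case True
      then show ?thesis by (intro inside) auto
    next
      case False
      then have "{max a l<..<min b r} = {}" by auto
      then show ?thesis by simp
    qed
    finally show "(LINT x|lborel. indicator {a<..<b} x * (indicator {l<..<r} x * v x)) = 0" .
  qed
  then show ?thesis by (rule AE_mp) (auto simp: indicator_def)
qed

text \<open>
The vanishing integral is what makes the antiderivative compactly supported on the right-hand side of the
support as well.
\<close>
lemma test_function_antiderivative:
  assumes \<zeta>: "test_function a b \<zeta>" and ab: "a < b" and zero: "integral {a..b} \<zeta> = 0"
  obtains \<phi> where "test_function a b \<phi>" "deriv \<phi> = \<zeta>"
proof -
  obtain l r where lr: "a < l" "l \<le> r" "r < b" and z: "\<And>x. x \<notin> {l..r} \<Longrightarrow> \<zeta> x = 0"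
    using test_function_support[OF ab \<zeta>] by metis
  have cont: "continuous_on S \<zeta>" for S
    using \<zeta> by (rule test_function_continuous)
  define \<phi> where "\<phi> x = integral {a..x} \<zeta>" for x
  have left: "\<phi> x = 0" if "x < l" for x
  proof -
    have "\<phi> x = integral {a..x} (\<lambda>_. 0)"
      unfolding \<phi>_def by (intro integral_cong z) (use that in auto)
    then show ?thesis by simp
  qed
  have right: "\<phi> x = 0" if "r < x" for x
  proof -
    have *: "\<phi> y = integral {a..r} \<zeta>" if "r < y" for y
    proof -
      have "integral {a..r} \<zeta> + integral {r..y} \<zeta> = integral {a..y} \<zeta>"
        using lr that by (intro Henstock_Kurzweil_Integration.integral_combine integrable_continuous_real cont) auto
      moreover have "integral {r..y} \<zeta> = integral {r..y} (\<lambda>_. 0)"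
        by (rule integral_spike[of "{r}"]) (use z in auto)
      ultimately show ?thesis by (simp add: \<phi>_def)
    qed
    show ?thesis using *[OF that] *[of b] lr zero by (simp add: \<phi>_def)
  qed
  have D: "(\<phi> has_real_derivative \<zeta> x) (at x)" for x
  proof (cases "x < l")
    case True
    have "(\<phi> has_real_derivative 0) (at x)"
      by (rule has_field_derivative_transform_within_open[of "\<lambda>_. 0" _ _ "{..<l}"])
        (use True left in auto)
    then show ?thesis using z True by simp
  next
    case False
    have "(\<phi> has_real_derivative \<zeta> x) (at x within {a..x + 1})"
      unfolding \<phi>_def by (rule integral_has_real_derivative[OF cont]) (use False lr in auto)
    moreover have "at x within {a..x + 1} = at x"
      by (rule at_within_interior) (use False lr in auto)
    ultimately show ?thesis by simp
  qed
  then have d: "deriv \<phi> = \<zeta>" by (intro ext DERIV_imp_deriv)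
  have "(deriv ^^ n) \<phi> field_differentiable (at x)" for n x
  proof (cases n)
    case 0
    then show ?thesis using D by (auto simp: field_differentiable_def)
  next
    case (Suc m)
    then have "(deriv ^^ n) \<phi> = (deriv ^^ m) \<zeta>"
      by (simp add: funpow_Suc_right d del: funpow.simps)
    then show ?thesis using \<zeta> by (simp add: test_function_def)
  qed
  moreover have "\<exists>K. compact K \<and> K \<subseteq> {a<..<b} \<and> (\<forall>x. x \<notin> K \<longrightarrow> \<phi> x = 0)"
    using lr left right by (intro exI[of _ "{l..r}"]) (auto simp: not_le)
  ultimately have "test_function a b \<phi>" unfolding test_function_def by blast
  then show ?thesis using d that by blast
qed

lemma test_function_integral:
  assumes \<phi>: "test_function a b \<phi>" and ab: "a < b"
  shows "integrable lborel \<phi>" and "(LINT x|lborel. \<phi> x) = integral {a..b} \<phi>"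
proof -
  obtain l r where lr: "a < l" "l \<le> r" "r < b" and z: "\<And>x. x \<notin> {l..r} \<Longrightarrow> \<phi> x = 0"
    using test_function_support[OF ab \<phi>] by metis
  have eq: "\<phi> = (\<lambda>x. indicator {a..b} x *\<^sub>R \<phi> x)"
  proof
    fix x
    show "\<phi> x = indicator {a..b} x *\<^sub>R \<phi> x"
      using z[of x] lr by (cases "x \<in> {l..r}") (auto simp: indicator_def)
  qed
  have "integrable lborel (\<lambda>x. indicator {a..b} x *\<^sub>R \<phi> x)"
    by (intro borel_integrable_compact test_function_continuous[OF \<phi>]) auto
  then show "integrable lborel \<phi>" using eq by simp
  have "set_integrable lborel {a..b} \<phi>"
    unfolding set_integrable_def by fact
  from set_borel_integral_eq_integral(2)[OF this]
  show "(LINT x|lborel. \<phi> x) = integral {a..b} \<phi>"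
    unfolding set_lebesgue_integral_def using eq by simp
qed

lemma integrable_mult_test_function:
  fixes v :: "real \<Rightarrow> real"
  assumes v: "integrable lborel v" and cont: "continuous_on UNIV \<phi>" and z: "\<And>x. x \<notin> {l..r} \<Longrightarrow> \<phi> x = 0"
  shows "integrable lborel (\<lambda>x. v x * \<phi> x)"
proof -
  note [measurable] = borel_measurable_integrable[OF v, simplified] borel_measurable_continuous_onI[OF cont]
  have "compact (\<phi> ` {l..r})"
    by (intro compact_continuous_image continuous_on_subset[OF cont]) auto
  then obtain B where B: "\<And>x. x \<in> {l..r} \<Longrightarrow> \<bar>\<phi> x\<bar> \<le> B"
    using compact_imp_bounded bounded_iff by (metis imageI real_norm_def)
  have B': "\<bar>\<phi> x\<bar> \<le> max B 0" for x
    using B[of x] z[of x] by (cases "x \<in> {l..r}") auto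
  show ?thesis
  proof (rule Bochner_Integration.integrable_bound)
    show "integrable lborel (\<lambda>x. v x * max B 0)" using v by simp
    show "AE x in lborel. norm (v x * \<phi> x) \<le> norm (v x * max B 0)"
    proof (rule AE_I2)
      fix x
      have "\<bar>v x\<bar> * \<bar>\<phi> x\<bar> \<le> \<bar>v x\<bar> * max B 0"
        by (intro mult_left_mono B') simp
      then show "norm (v x * \<phi> x) \<le> norm (v x * max B 0)"
        by (simp add: abs_mult)
    qed
  qed measurable
qed

text \<open>
Lemma of du Bois-Reymond. Fix a test function \<open>\<eta>\<close> with nonzero integral. Subtracting from a test
function \<open>\<psi>\<close> the right multiple of \<open>\<eta>\<close> gives a test function of integral zero, which
is the derivative of a test function. So \<open>v\<close> minus the constant
\<open>C = \<integral>v \<eta> / \<integral>\<eta>\<close> is orthogonal to every \<open>\<psi>\<close>.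
\<close>
lemma zero_weak_derivative_imp_AE_constant:
  fixes v :: "real \<Rightarrow> real"
  assumes v: "integrable lborel v" and lr: "l < r"
    and test: "\<And>\<phi>. test_function l r \<phi> \<Longrightarrow> (LINT x|lborel. v x * deriv \<phi> x) = 0"
  shows "\<exists>C. AE x in lborel. x \<in> {l<..<r} \<longrightarrow> v x = C"
proof -
  define d where "d = (r - l) / 3"
  have d: "0 < d" using lr by (simp add: d_def)
  define \<eta> where "\<eta> = flat_bump (l + d) (r - d) 1 1 0"
  have \<eta>: "test_function l r \<eta>"
    unfolding \<eta>_def by (rule flat_bump_test_function) (use lr in \<open>auto simp: d_def field_simps\<close>)
  have \<eta>0: "0 \<le> \<eta> x" for x by (simp add: \<eta>_def flat_bump_def)
  define I where "I = (LINT x|lborel. \<eta> x)"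
  have "I \<noteq> 0"
  proof
    assume "I = 0"
    then have "AE x in lborel. \<eta> x = 0"
      using integral_nonneg_eq_0_iff_AE[OF test_function_integral(1)[OF \<eta> lr]] \<eta>0 by (simp add: I_def)
    then have "AE x in lborel. x \<notin> {l + d<..<r - d}"
      by (rule AE_mp) (auto simp: \<eta>_def flat_bump_def)
    then have "emeasure lborel {l + d<..<r - d} = 0"
      by (subst (asm) AE_iff_null_sets[symmetric]) auto
    then show False using lr by (simp add: d_def field_simps)
  qed
  define C where "C = (LINT x|lborel. v x * \<eta> x) / I"
  have vi: "integrable lborel (\<lambda>x. v x * \<phi> x)" if "test_function l r \<phi>" for \<phi>
    using test_function_support[OF lr that]
    by (metis integrable_mult_test_function[OF v test_function_continuous(1)[OF that]])
  have "AE x in lborel. x \<in> {l<..<r} \<longrightarrow> v x - indicator {l<..<r} x * C = 0"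
  proof (rule test_functions_determine_AE[OF _ lr])
    show "integrable lborel (\<lambda>x. v x - indicator {l<..<r} x * C)"
      using v lr by (intro Bochner_Integration.integrable_diff integrable_mult_left integrable_real_indicator) auto
    fix \<psi> assume \<psi>: "test_function l r \<psi>"
    define s where "s = (LINT x|lborel. \<psi> x) / I"
    define \<zeta> where "\<zeta> x = \<psi> x - s * \<eta> x" for x
    have \<zeta>: "test_function l r \<zeta>"
      unfolding \<zeta>_def using \<psi> \<eta> by (rule test_function_diff_cmult)
    have "(LINT x|lborel. \<zeta> x) = (LINT x|lborel. \<psi> x) - s * I"
      unfolding \<zeta>_def I_def
      using test_function_integral(1)[OF \<psi> lr] test_function_integral(1)[OF \<eta> lr] by simp
    also have "\<dots> = 0" using \<open>I \<noteq> 0\<close> by (simp add: s_def)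
    finally have "integral {l..r} \<zeta> = 0"
      using test_function_integral(2)[OF \<zeta> lr] by simp
    then obtain \<phi> where \<phi>: "test_function l r \<phi>" "deriv \<phi> = \<zeta>"
      using test_function_antiderivative[OF \<zeta> lr] by blast
    have "0 = (LINT x|lborel. v x * \<zeta> x)"
      using test[OF \<phi>(1)] \<phi>(2) by simp
    also have "\<dots> = (LINT x|lborel. v x * \<psi> x - s * (v x * \<eta> x))"
      by (simp add: \<zeta>_def algebra_simps)
    also have "\<dots> = (LINT x|lborel. v x * \<psi> x) - s * (LINT x|lborel. v x * \<eta> x)"
      using vi[OF \<psi>] vi[OF \<eta>] by simp
    also have "s * (LINT x|lborel. v x * \<eta> x) = C * (LINT x|lborel. \<psi> x)"
      by (simp add: s_def C_def)
    finally have 1: "(LINT x|lborel. v x * \<psi> x) = C * (LINT x|lborel. \<psi> x)" by simp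
    obtain l' r' where "l < l'" "r' < r" "\<And>x. x \<notin> {l'..r'} \<Longrightarrow> \<psi> x = 0"
      using test_function_support[OF lr \<psi>] by metis
    then have "(v x - indicator {l<..<r} x * C) * \<psi> x = v x * \<psi> x - C * \<psi> x" for x
      by (cases "x \<in> {l<..<r}") (auto simp: algebra_simps)
    then have "(LINT x|lborel. (v x - indicator {l<..<r} x * C) * \<psi> x)
        = (LINT x|lborel. v x * \<psi> x) - C * (LINT x|lborel. \<psi> x)"
      using vi[OF \<psi>] test_function_integral(1)[OF \<psi> lr] by simp
    then show "(LINT x|lborel. (v x - indicator {l<..<r} x * C) * \<psi> x) = 0"
      using 1 by simp
  qed
  then have "AE x in lborel. x \<in> {l<..<r} \<longrightarrow> v x = C"
    by (rule AE_mp) (auto simp: indicator_def)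
  then show ?thesis by blast
qed

text \<open>
Exhaustion by countably many compactly contained intervals, for use with functions that are only locally
integrable.
\<close>
lemma AE_on_open_subintervals:
  fixes P :: "real \<Rightarrow> bool"
  assumes "\<And>l r. a < l \<Longrightarrow> l < r \<Longrightarrow> r < b \<Longrightarrow> AE x in lborel. x \<in> {l<..<r} \<longrightarrow> P x"
  shows "AE x in lborel. x \<in> {a<..<b} \<longrightarrow> P x"
proof -
  define e where "e n = 1 / real (Suc n)" for n
  have "AE x in lborel. x \<in> {a + e n<..<b - e n} \<longrightarrow> P x" for n
  proof (cases "a + e n < b - e n")
    case True
    then show ?thesis by (intro assms) (auto simp: e_def)
  qed auto
  then have "AE x in lborel. \<forall>n. x \<in> {a + e n<..<b - e n} \<longrightarrow> P x"
    unfolding AE_all_countable by blast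
  then show ?thesis
  proof eventually_elim
    case (elim x)
    show ?case
    proof
      assume x: "x \<in> {a<..<b}"
      then obtain n where "e n < min (x - a) (b - x)"
        using reals_Archimedean[of "min (x - a) (b - x)"] by (auto simp: e_def inverse_eq_divide)
      then have "x \<in> {a + e n<..<b - e n}" by auto
      then show "P x" using elim by blast
    qed
  qed
qed

text \<open>
The chosen \<open>weak_deriv\<close> is an arbitrary function satisfying the defining identity, so its norm
can be computed only through this uniqueness.
\<close>
lemma weak_derivative_unique:
  assumes 1: "has_weak_deriv a b g h1" and 2: "has_weak_deriv a b g h2"
  shows "AE x in lborel. x \<in> {a<..<b} \<longrightarrow> h1 x = h2 x"
proof (rule AE_on_open_subintervals)
  fix l r assume lr: "a < l" "l < r" "r < b"
  have rep: "\<exists>k. integrable lborel k \<and> (\<forall>x. x \<notin> {l..r} \<longrightarrow> k x = 0) \<and> (AE x in lborel. x \<in> {l..r} \<longrightarrow> h x = k x)"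
    if "has_weak_deriv a b g h" for h
  proof -
    have "compact {l..r} \<and> {l..r} \<subseteq> {a<..<b}" using lr by auto
    then have h: "integrable (lebesgue_on {l..r}) h"
      using that unfolding has_weak_deriv_def locally_integrable_def by blast
    obtain k where k: "k \<in> borel_measurable borel" "\<And>x. x \<notin> {l..r} \<Longrightarrow> k x = 0"
        "AE x in lborel. x \<in> {l..r} \<longrightarrow> h x = k x"
      by (rule borel_representative[OF borel_measurable_integrable[OF h]]) (simp, blast)
    then show ?thesis
      using integral_lebesgue_on_of_borel(1)[OF k(1) _ k(3,2)] h by auto
  qed
  obtain k1 where k1: "integrable lborel k1" "\<And>x. x \<notin> {l..r} \<Longrightarrow> k1 x = 0" "AE x in lborel. x \<in> {l..r} \<longrightarrow> h1 x = k1 x"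
    using rep[OF 1] by blast
  obtain k2 where k2: "integrable lborel k2" "\<And>x. x \<notin> {l..r} \<Longrightarrow> k2 x = 0" "AE x in lborel. x \<in> {l..r} \<longrightarrow> h2 x = k2 x"
    using rep[OF 2] by blast
  note [measurable] = borel_measurable_integrable[OF k1(1), simplified] borel_measurable_integrable[OF k2(1), simplified]
  have "AE x in lborel. x \<in> {l<..<r} \<longrightarrow> k1 x - k2 x = 0"
  proof (rule test_functions_determine_AE[OF _ lr(2)])
    show "integrable lborel (\<lambda>x. k1 x - k2 x)" using k1 k2 by simp
    fix \<phi> assume \<phi>: "test_function l r \<phi>"
    then have \<phi>': "test_function a b \<phi>"
      by (rule test_function_subinterval) (use lr in auto)
    note [measurable] = test_function_measurable(1)[OF \<phi>]
    obtain l' r' where l'r': "l < l'" "r' < r" "\<And>x. x \<notin> {l'..r'} \<Longrightarrow> \<phi> x = 0"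
      using test_function_support[OF lr(2) \<phi>] by metis
    have val: "(LINT x|lebesgue_on {a<..<b}. h x * \<phi> x) = (LINT x|lborel. k x * \<phi> x)"
      if [measurable]: "k \<in> borel_measurable borel" and k: "\<And>x. x \<notin> {l..r} \<Longrightarrow> k x = 0"
        "AE x in lborel. x \<in> {l..r} \<longrightarrow> h x = k x" for h k
    proof (rule integral_lebesgue_on_of_borel(2))
      show "AE x in lborel. x \<in> {a<..<b} \<longrightarrow> h x * \<phi> x = k x * \<phi> x"
        using k(2)
      proof eventually_elim
        case (elim x)
        then show ?case using l'r'(1,2) l'r'(3)[of x] by (cases "x \<in> {l'..r'}") auto
      qed
      show "k x * \<phi> x = 0" if "x \<notin> {a<..<b}" for x
        using k(1)[of x] that lr by auto
    qed measurable
    have "(LINT x|lborel. k1 x * \<phi> x) = (LINT x|lborel. k2 x * \<phi> x)"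
      using 1 2 \<phi>' val[OF _ k1(2,3)] val[OF _ k2(2,3)] unfolding has_weak_deriv_def by simp
    moreover have "integrable lborel (\<lambda>x. k x * \<phi> x)" if "integrable lborel k" for k
      by (rule integrable_mult_test_function[OF that test_function_continuous(1)[OF \<phi>] l'r'(3)])
    from this[OF k1(1)] this[OF k2(1)] have "integrable lborel (\<lambda>x. k1 x * \<phi> x)" "integrable lborel (\<lambda>x. k2 x * \<phi> x)" .
    ultimately show "(LINT x|lborel. (k1 x - k2 x) * \<phi> x) = 0"
      by (simp add: left_diff_distrib)
  qed
  with k1(3) k2(3) show "AE x in lborel. x \<in> {l<..<r} \<longrightarrow> h1 x = h2 x"
    by eventually_elim auto
qed

section \<open>Primitives\<close>

definition primitive :: "(real \<Rightarrow> real) \<Rightarrow> real \<Rightarrow> real" where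
  "primitive h x = (LINT t|lborel. (if t \<le> x then h t else 0))"

lemma primitive_measurable [measurable]:
  assumes [measurable]: "h \<in> borel_measurable borel"
  shows "primitive h \<in> borel_measurable borel"
  unfolding primitive_def by measurable

lemma primitive_integrable:
  fixes h :: "real \<Rightarrow> real"
  assumes h: "integrable lborel h"
  shows "integrable lborel (\<lambda>t. if t \<le> x then h t else 0)"
proof -
  note [measurable] = borel_measurable_integrable[OF h, simplified]
  show ?thesis by (rule Bochner_Integration.integrable_bound[OF h]) auto
qed

lemma primitive_bounded:
  assumes h: "integrable lborel h"
  shows "\<bar>primitive h x\<bar> \<le> (LINT t|lborel. \<bar>h t\<bar>)"
proof -
  have "\<bar>primitive h x\<bar> \<le> (LINT t|lborel. \<bar>if t \<le> x then h t else 0\<bar>)"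
    unfolding primitive_def using integral_norm_bound[of lborel "\<lambda>t. if t \<le> x then h t else 0"] by simp
  also have "\<dots> \<le> (LINT t|lborel. \<bar>h t\<bar>)"
    by (intro integral_mono integrable_abs primitive_integrable h) auto
  finally show ?thesis .
qed

lemma integrable_indicator_primitive:
  assumes h: "integrable lborel h" and "a < b"
  shows "integrable lborel (\<lambda>x. indicator {a<..<b} x * primitive h x)"
proof -
  note [measurable] = borel_measurable_integrable[OF h, simplified]
  show ?thesis
  proof (rule Bochner_Integration.integrable_bound)
    show "integrable lborel (\<lambda>x. indicator {a<..<b} x * (LINT t|lborel. \<bar>h t\<bar>))"
      using assms(2) by (intro integrable_mult_left integrable_real_indicator) auto
    show "AE x in lborel. norm (indicator {a<..<b} x * primitive h x)
        \<le> norm (indicator {a<..<b} x * (LINT t|lborel. \<bar>h t\<bar>))"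
      using primitive_bounded[OF h] by (intro AE_I2) (auto simp: indicator_def intro: order_trans[OF _ abs_ge_self])
  qed measurable
qed

text \<open>
Integration by parts, as Fubini's theorem for \<open>h t * deriv \<phi> x\<close> over \<open>t \<le> x\<close>:
the inner integral over \<open>x \<ge> t\<close> is \<open>- \<phi> t\<close>.
\<close>
lemma integral_primitive_deriv:
  assumes h: "integrable lborel h" and \<phi>: "test_function a b \<phi>" and ab: "a < b"
  shows "(LINT x|lborel. primitive h x * deriv \<phi> x) = - (LINT t|lborel. h t * \<phi> t)"
proof -
  note [measurable] = borel_measurable_integrable[OF h, simplified] test_function_measurable[OF \<phi>]
  obtain l r where lr: "a < l" "l \<le> r" "r < b" and z: "\<And>x. x \<notin> {l..r} \<Longrightarrow> \<phi> x = 0"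
      "\<And>x. x \<notin> {l..r} \<Longrightarrow> deriv \<phi> x = 0"
    using test_function_support[OF ab \<phi>] by metis
  have d\<phi>: "integrable lborel (\<lambda>x. deriv \<phi> x)"
  proof -
    have "integrable lborel (\<lambda>x. indicator {l..r} x *\<^sub>R deriv \<phi> x)"
      by (intro borel_integrable_compact test_function_continuous[OF \<phi>]) auto
    also have "(\<lambda>x. indicator {l..r} x *\<^sub>R deriv \<phi> x) = deriv \<phi>"
      using z(2) by (auto simp: indicator_def fun_eq_iff)
    finally show ?thesis .
  qed
  define F where "F t x = (if t \<le> x then h t * deriv \<phi> x else 0)" for t x
  have Ft: "integrable lborel (F t)" for t
    unfolding F_def by (rule Bochner_Integration.integrable_bound[OF integrable_mult_right[OF d\<phi>, of "h t"]]) auto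
  have int: "integrable (lborel \<Otimes>\<^sub>M lborel) (case_prod F)"
  proof (rule lborel_pair.Fubini_integrable)
    show [measurable]: "case_prod F \<in> borel_measurable (lborel \<Otimes>\<^sub>M lborel)"
      unfolding F_def by measurable
    show "AE t in lborel. integrable lborel (\<lambda>x. case_prod F (t, x))"
      using Ft by simp
    show "integrable lborel (\<lambda>t. LINT x|lborel. norm (case_prod F (t, x)))"
    proof (rule Bochner_Integration.integrable_bound)
      show "integrable lborel (\<lambda>t. h t * (LINT x|lborel. \<bar>deriv \<phi> x\<bar>))"
        using h by simp
      show "AE t in lborel. norm (LINT x|lborel. norm (case_prod F (t, x)))
          \<le> norm (h t * (LINT x|lborel. \<bar>deriv \<phi> x\<bar>))"
      proof (rule AE_I2)
        fix t
        have "(LINT x|lborel. \<bar>F t x\<bar>) \<le> (LINT x|lborel. \<bar>h t\<bar> * \<bar>deriv \<phi> x\<bar>)"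
          by (intro integral_mono integrable_abs Ft integrable_mult_right d\<phi>) (auto simp: F_def abs_mult)
        then show "norm (LINT x|lborel. norm (case_prod F (t, x)))
          \<le> norm (h t * (LINT x|lborel. \<bar>deriv \<phi> x\<bar>))"
          by (simp add: abs_mult)
      qed
    qed measurable
  qed
  have "(LINT x|lborel. primitive h x * deriv \<phi> x) = (LINT x|lborel. LINT t|lborel. F t x)"
  proof (rule Bochner_Integration.integral_cong[OF refl])
    fix x
    have "primitive h x * deriv \<phi> x = (LINT t|lborel. (if t \<le> x then h t else 0) * deriv \<phi> x)"
      unfolding primitive_def by simp
    also have "\<dots> = (LINT t|lborel. F t x)"
      by (intro Bochner_Integration.integral_cong) (auto simp: F_def)
    finally show "primitive h x * deriv \<phi> x = (LINT t|lborel. F t x)" .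
  qed
  also have "\<dots> = (LINT t|lborel. LINT x|lborel. F t x)"
    by (rule lborel_pair.Fubini_integral[OF int])
  also have "\<dots> = (LINT t|lborel. - (h t * \<phi> t))"
  proof (rule Bochner_Integration.integral_cong[OF refl])
    fix t
    \<comment> \<open>An upper limit beyond both \<open>t\<close> and the support, so that the boundary term there vanishes.\<close>
    define m where "m = max t b"
    have "(LINT x|lborel. F t x) = (LINT x|lborel. h t * (indicator {t..m} x *\<^sub>R deriv \<phi> x))"
    proof (rule Bochner_Integration.integral_cong[OF refl])
      fix x
      show "F t x = h t * (indicator {t..m} x *\<^sub>R deriv \<phi> x)"
        using z(2)[of x] lr by (cases "x \<in> {l..r}") (auto simp: F_def m_def indicator_def)
    qed
    also have "\<dots> = h t * (\<phi> m - \<phi> t)"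
    proof -
      have "(LINT x|lborel. indicator {t..m} x *\<^sub>R deriv \<phi> x) = \<phi> m - \<phi> t"
      proof (rule integral_FTC_Icc)
        show "(\<phi> has_vector_derivative deriv \<phi> x) (at x within {t..m})" for x
          using has_field_derivative_at_within[OF test_function_has_derivatives(1)[OF \<phi>]]
          by (simp add: has_real_derivative_iff_has_vector_derivative)
      qed (auto simp: m_def intro: test_function_continuous[OF \<phi>])
      then show ?thesis by simp
    qed
    also have "\<phi> m = 0" using lr by (intro z(1)) (auto simp: m_def)
    finally show "(LINT x|lborel. F t x) = - (h t * \<phi> t)" by simp
  qed
  finally show ?thesis by simp
qed

lemma conv_integrable:
  assumes n: "integrable lborel n" and h: "integrable lborel h"
  shows "integrable lborel (conv n h)"
  using lborel_pair.integrable_snd[OF integrable_convolution_product[OF n h]]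
  unfolding conv_def[abs_def] .

text \<open>
Both sides are the double integral of \<open>n s * h (r - s)\<close> over all \<open>s\<close> and all
\<open>r \<le> x\<close>. This is the reason why \<open>J \<nu>\<close> commutes with differentiation on functions
vanishing at \<open>0\<close>.
\<close>
lemma conv_primitive:
  assumes n: "integrable lborel n" and h: "integrable lborel h"
  shows "conv n (primitive h) = primitive (conv n h)"
proof
  fix x
  note [measurable] = borel_measurable_integrable[OF n, simplified] borel_measurable_integrable[OF h, simplified]
  have int: "integrable (lborel \<Otimes>\<^sub>M lborel) (\<lambda>(s, r). if r \<le> x then n s * h (r - s) else 0)"
    by (rule Bochner_Integration.integrable_bound[OF integrable_convolution_product[OF n h]]) auto
  have "primitive (conv n h) x = (LINT r|lborel. LINT s|lborel. (if r \<le> x then n s * h (r - s) else 0))"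
    unfolding primitive_def conv_def by (intro Bochner_Integration.integral_cong) auto
  also have "\<dots> = (LINT s|lborel. LINT r|lborel. (if r \<le> x then n s * h (r - s) else 0))"
    by (rule lborel_pair.Fubini_integral[OF int])
  also have "\<dots> = (LINT s|lborel. n s * primitive h (x - s))"
  proof (rule Bochner_Integration.integral_cong[OF refl])
    fix s
    have "(LINT r|lborel. (if r \<le> x then n s * h (r - s) else 0))
        = (LINT r|lborel. n s * (if r \<le> x then h (r - s) else 0))"
      by (intro Bochner_Integration.integral_cong) auto
    also have "\<dots> = n s * (LINT r|lborel. (if r \<le> x then h (r - s) else 0))" by simp
    also have "(LINT r|lborel. (if r \<le> x then h (r - s) else 0)) = (LINT t|lborel. (if t \<le> x - s then h t else 0))"
      by (subst lborel_integral_real_affine[where c=1 and t=s]) (auto intro!: Bochner_Integration.integral_cong)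
    finally show "(LINT r|lborel. (if r \<le> x then n s * h (r - s) else 0)) = n s * primitive h (x - s)"
      by (simp add: primitive_def)
  qed
  finally show "conv n (primitive h) x = primitive (conv n h) x"
    by (simp add: conv_def)
qed

section \<open>The Volterra operator on the Sobolev scale\<close>

lemma L2_space_iff_representative:
  assumes f: "f \<in> borel_measurable borel" "\<And>x. x \<notin> {a<..<b} \<Longrightarrow> f x = 0"
    and ae: "AE x in lborel. x \<in> {a<..<b} \<longrightarrow> g x = f x"
  shows "g \<in> L2_space a b \<longleftrightarrow> (\<integral>\<^sup>+x. ennreal ((f x)\<^sup>2) \<partial>lborel) < \<infinity>"
    and "g \<in> L2_space a b \<Longrightarrow> ennreal (L2_norm_sq a b g) = (\<integral>\<^sup>+x. ennreal ((f x)\<^sup>2) \<partial>lborel)"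
proof -
  note [measurable] = f(1)
  have ae2: "AE x in lborel. x \<in> {a<..<b} \<longrightarrow> (g x)\<^sup>2 = (f x)\<^sup>2"
    using ae by eventually_elim auto
  have sq: "integrable (lebesgue_on {a<..<b}) (\<lambda>x. (g x)\<^sup>2) \<longleftrightarrow> integrable lborel (\<lambda>x. (f x)\<^sup>2)"
    "(LINT x|lebesgue_on {a<..<b}. (g x)\<^sup>2) = (LINT x|lborel. (f x)\<^sup>2)"
    by (rule integral_lebesgue_on_of_borel[OF _ _ ae2]; use f(2) in simp)+
  have "g \<in> borel_measurable (lebesgue_on {a<..<b})"
    using f(1) ae by (intro measurable_lebesgue_on_of_borel) auto
  then have "g \<in> L2_space a b \<longleftrightarrow> integrable lborel (\<lambda>x. (f x)\<^sup>2)"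
    by (simp add: L2_space_def sq(1))
  then show "g \<in> L2_space a b \<longleftrightarrow> (\<integral>\<^sup>+x. ennreal ((f x)\<^sup>2) \<partial>lborel) < \<infinity>"
    by (simp add: integrable_iff_bounded)
  assume "g \<in> L2_space a b"
  then have "integrable lborel (\<lambda>x. (f x)\<^sup>2)"
    using \<open>g \<in> L2_space a b \<longleftrightarrow> integrable lborel (\<lambda>x. (f x)\<^sup>2)\<close> by simp
  then show "ennreal (L2_norm_sq a b g) = (\<integral>\<^sup>+x. ennreal ((f x)\<^sup>2) \<partial>lborel)"
    unfolding L2_norm_sq_def sq(2) by (subst nn_integral_eq_integral) auto
qed

lemma L2_norm_sq_nonneg: "0 \<le> L2_norm_sq a b g"
  unfolding L2_norm_sq_def by (rule Bochner_Integration.integral_nonneg) simp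

lemma L2_representative:
  assumes g: "g \<in> L2_space a b"
  obtains f where "f \<in> borel_measurable borel" "\<And>x. x \<notin> {a<..<b} \<Longrightarrow> f x = 0"
    "AE x in lborel. x \<in> {a<..<b} \<longrightarrow> g x = f x"
proof (rule borel_representative)
  show "g \<in> borel_measurable (lebesgue_on {a<..<b})" using g by (simp add: L2_space_def)
qed (auto intro: that)

lemma square_integrable_imp_integrable:
  fixes f :: "real \<Rightarrow> real"
  assumes [measurable]: "f \<in> borel_measurable borel" and f0: "\<And>x. x \<notin> {a<..<b} \<Longrightarrow> f x = 0" and "a \<le> b"
    and fin: "(\<integral>\<^sup>+x. ennreal ((f x)\<^sup>2) \<partial>lborel) < \<infinity>"
  shows "integrable lborel f"
proof (rule Bochner_Integration.integrable_bound)
  have "integrable lborel (\<lambda>x. (f x)\<^sup>2)"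
    using fin by (simp add: integrable_iff_bounded)
  then show "integrable lborel (\<lambda>x. indicator {a<..<b} x + (f x)\<^sup>2)"
    using \<open>a \<le> b\<close> by (intro Bochner_Integration.integrable_add integrable_real_indicator) auto
  show "AE x in lborel. norm (f x) \<le> norm (indicator {a<..<b} x + (f x)\<^sup>2)"
  proof (rule AE_I2)
    fix x
    have "2 * \<bar>f x\<bar> \<le> 1 + (f x)\<^sup>2"
      using zero_le_power2[of "\<bar>f x\<bar> - 1"] by (simp add: power2_eq_square algebra_simps)
    then show "norm (f x) \<le> norm (indicator {a<..<b} x + (f x)\<^sup>2)"
      using f0[of x] by (cases "x \<in> {a<..<b}") auto
  qed
qed measurable

text \<open>
The representative is made nonnegative everywhere, so that the estimates above apply, and \<open>N \<nu> T\<close>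
becomes its total mass.
\<close>
lemma kernel_representative:
  assumes \<nu>: "positive_kernel T \<nu>"
  obtains n where "n \<in> borel_measurable borel" "\<And>x. x \<notin> {0<..<T} \<Longrightarrow> n x = 0"
    "AE x in lborel. x \<in> {0<..<T} \<longrightarrow> \<nu> x = n x" "\<And>x. 0 \<le> n x" "integrable lborel n"
    "ennreal (N \<nu> T) = (\<integral>\<^sup>+s. ennreal (n s) \<partial>lborel)" "0 \<le> N \<nu> T"
proof -
  have int: "integrable (lebesgue_on {0<..<T}) \<nu>" and pos: "AE x in lborel. x \<in> {0<..<T} \<longrightarrow> 0 < \<nu> x"
    using \<nu> by (simp_all add: positive_kernel_def AE_lebesgue_on_iff)
  obtain m where m: "m \<in> borel_measurable borel" "\<And>x. x \<notin> {0<..<T} \<Longrightarrow> m x = 0"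
    "AE x in lborel. x \<in> {0<..<T} \<longrightarrow> \<nu> x = m x"
    by (rule borel_representative[OF borel_measurable_integrable[OF int]]) (simp, blast)
  define n where "n x = max 0 (m x)" for x
  note [measurable] = m(1)
  have n: "n \<in> borel_measurable borel" "\<And>x. x \<notin> {0<..<T} \<Longrightarrow> n x = 0" "\<And>x. 0 \<le> n x"
    unfolding n_def by (measurable, simp_all add: m(2))
  have ae: "AE x in lborel. x \<in> {0<..<T} \<longrightarrow> \<nu> x = n x"
    using pos m(3) by eventually_elim (auto simp: n_def)
  have i: "integrable lborel n"
    using integral_lebesgue_on_of_borel(1)[OF n(1) _ ae n(2)] int by simp
  have "AE s in lborel. s \<noteq> 0" "AE s in lborel. s \<noteq> T"
    by (auto intro: AE_lborel_singleton)
  with ae have ae': "AE x in lborel. x \<in> {0..T} \<longrightarrow> \<nu> x = n x"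
    by eventually_elim auto
  have "N \<nu> T = (LINT s|lborel. n s)"
    unfolding N_def by (rule integral_lebesgue_on_of_borel(2)[OF n(1) _ ae']) (use n(2) in auto)
  then show ?thesis
    using that[OF n(1,2) ae n(3) i] i n(3) by (simp add: nn_integral_eq_integral)
qed

lemma J_representative:
  assumes n: "n \<in> borel_measurable borel" "\<And>x. x \<notin> {0<..<T} \<Longrightarrow> n x = 0"
    "AE x in lborel. x \<in> {0<..<T} \<longrightarrow> \<nu> x = n x"
    and f: "f \<in> borel_measurable borel" "\<And>x. x \<notin> {0<..<T} \<Longrightarrow> f x = 0"
    "AE x in lborel. x \<in> {0<..<T} \<longrightarrow> g x = f x"
  shows "AE x in lborel. x \<in> {0<..<T} \<longrightarrow> J \<nu> g x = indicator {0<..<T} x * conv n f x"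
proof (rule AE_I2, rule impI)
  fix x assume "x \<in> {0<..<T}"
  then show "J \<nu> g x = indicator {0<..<T} x * conv n f x"
    using J_eq_conv[OF n f, of x] by simp
qed

lemma J_L2:
  assumes \<nu>: "positive_kernel T \<nu>" and g: "g \<in> L2_space 0 T"
  shows "J \<nu> g \<in> L2_space 0 T" and "L2_norm_sq 0 T (J \<nu> g) \<le> (N \<nu> T)\<^sup>2 * L2_norm_sq 0 T g"
proof -
  obtain n where n: "n \<in> borel_measurable borel" "\<And>x. x \<notin> {0<..<T} \<Longrightarrow> n x = 0"
    "AE x in lborel. x \<in> {0<..<T} \<longrightarrow> \<nu> x = n x" "\<And>x. 0 \<le> n x" "integrable lborel n"
    "ennreal (N \<nu> T) = (\<integral>\<^sup>+s. ennreal (n s) \<partial>lborel)" "0 \<le> N \<nu> T"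
    using kernel_representative[OF \<nu>] by blast
  obtain f where f: "f \<in> borel_measurable borel" "\<And>x. x \<notin> {0<..<T} \<Longrightarrow> f x = 0"
    "AE x in lborel. x \<in> {0<..<T} \<longrightarrow> g x = f x"
    using L2_representative[OF g] by blast
  note [measurable] = n(1) f(1)
  have F: "(\<lambda>x. indicator {0<..<T} x * conv n f x) \<in> borel_measurable borel"
    "\<And>x. x \<notin> {0<..<T} \<Longrightarrow> indicator {0<..<T} x * conv n f x = 0"
    by auto
  have "(\<integral>\<^sup>+x. ennreal ((indicator {0<..<T} x * conv n f x)\<^sup>2) \<partial>lborel)
      \<le> (\<integral>\<^sup>+x. ennreal ((conv n f x)\<^sup>2) \<partial>lborel)"
    by (intro nn_integral_mono) (auto simp: indicator_def)
  also have "\<dots> \<le> (\<integral>\<^sup>+s. ennreal (n s) \<partial>lborel)\<^sup>2 * (\<integral>\<^sup>+x. ennreal ((f x)\<^sup>2) \<partial>lborel)"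
    by (rule conv_L2) (use n(4) in auto)
  also have "(\<integral>\<^sup>+x. ennreal ((f x)\<^sup>2) \<partial>lborel) = ennreal (L2_norm_sq 0 T g)"
    using L2_space_iff_representative(2)[OF f g] by simp
  also have "(\<integral>\<^sup>+s. ennreal (n s) \<partial>lborel)\<^sup>2 * ennreal (L2_norm_sq 0 T g) = ennreal ((N \<nu> T)\<^sup>2 * L2_norm_sq 0 T g)"
    unfolding n(6)[symmetric] using n(7) by (simp add: ennreal_mult ennreal_power L2_norm_sq_nonneg)
  finally have le: "(\<integral>\<^sup>+x. ennreal ((indicator {0<..<T} x * conv n f x)\<^sup>2) \<partial>lborel)
      \<le> ennreal ((N \<nu> T)\<^sup>2 * L2_norm_sq 0 T g)" .
  have rep: "AE x in lborel. x \<in> {0<..<T} \<longrightarrow> J \<nu> g x = indicator {0<..<T} x * conv n f x"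
    by (rule J_representative[OF n(1-3) f])
  have "J \<nu> g \<in> L2_space 0 T \<longleftrightarrow> (\<integral>\<^sup>+x. ennreal ((indicator {0<..<T} x * conv n f x)\<^sup>2) \<partial>lborel) < \<infinity>"
    by (rule L2_space_iff_representative(1)[OF F rep])
  also have "\<dots>" using le by (rule le_less_trans) simp
  finally show *: "J \<nu> g \<in> L2_space 0 T" by simp
  have "ennreal (L2_norm_sq 0 T (J \<nu> g)) = (\<integral>\<^sup>+x. ennreal ((indicator {0<..<T} x * conv n f x)\<^sup>2) \<partial>lborel)"
    by (rule L2_space_iff_representative(2)[OF F rep *])
  also note le
  finally have "ennreal (L2_norm_sq 0 T (J \<nu> g)) \<le> ennreal ((N \<nu> T)\<^sup>2 * L2_norm_sq 0 T g)" .
  then show "L2_norm_sq 0 T (J \<nu> g) \<le> (N \<nu> T)\<^sup>2 * L2_norm_sq 0 T g"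
    by (subst (asm) ennreal_le_iff) (auto simp: L2_norm_sq_nonneg)
qed

text \<open>
The common part of both fractional cases: a Hardy inequality for the given function is turned into the
bound for \<open>J \<nu>\<close>, through the zero extension and the convolution estimate on \<open>[-T,T]\<close>.
\<close>
lemma J_fractional:
  assumes T: "0 < T" and th: "0 < \<theta>" "\<theta> < 1" and C: "0 \<le> C"
    and \<nu>: "positive_kernel T \<nu>" and g: "g \<in> H_space \<theta> 0 T"
    and f: "f \<in> borel_measurable borel" "\<And>x. x \<notin> {0<..<T} \<Longrightarrow> f x = 0"
    "AE x in lborel. x \<in> {0<..<T} \<longrightarrow> g x = f x"
    and hardy: "(\<integral>\<^sup>+x. ennreal ((f x)\<^sup>2 * x powr (-2 * \<theta>)) \<partial>lborel)
      \<le> ennreal C * (gagliardo_sq \<theta> 0 T f + (\<integral>\<^sup>+x. ennreal ((f x)\<^sup>2) \<partial>lborel))"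
  shows "J \<nu> g \<in> H_space \<theta> 0 T \<and>
    H_norm \<theta> 0 T (J \<nu> g) \<le> sqrt (1 + C / \<theta>) * N \<nu> T * H_norm \<theta> 0 T g"
proof -
  have gL2: "g \<in> L2_space 0 T" and gG: "gagliardo_sq \<theta> 0 T g < \<infinity>"
    using g th by (simp_all add: H_space_def)
  obtain n where n: "n \<in> borel_measurable borel" "\<And>x. x \<notin> {0<..<T} \<Longrightarrow> n x = 0"
    "AE x in lborel. x \<in> {0<..<T} \<longrightarrow> \<nu> x = n x" "\<And>x. 0 \<le> n x" "integrable lborel n"
    "ennreal (N \<nu> T) = (\<integral>\<^sup>+s. ennreal (n s) \<partial>lborel)" "0 \<le> N \<nu> T"
    using kernel_representative[OF \<nu>] by blast
  have fi: "integrable lborel f"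
    using square_integrable_imp_integrable[OF f(1,2)] T gL2 L2_space_iff_representative(1)[OF f] by simp
  define S where "S = L2_norm_sq 0 T g"
  have S: "0 \<le> S" "ennreal S = (\<integral>\<^sup>+x. ennreal ((f x)\<^sup>2) \<partial>lborel)"
    using L2_space_iff_representative(2)[OF f gL2] by (simp_all add: S_def L2_norm_sq_nonneg)
  define G where "G = enn2real (gagliardo_sq \<theta> 0 T g)"
  have G: "0 \<le> G" "ennreal G = gagliardo_sq \<theta> 0 T f"
    using gG gagliardo_sq_cong_AE[OF f(3)] by (simp_all add: G_def)
  have "gagliardo_sq \<theta> 0 T (J \<nu> g) = gagliardo_sq \<theta> 0 T (conv n f)"
    by (rule gagliardo_sq_cong_AE, rule AE_I2) (use J_eq_conv[OF n(1-3) f] in auto)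
  also have "\<dots> \<le> (ennreal (N \<nu> T))\<^sup>2 * gagliardo_sq \<theta> (-T) T f"
    unfolding n(6) by (rule conv_gagliardo[OF n(5,4,2) fi])
  also have "\<dots> \<le> (ennreal (N \<nu> T))\<^sup>2 * (gagliardo_sq \<theta> 0 T f
      + ennreal (1 / \<theta>) * (\<integral>\<^sup>+x. ennreal ((f x)\<^sup>2 * x powr (-2 * \<theta>)) \<partial>lborel))"
    by (intro mult_left_mono gagliardo_zero_extension f th T) auto
  also have "\<dots> \<le> (ennreal (N \<nu> T))\<^sup>2 * (ennreal G + ennreal (1 / \<theta>) * (ennreal C * (ennreal G + ennreal S)))"
    unfolding G S by (intro mult_left_mono add_left_mono hardy) auto
  also have "ennreal (1 / \<theta>) * (ennreal C * (ennreal G + ennreal S)) = ennreal (1 / \<theta> * (C * (G + S)))"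
    using G(1) S(1) C th by (simp flip: ennreal_plus ennreal_mult)
  also have "(ennreal (N \<nu> T))\<^sup>2 * (ennreal G + ennreal (1 / \<theta> * (C * (G + S))))
      = ennreal ((N \<nu> T)\<^sup>2 * (G + 1 / \<theta> * (C * (G + S))))"
    using n(7) G(1) S(1) C th by (simp add: ennreal_power flip: ennreal_plus ennreal_mult)
  finally have gJ: "gagliardo_sq \<theta> 0 T (J \<nu> g) \<le> ennreal ((N \<nu> T)\<^sup>2 * (G + 1 / \<theta> * (C * (G + S))))" .
  have JH: "J \<nu> g \<in> H_space \<theta> 0 T"
    using J_L2(1)[OF \<nu> gL2] gJ th by (auto simp: H_space_def intro: le_less_trans)
  have "0 \<le> (N \<nu> T)\<^sup>2 * (G + 1 / \<theta> * (C * (G + S)))"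
    using G(1) S(1) C th by auto
  then have gJ': "enn2real (gagliardo_sq \<theta> 0 T (J \<nu> g)) \<le> (N \<nu> T)\<^sup>2 * (G + 1 / \<theta> * (C * (G + S)))"
    using gJ by (metis enn2real_leI)
  have "L2_norm_sq 0 T (J \<nu> g) + enn2real (gagliardo_sq \<theta> 0 T (J \<nu> g))
      \<le> (N \<nu> T)\<^sup>2 * S + (N \<nu> T)\<^sup>2 * (G + 1 / \<theta> * (C * (G + S)))"
    unfolding S_def by (intro add_mono J_L2[OF \<nu> gL2] gJ'[unfolded S_def])
  also have "\<dots> = (1 + C / \<theta>) * (N \<nu> T)\<^sup>2 * (S + G)"
    using th by (simp add: field_simps)
  finally have "sqrt (L2_norm_sq 0 T (J \<nu> g) + enn2real (gagliardo_sq \<theta> 0 T (J \<nu> g)))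
      \<le> sqrt ((1 + C / \<theta>) * (N \<nu> T)\<^sup>2 * (S + G))" by (rule real_sqrt_le_mono)
  also have "\<dots> = sqrt (1 + C / \<theta>) * N \<nu> T * sqrt (S + G)"
    using n(7) by (simp add: real_sqrt_mult)
  finally show ?thesis
    using JH th by (simp add: H_norm_def S_def G_def)
qed

lemma locally_integrable_of_representative:
  assumes f: "integrable lborel f" and ae: "AE x in lborel. x \<in> {a<..<b} \<longrightarrow> g x = f x"
  shows "locally_integrable a b g"
  unfolding locally_integrable_def
proof (intro allI impI, elim conjE)
  fix K :: "real set" assume K: "compact K" "K \<subseteq> {a<..<b}"
  note [measurable] = borel_measurable_integrable[OF f, simplified]
  have Kb [measurable]: "K \<in> sets borel" using K(1) by (simp add: borel_compact)
  have "integrable (lebesgue_on K) g \<longleftrightarrow> integrable lborel (\<lambda>x. indicator K x * f x)"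
  proof (rule integral_lebesgue_on_of_borel(1))
    show "AE x in lborel. x \<in> K \<longrightarrow> g x = indicator K x * f x"
      using ae by eventually_elim (use K(2) in auto)
  qed auto
  also have "integrable lborel (\<lambda>x. indicator K x * f x)"
    using integrable_mult_indicator[OF _ f, of K] Kb by simp
  finally show "integrable (lebesgue_on K) g" by simp
qed

lemma has_weak_deriv_iff_representatives:
  assumes f: "integrable lborel f" "\<And>x. x \<notin> {a<..<b} \<Longrightarrow> f x = 0" "AE x in lborel. x \<in> {a<..<b} \<longrightarrow> g x = f x"
    and k: "integrable lborel k" "\<And>x. x \<notin> {a<..<b} \<Longrightarrow> k x = 0" "AE x in lborel. x \<in> {a<..<b} \<longrightarrow> h x = k x"
  shows "has_weak_deriv a b g h \<longleftrightarrow> (\<forall>\<phi>. test_function a b \<phi> \<longrightarrow>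
    (LINT x|lborel. f x * deriv \<phi> x) = - (LINT x|lborel. k x * \<phi> x))"
proof -
  have "(LINT x|lebesgue_on {a<..<b}. g x * \<psi> x) = (LINT x|lborel. f x * \<psi> x)"
    if f: "integrable lborel f" "\<And>x. x \<notin> {a<..<b} \<Longrightarrow> f x = 0" "AE x in lborel. x \<in> {a<..<b} \<longrightarrow> g x = f x"
      and [measurable]: "\<psi> \<in> borel_measurable borel" for g f \<psi> :: "real \<Rightarrow> real"
  proof (rule integral_lebesgue_on_of_borel(2))
    note [measurable] = borel_measurable_integrable[OF f(1), simplified]
    show "(\<lambda>x. f x * \<psi> x) \<in> borel_measurable borel" by measurable
    show "AE x in lborel. x \<in> {a<..<b} \<longrightarrow> g x * \<psi> x = f x * \<psi> x"
      using f(3) by eventually_elim auto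
  qed (use f(2) in auto)
  note * = this[OF f] this[OF k]
  show ?thesis
    using * test_function_measurable
      locally_integrable_of_representative[OF f(1,3)] locally_integrable_of_representative[OF k(1,3)]
    unfolding has_weak_deriv_def by auto
qed

text \<open>
The difference of \<open>f\<close> and the primitive of its weak derivative has weak derivative zero, so it is
a constant. Along a sequence of points that tends to \<open>0\<close> both the continuous representative and
the primitive tend to \<open>0\<close>, so the constant is \<open>0\<close>.
\<close>
lemma vanishing_at_zero_imp_primitive:
  assumes T: "0 < T"
    and f: "integrable lborel f" "\<And>x. x \<notin> {0<..<T} \<Longrightarrow> f x = 0"
    and h: "integrable lborel h" "\<And>x. x \<notin> {0<..<T} \<Longrightarrow> h x = 0"
    and weak: "\<And>\<phi>. test_function 0 T \<phi> \<Longrightarrow> (LINT x|lborel. f x * deriv \<phi> x) = - (LINT x|lborel. h x * \<phi> x)"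
    and u: "continuous_on {0..T} u" "u 0 = 0" "AE x in lborel. x \<in> {0<..<T} \<longrightarrow> u x = f x"
  shows "AE x in lborel. x \<in> {0<..<T} \<longrightarrow> f x = primitive h x"
proof -
  define p where "p x = indicator {0<..<T} x * primitive h x" for x
  have p: "integrable lborel p"
    unfolding p_def using h(1) T by (rule integrable_indicator_primitive)
  have "\<exists>C. AE x in lborel. x \<in> {0<..<T} \<longrightarrow> f x - p x = C"
  proof (rule zero_weak_derivative_imp_AE_constant[OF _ T])
    show "integrable lborel (\<lambda>x. f x - p x)" using f(1) p by simp
    fix \<phi> assume \<phi>: "test_function 0 T \<phi>"
    obtain l r where lr: "0 < l" "r < T" and z: "\<And>x. x \<notin> {l..r} \<Longrightarrow> deriv \<phi> x = 0"
      using test_function_support[OF T \<phi>] by metis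
    have int: "integrable lborel (\<lambda>x. q x * deriv \<phi> x)" if "integrable lborel q" for q
      by (rule integrable_mult_test_function[OF that test_function_continuous(2)[OF \<phi>] z])
    have "(LINT x|lborel. (f x - p x) * deriv \<phi> x)
        = (LINT x|lborel. f x * deriv \<phi> x) - (LINT x|lborel. p x * deriv \<phi> x)"
      using int[OF f(1)] int[OF p] by (simp add: left_diff_distrib)
    also have "(LINT x|lborel. p x * deriv \<phi> x) = (LINT x|lborel. primitive h x * deriv \<phi> x)"
    proof (rule Bochner_Integration.integral_cong[OF refl])
      fix x
      show "p x * deriv \<phi> x = primitive h x * deriv \<phi> x"
        using z[of x] lr by (cases "x \<in> {l..r}") (auto simp: p_def)
    qed
    also have "\<dots> = - (LINT x|lborel. h x * \<phi> x)"
      by (rule integral_primitive_deriv[OF h(1) \<phi> T])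
    finally show "(LINT x|lborel. (f x - p x) * deriv \<phi> x) = 0"
      using weak[OF \<phi>] by simp
  qed
  then obtain C where C: "AE x in lborel. x \<in> {0<..<T} \<longrightarrow> f x - p x = C" by blast
  have "\<exists>x. 0 < x \<and> x < T / real (Suc i) \<and> u x = primitive h x + C" for i :: nat
  proof (rule ccontr)
    assume not: "\<nexists>x. 0 < x \<and> x < T / real (Suc i) \<and> u x = primitive h x + C"
    have sub: "T / real (Suc i) \<le> T" using T by (simp add: divide_le_eq)
    have "AE x in lborel. x \<notin> {0<..<T / real (Suc i)}"
      using C u(3)
    proof eventually_elim
      case (elim x)
      show ?case
      proof
        assume x: "x \<in> {0<..<T / real (Suc i)}"
        then have "x \<in> {0<..<T}" using sub by auto
        then have "u x = primitive h x + C" using elim by (simp add: p_def)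
        then show False using not x by auto
      qed
    qed
    then have "emeasure lborel {0<..<T / real (Suc i)} = 0"
      by (subst (asm) AE_iff_null_sets[symmetric]) auto
    then show False using T by simp
  qed
  then obtain x where x: "\<And>i. 0 < x i" "\<And>i. x i < T / real (Suc i)" "\<And>i. u (x i) = primitive h (x i) + C"
    by metis
  have x0: "x \<longlonglongrightarrow> 0"
  proof (rule tendsto_sandwich[OF always_eventually always_eventually tendsto_const])
    show "\<forall>i. 0 \<le> x i" "\<forall>i. x i \<le> T / real (Suc i)" using x by (auto intro: less_imp_le)
    show "(\<lambda>i. T / real (Suc i)) \<longlonglongrightarrow> 0" by (rule LIMSEQ_Suc[OF lim_const_over_n])
  qed
  have xT: "x i \<in> {0..T}" for i
  proof -
    have "T / real (Suc i) \<le> T" using T by (simp add: divide_le_eq)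
    then show ?thesis using x(1,2)[of i] by auto
  qed
  have "(\<lambda>i. u (x i)) \<longlonglongrightarrow> u 0"
    by (rule continuous_on_tendsto_compose[OF u(1) x0]) (use T xT in auto)
  moreover have "(\<lambda>i. primitive h (x i)) \<longlonglongrightarrow> (LINT t|(lborel :: real measure). 0)"
    unfolding primitive_def
  proof (rule integral_dominated_convergence[where w="\<lambda>t. \<bar>h t\<bar>"])
    show "AE t in lborel. (\<lambda>i. if t \<le> x i then h t else 0) \<longlonglongrightarrow> 0"
    proof (rule AE_I2)
      fix t
      show "(\<lambda>i. if t \<le> x i then h t else 0) \<longlonglongrightarrow> 0"
      proof (cases "0 < t")
        case True
        have "\<forall>\<^sub>F i in sequentially. x i < t" by (rule order_tendstoD(2)[OF x0 True])
        then have "\<forall>\<^sub>F i in sequentially. (if t \<le> x i then h t else 0) = 0"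
          by eventually_elim auto
        then show ?thesis by (rule tendsto_eventually)
      next
        case False
        then have "h t = 0" using h(2)[of t] by simp
        then have "(\<lambda>i. if t \<le> x i then h t else 0) = (\<lambda>i. 0)" by auto
        then show ?thesis by simp
      qed
    qed
    show "(\<lambda>t. if t \<le> x i then h t else 0) \<in> borel_measurable lborel" for i
      using borel_measurable_integrable[OF primitive_integrable[OF h(1)]] .
  qed (use h(1) in auto)
  ultimately have "(\<lambda>i. u (x i) - primitive h (x i)) \<longlonglongrightarrow> 0 - 0"
    using u(2) by (intro tendsto_diff) simp_all
  then have "C = 0"
    using LIMSEQ_unique[of "\<lambda>i. C" C 0] by (simp add: x(3))
  with C show ?thesis by (auto elim!: AE_mp simp: p_def)
qed

lemma conv_cong_AE:
  assumes [measurable]: "n \<in> borel_measurable borel" "f \<in> borel_measurable borel" "p \<in> borel_measurable borel"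
    and n0: "\<And>s. s \<notin> {0<..<T} \<Longrightarrow> n s = 0"
    and f0: "\<And>x. x \<le> 0 \<Longrightarrow> f x = p x"
    and ae: "AE x in lborel. x \<in> {0<..<T} \<longrightarrow> f x = p x"
    and x: "x < T"
  shows "conv n f x = conv n p x"
  unfolding conv_def
proof (rule integral_cong_AE)
  have "AE s in lborel. x + (-1) * s \<in> {0<..<T} \<longrightarrow> f (x + (-1) * s) = p (x + (-1) * s)"
    using ae by (rule AE_lborel_affine) simp
  then show "AE s in lborel. n s * f (x - s) = n s * p (x - s)"
  proof eventually_elim
    case (elim s)
    show ?case
      using elim n0[of s] f0[of "x - s"] x by (cases "s \<in> {0<..<T}"; cases "x - s \<le> 0") auto
  qed
qed auto

text \<open>
With \<open>f = primitive k\<close> almost everywhere, \<open>conv n f = primitive (conv n k)\<close>, and a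
primitive has the expected weak derivative. The condition \<open>u 0 = 0\<close> is essential: otherwise
\<open>u 0\<close> times the kernel would appear in the derivative.
\<close>
lemma J_weak_derivative:
  assumes T: "0 < T" and \<nu>: "positive_kernel T \<nu>"
    and g: "g \<in> L2_space 0 T" and h: "h \<in> L2_space 0 T" and gh: "has_weak_deriv 0 T g h"
    and u: "continuous_rep 0 T g u" "u 0 = 0"
  shows "has_weak_deriv 0 T (J \<nu> g) (J \<nu> h)"
proof -
  obtain n where n: "n \<in> borel_measurable borel" "\<And>x. x \<notin> {0<..<T} \<Longrightarrow> n x = 0"
    "AE x in lborel. x \<in> {0<..<T} \<longrightarrow> \<nu> x = n x" "\<And>x. 0 \<le> n x" "integrable lborel n"
    "ennreal (N \<nu> T) = (\<integral>\<^sup>+s. ennreal (n s) \<partial>lborel)" "0 \<le> N \<nu> T"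
    using kernel_representative[OF \<nu>] by blast
  obtain f where f: "f \<in> borel_measurable borel" "\<And>x. x \<notin> {0<..<T} \<Longrightarrow> f x = 0"
    "AE x in lborel. x \<in> {0<..<T} \<longrightarrow> g x = f x"
    using L2_representative[OF g] by blast
  obtain k where k: "k \<in> borel_measurable borel" "\<And>x. x \<notin> {0<..<T} \<Longrightarrow> k x = 0"
    "AE x in lborel. x \<in> {0<..<T} \<longrightarrow> h x = k x"
    using L2_representative[OF h] by blast
  have fi: "integrable lborel f" and ki: "integrable lborel k"
    using square_integrable_imp_integrable[OF f(1,2)] square_integrable_imp_integrable[OF k(1,2)] T g h
      L2_space_iff_representative(1)[OF f] L2_space_iff_representative(1)[OF k] by simp_all
  note [measurable] = n(1) f(1) k(1)
  have uf: "AE x in lborel. x \<in> {0<..<T} \<longrightarrow> u x = f x"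
  proof -
    have "AE x in lborel. x \<in> {0<..<T} \<longrightarrow> u x = g x"
      using u(1) by (simp add: continuous_rep_def AE_lebesgue_on_iff)
    with f(3) show ?thesis by eventually_elim auto
  qed
  have fp: "AE x in lborel. x \<in> {0<..<T} \<longrightarrow> f x = primitive k x"
  proof (rule vanishing_at_zero_imp_primitive[OF T fi f(2) ki k(2) _ _ u(2) uf])
    show "continuous_on {0..T} u" using u(1) by (simp add: continuous_rep_def)
    show "(LINT x|lborel. f x * deriv \<phi> x) = - (LINT x|lborel. k x * \<phi> x)" if "test_function 0 T \<phi>" for \<phi>
      using has_weak_deriv_iff_representatives[OF fi f(2,3) ki k(2,3)] gh that by blast
  qed
  \<comment> \<open>\<open>conv n k\<close> may be nonzero beyond \<open>T\<close>, so it is cut off; on \<open>x < T\<close> nothing changes.\<close>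
  define c where "c x = indicator {0<..<T} x * conv n k x" for x
  have ci: "integrable lborel c"
    unfolding c_def using integrable_mult_indicator[OF _ conv_integrable[OF n(5) ki], of "{0<..<T}"] by simp
  have c_eq: "conv n k x = c x" if "x < T" for x
  proof (cases "0 < x")
    case False
    have "(\<lambda>s. n s * k (x - s)) = (\<lambda>s. 0)"
    proof
      fix s
      show "n s * k (x - s) = 0"
        using n(2)[of s] k(2)[of "x - s"] False by (cases "0 < s") auto
    qed
    then show ?thesis using False by (simp add: conv_def c_def)
  qed (use that in \<open>simp add: c_def\<close>)
  have Jp: "J \<nu> g x = primitive c x" if x: "x \<in> {0<..<T}" for x
  proof -
    have "J \<nu> g x = conv n f x"
      by (rule J_eq_conv[OF n(1-3) f]) (use x in auto)
    also have "\<dots> = conv n (primitive k) x"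
    proof (rule conv_cong_AE[OF _ _ _ n(2) _ fp])
      fix y :: real assume y: "y \<le> 0"
      then have "(\<lambda>t. if t \<le> y then k t else 0) = (\<lambda>t. 0)"
        using k(2) by fastforce
      then show "f y = primitive k y"
        using y f(2)[of y] by (simp add: primitive_def)
    qed (use x in auto)
    also have "\<dots> = primitive (conv n k) x"
      by (simp add: conv_primitive[OF n(5) ki])
    also have "\<dots> = primitive c x"
      unfolding primitive_def using x c_eq by (intro Bochner_Integration.integral_cong) auto
    finally show ?thesis .
  qed
  define q where "q x = indicator {0<..<T} x * primitive c x" for x
  have q: "integrable lborel q" "\<And>x. x \<notin> {0<..<T} \<Longrightarrow> q x = 0"
    unfolding q_def using integrable_indicator_primitive[OF ci T] by auto
  have Jq: "AE x in lborel. x \<in> {0<..<T} \<longrightarrow> J \<nu> g x = q x"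
    using Jp by (intro AE_I2) (simp add: q_def)
  have Jc: "AE x in lborel. x \<in> {0<..<T} \<longrightarrow> J \<nu> h x = c x"
    unfolding c_def by (rule J_representative[OF n(1-3) k])
  have c0: "c x = 0" if "x \<notin> {0<..<T}" for x
    using that by (simp add: c_def)
  have "has_weak_deriv 0 T (J \<nu> g) (J \<nu> h) \<longleftrightarrow> (\<forall>\<phi>. test_function 0 T \<phi> \<longrightarrow>
      (LINT x|lborel. q x * deriv \<phi> x) = - (LINT x|lborel. c x * \<phi> x))"
    by (rule has_weak_deriv_iff_representatives[OF q Jq ci c0 Jc])
  moreover have "\<forall>\<phi>. test_function 0 T \<phi> \<longrightarrow>
      (LINT x|lborel. q x * deriv \<phi> x) = - (LINT x|lborel. c x * \<phi> x)"
  proof (intro allI impI)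
    fix \<phi> assume \<phi>: "test_function 0 T \<phi>"
    obtain l r where lr: "0 < l" "r < T" and z: "\<And>x. x \<notin> {l..r} \<Longrightarrow> deriv \<phi> x = 0"
      using test_function_support[OF T \<phi>] by metis
    have "(LINT x|lborel. q x * deriv \<phi> x) = (LINT x|lborel. primitive c x * deriv \<phi> x)"
    proof (rule Bochner_Integration.integral_cong[OF refl])
      fix x
      show "q x * deriv \<phi> x = primitive c x * deriv \<phi> x"
        using z[of x] lr by (cases "x \<in> {l..r}") (auto simp: q_def)
    qed
    then show "(LINT x|lborel. q x * deriv \<phi> x) = - (LINT x|lborel. c x * \<phi> x)"
      using integral_primitive_deriv[OF ci \<phi> T] by simp
  qed
  ultimately show ?thesis by blast
qed

lemma L2_norm_sq_cong_AE:
  assumes ae: "AE x in lborel. x \<in> {a<..<b} \<longrightarrow> g x = h x" and h: "h \<in> L2_space a b"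
  shows "g \<in> L2_space a b" and "L2_norm_sq a b g = L2_norm_sq a b h"
proof -
  obtain f where f: "f \<in> borel_measurable borel" "\<And>x. x \<notin> {a<..<b} \<Longrightarrow> f x = 0"
    "AE x in lborel. x \<in> {a<..<b} \<longrightarrow> h x = f x"
    using L2_representative[OF h] by blast
  have gf: "AE x in lborel. x \<in> {a<..<b} \<longrightarrow> g x = f x"
    using ae f(3) by eventually_elim auto
  show g: "g \<in> L2_space a b"
    using h L2_space_iff_representative(1)[OF f] L2_space_iff_representative(1)[OF f(1,2) gf] by simp
  have "ennreal (L2_norm_sq a b g) = ennreal (L2_norm_sq a b h)"
    using L2_space_iff_representative(2)[OF f h] L2_space_iff_representative(2)[OF f(1,2) gf g] by simp
  then show "L2_norm_sq a b g = L2_norm_sq a b h"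
    by (simp add: L2_norm_sq_nonneg)
qed

lemma L2_norm_sq_weak_deriv:
  assumes "has_weak_deriv a b g h" and h: "h \<in> L2_space a b"
  shows "L2_norm_sq a b (weak_deriv a b g) = L2_norm_sq a b h"
proof (rule L2_norm_sq_cong_AE(2)[OF _ h])
  have "has_weak_deriv a b g (weak_deriv a b g)"
    unfolding weak_deriv_def using someI[of "\<lambda>h. has_weak_deriv a b g h", OF assms(1)] by simp
  then show "AE x in lborel. x \<in> {a<..<b} \<longrightarrow> weak_deriv a b g x = h x"
    using assms(1) by (rule weak_derivative_unique)
qed

text \<open>
\<open>J \<nu>\<close> acts on the weak derivative as it does on the function, so the \<open>L\<^sup>2\<close> bound
applies to both, with constant \<open>1\<close>.
\<close>
lemma J_H1:
  assumes T: "0 < T" and \<nu>: "positive_kernel T \<nu>" and g: "g \<in> H_space 1 0 T"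
    and u: "continuous_rep 0 T g u" "u 0 = 0"
  shows "J \<nu> g \<in> H_space 1 0 T \<and> H_norm 1 0 T (J \<nu> g) \<le> N \<nu> T * H_norm 1 0 T g"
proof -
  obtain h where gL2: "g \<in> L2_space 0 T" and h: "h \<in> L2_space 0 T" and gh: "has_weak_deriv 0 T g h"
    using g by (auto simp: H_space_def)
  note JgL2 = J_L2[OF \<nu> gL2] and JhL2 = J_L2[OF \<nu> h]
  have Jgh: "has_weak_deriv 0 T (J \<nu> g) (J \<nu> h)"
    by (rule J_weak_derivative[OF T \<nu> gL2 h gh u])
  have N0: "0 \<le> N \<nu> T" using kernel_representative[OF \<nu>] by metis
  have "L2_norm_sq 0 T (J \<nu> g) + L2_norm_sq 0 T (weak_deriv 0 T (J \<nu> g))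
      \<le> (N \<nu> T)\<^sup>2 * L2_norm_sq 0 T g + (N \<nu> T)\<^sup>2 * L2_norm_sq 0 T (weak_deriv 0 T g)"
    unfolding L2_norm_sq_weak_deriv[OF Jgh JhL2(1)] L2_norm_sq_weak_deriv[OF gh h]
    by (intro add_mono JgL2 JhL2)
  also have "\<dots> = (N \<nu> T)\<^sup>2 * (L2_norm_sq 0 T g + L2_norm_sq 0 T (weak_deriv 0 T g))"
    by (simp add: distrib_left)
  finally have "sqrt (L2_norm_sq 0 T (J \<nu> g) + L2_norm_sq 0 T (weak_deriv 0 T (J \<nu> g)))
      \<le> sqrt ((N \<nu> T)\<^sup>2 * (L2_norm_sq 0 T g + L2_norm_sq 0 T (weak_deriv 0 T g)))"
    by (rule real_sqrt_le_mono)
  then have "H_norm 1 0 T (J \<nu> g) \<le> N \<nu> T * H_norm 1 0 T g"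
    using N0 by (simp add: H_norm_def real_sqrt_mult)
  then show ?thesis
    using JgL2(1) JhL2(1) Jgh by (auto simp: H_space_def)
qed

theorem theorem5p1:
  fixes T \<theta> :: real
  assumes "T > 0" and "0 \<le> \<theta>" and "\<theta> \<le> 1"
  shows
    "(\<theta> < 1/2 \<longrightarrow>
       (\<exists>c>0. \<forall>\<nu>. positive_kernel T \<nu> \<longrightarrow>
          (\<forall>g \<in> H_space \<theta> 0 T.
             J \<nu> g \<in> H_space \<theta> 0 T \<and>
             H_norm \<theta> 0 T (J \<nu> g) \<le> c * N \<nu> T * H_norm \<theta> 0 T g))) \<and>
     (\<theta> > 1/2 \<longrightarrow>
       (\<exists>c>0. \<forall>\<nu>. positive_kernel T \<nu> \<longrightarrow>
          (\<forall>g \<in> H_space \<theta> 0 T. \<forall>u. continuous_rep 0 T g u \<and> u 0 = 0 \<longrightarrow>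
             J \<nu> g \<in> H_space \<theta> 0 T \<and>
             H_norm \<theta> 0 T (J \<nu> g) \<le> c * N \<nu> T * H_norm \<theta> 0 T g)))"
proof (intro conjI impI)
  assume lt: "\<theta> < 1/2"
  show "\<exists>c>0. \<forall>\<nu>. positive_kernel T \<nu> \<longrightarrow>
          (\<forall>g \<in> H_space \<theta> 0 T.
             J \<nu> g \<in> H_space \<theta> 0 T \<and>
             H_norm \<theta> 0 T (J \<nu> g) \<le> c * N \<nu> T * H_norm \<theta> 0 T g)"
  proof (cases "\<theta> = 0")
    case True
    have "H_norm 0 0 T (J \<nu> g) \<le> 1 * N \<nu> T * H_norm 0 0 T g"
      if \<nu>: "positive_kernel T \<nu>" and g: "g \<in> L2_space 0 T" for \<nu> g
    proof -
      have "0 \<le> N \<nu> T" using kernel_representative[OF \<nu>] by metis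
      then show ?thesis
        using real_sqrt_le_mono[OF J_L2(2)[OF \<nu> g]] by (simp add: H_norm_def real_sqrt_mult)
    qed
    then show ?thesis
      using J_L2(1) unfolding True by (intro exI[of _ 1]) (auto simp: H_space_def)
  next
    case False
    then have th: "0 < \<theta>" "\<theta> < 1" using assms lt by auto
    define A where "A = 8 powr (1 / (1 - 2 * \<theta>))"
    define c1 where "c1 = 2 / A * (2 * A) powr (1 + 2 * \<theta>)"
    define c2 where "c2 = (T / (2 * A)) powr (-2 * \<theta>)"
    \<comment> \<open>One constant for the seminorm and the \<open>L\<^sup>2\<close> part, so that the bound is a multiple of the squared norm.\<close>
    define c3 where "c3 = max c1 c2"
    define C where "C = 2 * c3"
    have c: "0 \<le> c3" "c1 \<le> c3" "c2 \<le> c3" by (simp_all add: c1_def c2_def c3_def A_def le_max_iff_disj)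
    then have C: "0 \<le> C" by (simp add: C_def)
    have "J \<nu> g \<in> H_space \<theta> 0 T \<and> H_norm \<theta> 0 T (J \<nu> g) \<le> sqrt (1 + C / \<theta>) * N \<nu> T * H_norm \<theta> 0 T g"
      if \<nu>: "positive_kernel T \<nu>" and g: "g \<in> H_space \<theta> 0 T" for \<nu> g
    proof -
      have gL2: "g \<in> L2_space 0 T" using g th by (simp add: H_space_def)
      obtain f where f: "f \<in> borel_measurable borel" "\<And>x. x \<notin> {0<..<T} \<Longrightarrow> f x = 0"
        "AE x in lborel. x \<in> {0<..<T} \<longrightarrow> g x = f x"
        using L2_representative[OF gL2] by blast
      define S where "S = (\<integral>\<^sup>+x. ennreal ((f x)\<^sup>2) \<partial>lborel)"
      define G where "G = gagliardo_sq \<theta> 0 T f"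
      have "(\<integral>\<^sup>+x. ennreal ((f x)\<^sup>2 * x powr (-2 * \<theta>)) \<partial>lborel) \<le> 2 * (ennreal c1 * G + ennreal c2 * S)"
        unfolding c1_def c2_def G_def S_def
        by (rule hardy_below_half[OF f(1,2) assms(1) th(1) lt _ A_def])
          (use gL2 L2_space_iff_representative(1)[OF f] in auto)
      also have "\<dots> \<le> 2 * (ennreal c3 * G + ennreal c3 * S)"
        using c by (intro mult_left_mono add_mono mult_right_mono ennreal_leI) auto
      also have "\<dots> = ennreal C * (G + S)"
        unfolding C_def using c by (subst ennreal_mult) (auto simp: distrib_left mult.assoc)
      finally show ?thesis
        unfolding G_def S_def using J_fractional[OF assms(1) th C \<nu> g f] by blast
    qed
    moreover have "0 < sqrt (1 + C / \<theta>)" using C th by (simp add: add_pos_nonneg)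
    ultimately show ?thesis by blast
  qed
next
  assume gt: "\<theta> > 1/2"
  show "\<exists>c>0. \<forall>\<nu>. positive_kernel T \<nu> \<longrightarrow>
          (\<forall>g \<in> H_space \<theta> 0 T. \<forall>u. continuous_rep 0 T g u \<and> u 0 = 0 \<longrightarrow>
             J \<nu> g \<in> H_space \<theta> 0 T \<and>
             H_norm \<theta> 0 T (J \<nu> g) \<le> c * N \<nu> T * H_norm \<theta> 0 T g)"
  proof (cases "\<theta> = 1")
    case True
    then show ?thesis
      using J_H1[OF assms(1)] by (intro exI[of _ 1]) auto
  next
    case False
    then have th: "0 < \<theta>" "\<theta> < 1" using assms gt by auto
    define C where "C = 2 + 2 / (\<theta> - 1/2)\<^sup>2"
    have C: "0 \<le> C" by (simp add: C_def)
    have "J \<nu> g \<in> H_space \<theta> 0 T \<and> H_norm \<theta> 0 T (J \<nu> g) \<le> sqrt (1 + C / \<theta>) * N \<nu> T * H_norm \<theta> 0 T g"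
      if \<nu>: "positive_kernel T \<nu>" and g: "g \<in> H_space \<theta> 0 T"
        and u: "continuous_rep 0 T g u" "u 0 = 0" for \<nu> g u
    proof -
      have uc: "continuous_on {0..T} u" and ae: "AE x in lborel. x \<in> {0<..<T} \<longrightarrow> u x = g x"
        using u(1) by (simp_all add: continuous_rep_def AE_lebesgue_on_iff)
      define f where "f = (\<lambda>x. if x \<in> {0<..<T} then u x else 0)"
      have "continuous_on {0<..<T} u" by (rule continuous_on_subset[OF uc]) auto
      then have "f \<in> borel_measurable borel"
        unfolding f_def by (intro borel_measurable_continuous_on_if) simp_all
      moreover have "f x = 0" if "x \<notin> {0<..<T}" for x
        using that by (simp only: f_def if_False)
      moreover have "AE x in lborel. x \<in> {0<..<T} \<longrightarrow> g x = f x"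
        using ae by eventually_elim (simp add: f_def)
      ultimately have f: "f \<in> borel_measurable borel" "\<And>x. x \<notin> {0<..<T} \<Longrightarrow> f x = 0"
        "AE x in lborel. x \<in> {0<..<T} \<longrightarrow> g x = f x" by blast+
      have "(\<integral>\<^sup>+x. ennreal ((f x)\<^sup>2 * x powr (-2 * \<theta>)) \<partial>lborel) \<le> ennreal C * gagliardo_sq \<theta> 0 T f"
        unfolding C_def by (rule hardy_above_half[OF assms(1) gt uc u(2) f_def])
      also have "\<dots> \<le> ennreal C * (gagliardo_sq \<theta> 0 T f + (\<integral>\<^sup>+x. ennreal ((f x)\<^sup>2) \<partial>lborel))"
        by (intro mult_left_mono) auto
      finally show ?thesis
        using J_fractional[OF assms(1) th C \<nu> g f] by blast
    qed
    moreover have "0 < sqrt (1 + C / \<theta>)" using C th by (simp add: add_pos_nonneg)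
    ultimately show ?thesis by blast
  qed
qed

end
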